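(* Let $\mathbb{K}$ be a commutative unital ring, $V$ a $\mathbb{K}$-module, $U\subset V$ a non-empty subset, and $n\in\mathbb{N}$; write $\mathsf{n}=\{1,\dots,n\}$. (1) By induction, the following (structure specified in the context) define $n$-fold groupoids: $$U^{\mathsf n}=U^{\{1,\ldots,n\}}:=((U^{\{1\}})^{\{2\}}\ldots)^{\{n\}},\qquad U^{\mathsf n}_{\mathrm{fin}}:=((U^{\{1\}}_{\mathrm{fin}})^{\{2\}}_{\mathrm{fin}}\ldots)^{\{n\}}_{\mathrm{fin}}.$$ (2) For each $\mathbf{t}=(t_1,\ldots,t_n)\in\mathbb{K}^n$, the following defines an $n$-fold groupoid: $$U^{\mathsf n}_{\mathbf t}:=((U^{\{1\}}_{t_1})^{\{2\}}_{t_2}\ldots)^{\{n\}}_{t_n}.$$ The top vertex set $U^{\mathsf n;\mathsf n}$ of $U^{\mathsf n}$ agrees with the $n$-th order extended domain: $U^{\mathsf n;\mathsf n}=U^{[n]}$. Every map $f:U\to U'$ into a non-empty subset $U'$ of a $\mathbb{K}$-module $V'$ induces morphisms of $n$-fold groupoids $$f^{\mathsf n}_{\mathrm{fin}}:=((f^{\{1\}}_{\mathrm{fin}})^{\{2\}}_{\mathrm{fin}}\ldots)^{\{n\}}_{\mathrm{fin}}:U^{\mathsf n}_{\mathrm{fin}}\to(U')^{\mathsf n}_{\mathrm{fin}},$$ $$f^{\mathsf n}_{\mathbf t}:=((f_{t_1})_{t_2}\ldots)_{t_n}:U^{\mathsf n}_{\mathbf t}\to(U')^{\mathsf n}_{\mathbf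 t},$$ the latter under the condition that $t_i\in\mathbb{K}^\times$ for all $i=1,\ldots,n$.
   Context: $n$-fold groupoids. An $n$-fold groupoid is a family of sets (vertex sets) $(G^A)_{A\subset\mathsf n}$ such that: for each $A\subset\mathsf n$ and $k\in A$, with $B=A\setminus\{k\}$, the pair $(G^A,G^B)$ carries a groupoid structure (morphisms $G^A$, objects $G^B$); and for each $A$ and distinct $j,k\in A$, the four sets $G^A,G^{A\setminus\{j\}},G^{A\setminus\{k\}},G^{A\setminus\{j,k\}}$ form a double groupoid: the source maps, the target maps and the unit maps in direction $j$ are functors for the direction-$k$ groupoids and vice versa, and the two products $\ast,\bullet$ on $G^A$ satisfy the interchange law $(a\bullet c)\ast(b\bullet d)=(a\ast b)\bullet(c\ast d)$ whenever $a\bullet c$, $b\bullet d$, $a\ast b$, $c\ast d$ are defined. The top vertex set is $G^{\mathsf n}$. A morphism is a family of maps $f^A:G^A\to H^A$ that is a functor on every pair $(G^A,G^{A\setminus\{k\}})$. First order. For a subset $Y$ of a $\mathbb{K}$-module $E$: $Y^{[1]}:=\{(x,v,t)\in E\times E\times\mathbb{K}\mid x\in Y,\ x+tv\in Y\}$ (a subset of the module $E\times E\times\mathbb{K}$), $Y^{[1]}_{\mathrm{fin}}:=\{(x,v,t)\in Y^{[1]}\mid t\in\mathbb{K}^\times\}$, $Y_t:=\{(x,v)\mid(x,v,t)\in Y^{[1]}\}$; inductively $Y^{[n]}:=(Y^{[n-1]})^{[1]}$. $Y^{\{1\}}$ is the groupoid $(Y^{[1]},Y\times\mathbb{K})$ with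 $\alpha(x,v,t)=(x,t)$, $\beta(x,v,t)=(x+tv,t)$, $1_{(x,t)}=(x,0,t)$, $(x+tv,v',t)\ast(x,v,t)=(x,v'+v,t)$, $(x,v,t)^{-1}=(x+tv,-v,t)$; $Y^{\{1\}}_{\mathrm{fin}}=(Y^{[1]}_{\mathrm{fin}},Y\times\mathbb{K}^\times)$ and $Y^{\{1\}}_t=(Y_t,Y)$ are given by the same formulae. For a map $f:Y\to Y'$: $f^{[1]}(x,v,t)=t^{-1}(f(x+tv)-f(x))$ for $t\in\mathbb{K}^\times$; $f^{\{1\}}_{\mathrm{fin}}(x,v,t)=(f(x),f^{[1]}(x,v,t),t)$ on morphisms, $f\times\mathrm{id}_{\mathbb{K}^\times}$ on objects; $f_t(x,v)=(f(x),f^{[1]}(x,v,t))$ on morphisms, $f$ on objects. All structure maps occurring below are built from projections, additions and scalar multiplications; for such maps $\varphi$ the difference quotient is extended to all $t\in\mathbb{K}$ by its formal polynomial expression, i.e. by the rules $\varphi^{[1]}(x,v,t)=\varphi(v)$ for $\varphi$ linear, $\varphi^{[1]}=0$ for $\varphi$ constant, $(\varphi+\psi)^{[1]}=\varphi^{[1]}+\psi^{[1]}$, and $(\lambda\varphi)^{[1]}(x,v,t)=\lambda^{[1]}\varphi(x)+\lambda(x)\varphi^{[1]}+t\lambda^{[1]}\varphi^{[1]}$ for scalar-valued $\lambda$; then $\varphi^{\{1\}}(x,v,t)=(\varphi(x),\varphi^{[1]}(x,v,t),t)$ and $\varphi_t(x,v)=(\varphi(x),\varphi^{[1]}(x,v,t))$.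 (For products, the set of composable pairs of $Y^{\{1\}}$ is parametrized by $\{(x,v,v',t)\in E^3\times\mathbb{K}\mid x,\ x+tv,\ x+t(v+v')\in Y\}$, and composable pairs of the extended groupoid are identified with the extension of the set of composable pairs.) Iteration. $\{k\}$ denotes a copy of the construction $\{1\}$, applied at step $k$. Given an $(k-1)$-fold groupoid $(L^B)_{B\subset\{1,\dots,k-1\}}$ so constructed, $L^{\{k\}}$ has vertex sets $G^{B\cup\{k\}}=(L^B)^{[1]}$ and $G^{B}=L^B\times\mathbb{K}$; the edges $(G^{B\cup\{k\}},G^B)$ carry the groupoid structure $(L^B)^{\{k\}}$, and each structure map $\varphi$ of $L$ is replaced by $\varphi^{\{k\}}$ on the vertices containing $k$ and by $\varphi\times\mathrm{id}_{\mathbb{K}}$ on those not containing $k$. For the version $\mathrm{fin}$ replace $(L^B)^{[1]}$, $\mathbb{K}$ by $(L^B)^{[1]}_{\mathrm{fin}}$, $\mathbb{K}^\times$; for fixed $t_k$, replace $(L^B)^{[1]}$ by $(L^B)_{t_k}$, $L^B\times\mathbb{K}$ by $L^B$, and $\varphi^{\{k\}}$, $\varphi\times\mathrm{id}$ by $\varphi_{t_k}$, $\varphi$. Iterated extensions of a map $f$ are formed in the same way. *)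

theory Defs
  imports "HOL-Algebra.Module"
begin

section \<open>Groupoids and n-fold groupoids\<close>

record 'a gmaps =
  gsrc :: "'a \<Rightarrow> 'a"
  gtgt :: "'a \<Rightarrow> 'a"
  gunit :: "'a \<Rightarrow> 'a"
  gmul :: "'a \<Rightarrow> 'a \<Rightarrow> 'a"
  ginv :: "'a \<Rightarrow> 'a"

text \<open>The product \<open>gmul S a b\<close> is defined iff the source of \<open>a\<close> is the target of \<open>b\<close>.\<close>

definition composable :: "'a set \<Rightarrow> 'a gmaps \<Rightarrow> 'a \<Rightarrow> 'a \<Rightarrow> bool" where
  "composable M S a b \<longleftrightarrow> a \<in> M \<and> b \<in> M \<and> gsrc S a = gtgt S b"

locale groupoid =
  fixes M Ob :: "'a set" and S :: "'a gmaps"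
  assumes src_closed: "a \<in> M \<Longrightarrow> gsrc S a \<in> Ob"
    and tgt_closed: "a \<in> M \<Longrightarrow> gtgt S a \<in> Ob"
    and unit_closed: "x \<in> Ob \<Longrightarrow> gunit S x \<in> M"
    and inv_closed: "a \<in> M \<Longrightarrow> ginv S a \<in> M"
    and mul_closed: "composable M S a b \<Longrightarrow> gmul S a b \<in> M"
    and src_unit: "x \<in> Ob \<Longrightarrow> gsrc S (gunit S x) = x"
    and tgt_unit: "x \<in> Ob \<Longrightarrow> gtgt S (gunit S x) = x"
    and src_mul: "composable M S a b \<Longrightarrow> gsrc S (gmul S a b) = gsrc S b"
    and tgt_mul: "composable M S a b \<Longrightarrow> gtgt S (gmul S a b) = gtgt S a"
    and mul_assoc: "composable M S a b \<Longrightarrow> composable M S b c \<Longrightarrow>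
      gmul S (gmul S a b) c = gmul S a (gmul S b c)"
    and mul_unit_right: "a \<in> M \<Longrightarrow> gmul S a (gunit S (gsrc S a)) = a"
    and mul_unit_left: "a \<in> M \<Longrightarrow> gmul S (gunit S (gtgt S a)) a = a"
    and src_inv: "a \<in> M \<Longrightarrow> gsrc S (ginv S a) = gtgt S a"
    and tgt_inv: "a \<in> M \<Longrightarrow> gtgt S (ginv S a) = gsrc S a"
    and inv_mul: "a \<in> M \<Longrightarrow> gmul S (ginv S a) a = gunit S (gsrc S a)"
    and mul_inv: "a \<in> M \<Longrightarrow> gmul S a (ginv S a) = gunit S (gtgt S a)"

definition groupoid_functor ::
  "'a set \<Rightarrow> 'a set \<Rightarrow> 'a gmaps \<Rightarrow> 'b set \<Rightarrow> 'b set \<Rightarrow> 'b gmaps \<Rightarrow> ('a \<Rightarrow> 'b) \<Rightarrow> ('a \<Rightarrow> 'b) \<Rightarrow> bool" where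
  "groupoid_functor M Ob S M' Ob' S' F F0 \<longleftrightarrow>
     F \<in> M \<rightarrow> M' \<and> F0 \<in> Ob \<rightarrow> Ob' \<and>
     (\<forall>a\<in>M. gsrc S' (F a) = F0 (gsrc S a) \<and> gtgt S' (F a) = F0 (gtgt S a)) \<and>
     (\<forall>x\<in>Ob. F (gunit S x) = gunit S' (F0 x)) \<and>
     (\<forall>a b. composable M S a b \<longrightarrow> F (gmul S a b) = gmul S' (F a) (F b))"

text \<open>\<open>edge G A k\<close> is only meaningful for \<open>k \<in> A\<close>: it holds the structure maps of the pair
  \<open>(vertex G A, vertex G (A - {k}))\<close>.\<close>

record 'a nfold =
  vertex :: "nat set \<Rightarrow> 'a set"
  edge :: "nat set \<Rightarrow> nat \<Rightarrow> 'a gmaps"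

text \<open>One half of the double groupoid condition: the source, target and unit maps in direction
  \<open>j\<close> are functors for the direction \<open>k\<close> groupoids.\<close>

definition functorial_along :: "'a nfold \<Rightarrow> nat set \<Rightarrow> nat \<Rightarrow> nat \<Rightarrow> bool" where
  "functorial_along G A j k \<longleftrightarrow>
    (let M = vertex G A; Mj = vertex G (A - {j}); Mk = vertex G (A - {k});
         Mjk = vertex G (A - {j, k});
         S = edge G A k; Sj = edge G (A - {j}) k
     in groupoid_functor M Mk S Mj Mjk Sj (gsrc (edge G A j)) (gsrc (edge G (A - {k}) j)) \<and>
        groupoid_functor M Mk S Mj Mjk Sj (gtgt (edge G A j)) (gtgt (edge G (A - {k}) j)) \<and>
        groupoid_functor Mj Mjk Sj M Mk S (gunit (edge G A j)) (gunit (edge G (A - {k}) j)))"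

definition interchange :: "'a set \<Rightarrow> 'a gmaps \<Rightarrow> 'a gmaps \<Rightarrow> bool" where
  "interchange M S T \<longleftrightarrow>
    (\<forall>a b c d. composable M T a c \<and> composable M T b d \<and> composable M S a b \<and> composable M S c d \<longrightarrow>
       gmul S (gmul T a c) (gmul T b d) = gmul T (gmul S a b) (gmul S c d))"

definition double_groupoid :: "'a nfold \<Rightarrow> nat set \<Rightarrow> nat \<Rightarrow> nat \<Rightarrow> bool" where
  "double_groupoid G A j k \<longleftrightarrow>
     functorial_along G A j k \<and> functorial_along G A k j \<and>
     interchange (vertex G A) (edge G A j) (edge G A k)"

definition nfold_groupoid :: "nat \<Rightarrow> 'a nfold \<Rightarrow> bool" where
  "nfold_groupoid n G \<longleftrightarrow>
     (\<forall>A\<subseteq>{1..n}. \<forall>k\<in>A. groupoid (vertex G A) (vertex G (A - {k})) (edge G A k)) \<and>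
     (\<forall>A\<subseteq>{1..n}. \<forall>j\<in>A. \<forall>k\<in>A. j \<noteq> k \<longrightarrow> double_groupoid G A j k)"

definition nfold_morphism :: "nat \<Rightarrow> 'a nfold \<Rightarrow> 'b nfold \<Rightarrow> (nat set \<Rightarrow> 'a \<Rightarrow> 'b) \<Rightarrow> bool" where
  "nfold_morphism n G H F \<longleftrightarrow>
     (\<forall>A\<subseteq>{1..n}. F A \<in> vertex G A \<rightarrow> vertex H A) \<and>
     (\<forall>A\<subseteq>{1..n}. \<forall>k\<in>A. groupoid_functor
        (vertex G A) (vertex G (A - {k})) (edge G A k)
        (vertex H A) (vertex H (A - {k})) (edge H A k) (F A) (F (A - {k})))"


section \<open>Iterated product modules\<close>

text \<open>The construction passes from a module \<open>E\<close> to \<open>E \<times> E \<times> K\<close>, \<open>E \<times> K\<close> or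
  \<open>E \<times> E\<close>, repeatedly. To have all these modules in one type, \<open>pt\<close> contains the elements of all
  finite iterated products of \<open>V\<close> and \<open>K\<close>, and a \<open>shape\<close> names one such product.
  The triple \<open>(x, v, t)\<close> is \<open>Tup x (Tup v (Scal t))\<close>.\<close>

datatype ('k, 'v) pt =
    Vec (the_vec: 'v)
  | Scal (the_scal: 'k)
  | Tup (fst_pt: "('k, 'v) pt") (snd_pt: "('k, 'v) pt")

datatype shape = ShV | ShK | ShProd shape shape

primrec pcarrier ::
  "('k, 'r) ring_scheme \<Rightarrow> ('k, 'v, 'm) module_scheme \<Rightarrow> shape \<Rightarrow> ('k, 'v) pt set" where
  "pcarrier R V ShV = Vec ` carrier V"
| "pcarrier R V ShK = Scal ` carrier R"
| "pcarrier R V (ShProd s s') = {Tup p q |p q. p \<in> pcarrier R V s \<and> q \<in> pcarrier R V s'}"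

primrec pzero :: "('k, 'r) ring_scheme \<Rightarrow> ('k, 'v, 'm) module_scheme \<Rightarrow> shape \<Rightarrow> ('k, 'v) pt" where
  "pzero R V ShV = Vec \<zero>\<^bsub>V\<^esub>"
| "pzero R V ShK = Scal \<zero>\<^bsub>R\<^esub>"
| "pzero R V (ShProd s s') = Tup (pzero R V s) (pzero R V s')"

fun padd :: "('k, 'r) ring_scheme \<Rightarrow> ('k, 'v, 'm) module_scheme \<Rightarrow>
    ('k, 'v) pt \<Rightarrow> ('k, 'v) pt \<Rightarrow> ('k, 'v) pt" where
  "padd R V (Vec x) (Vec y) = Vec (x \<oplus>\<^bsub>V\<^esub> y)"
| "padd R V (Scal a) (Scal b) = Scal (a \<oplus>\<^bsub>R\<^esub> b)"
| "padd R V (Tup p q) (Tup p' q') = Tup (padd R V p p') (padd R V q q')"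
| "padd R V _ _ = undefined"

primrec psmult :: "('k, 'r) ring_scheme \<Rightarrow> ('k, 'v, 'm) module_scheme \<Rightarrow>
    'k \<Rightarrow> ('k, 'v) pt \<Rightarrow> ('k, 'v) pt" where
  "psmult R V c (Vec x) = Vec (c \<odot>\<^bsub>V\<^esub> x)"
| "psmult R V c (Scal a) = Scal (c \<otimes>\<^bsub>R\<^esub> a)"
| "psmult R V c (Tup p q) = Tup (psmult R V c p) (psmult R V c q)"

text \<open>The fields \<open>mult\<close> and \<open>one\<close> of a module record carry no meaning.\<close>

definition pmod :: "('k, 'r) ring_scheme \<Rightarrow> ('k, 'v, 'm) module_scheme \<Rightarrow> shape \<Rightarrow>
    ('k, ('k, 'v) pt) module" where
  "pmod R V s = \<lparr>carrier = pcarrier R V s, mult = (\<lambda>_ _. undefined), one = undefined,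
     zero = pzero R V s, add = padd R V, smult = psmult R V\<rparr>"

lemma pmod_simps [simp]:
  "carrier (pmod R V s) = pcarrier R V s"
  "zero (pmod R V s) = pzero R V s"
  "add (pmod R V s) = padd R V"
  "smult (pmod R V s) = psmult R V"
  by (simp_all add: pmod_def)

lemma module_pmod:
  assumes "module R V"
  shows "module R (pmod R V s)"
proof -
  interpret module R V by fact
  have neg: "\<exists>y\<in>pcarrier R V s. padd R V y x = pzero R V s" if "x \<in> pcarrier R V s" for x s
    using that
  proof (induction s arbitrary: x)
    case ShV
    then obtain v where v: "v \<in> carrier V" "x = Vec v" by auto
    then show ?case by (auto intro!: bexI[of _ "\<ominus>\<^bsub>V\<^esub> v"] simp: M.l_neg)
  next
    case ShK
    then obtain v where v: "v \<in> carrier R" "x = Scal v" by auto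
    then show ?case by (auto intro!: bexI[of _ "\<ominus>\<^bsub>R\<^esub> v"] simp: R.l_neg)
  next
    case (ShProd s s')
    then obtain p q where pq: "p \<in> pcarrier R V s" "q \<in> pcarrier R V s'" "x = Tup p q" by auto
    then obtain p' q' where "p' \<in> pcarrier R V s" "padd R V p' p = pzero R V s"
      "q' \<in> pcarrier R V s'" "padd R V q' q = pzero R V s'"
      using ShProd.IH by blast
    with pq show ?case by (intro bexI[of _ "Tup p' q'"]) auto
  qed
  have cl: "padd R V x y \<in> pcarrier R V s"
    if "x \<in> pcarrier R V s" "y \<in> pcarrier R V s" for x y s
    using that by (induction s arbitrary: x y) auto
  have z: "pzero R V s \<in> pcarrier R V s" for s by (induction s) auto
  have assoc: "padd R V (padd R V x y) w = padd R V x (padd R V y w)"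
    if "x \<in> pcarrier R V s" "y \<in> pcarrier R V s" "w \<in> pcarrier R V s" for x y w s
    using that by (induction s arbitrary: x y w) (auto simp: M.a_assoc R.a_assoc)
  have comm: "padd R V x y = padd R V y x"
    if "x \<in> pcarrier R V s" "y \<in> pcarrier R V s" for x y s
    using that by (induction s arbitrary: x y) (auto simp: M.a_comm R.a_comm)
  have lz: "padd R V (pzero R V s) x = x" if "x \<in> pcarrier R V s" for x s
    using that by (induction s arbitrary: x) auto
  have scl: "psmult R V a x \<in> pcarrier R V s"
    if "a \<in> carrier R" "x \<in> pcarrier R V s" for a x s
    using that by (induction s arbitrary: x) auto
  have sl: "psmult R V (a \<oplus>\<^bsub>R\<^esub> b) x = padd R V (psmult R V a x) (psmult R V b x)"
    if "a \<in> carrier R" "b \<in> carrier R" "x \<in> pcarrier R V s" for a b x s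
    using that by (induction s arbitrary: x) (auto simp: smult_l_distr R.l_distr)
  have sr: "psmult R V a (padd R V x y) = padd R V (psmult R V a x) (psmult R V a y)"
    if "a \<in> carrier R" "x \<in> pcarrier R V s" "y \<in> pcarrier R V s" for a x y s
    using that by (induction s arbitrary: x y) (auto simp: smult_r_distr R.r_distr)
  have sa: "psmult R V (a \<otimes>\<^bsub>R\<^esub> b) x = psmult R V a (psmult R V b x)"
    if "a \<in> carrier R" "b \<in> carrier R" "x \<in> pcarrier R V s" for a b x s
    using that by (induction s arbitrary: x) (auto simp: smult_assoc1 R.m_assoc)
  have so: "psmult R V \<one>\<^bsub>R\<^esub> x = x" if "x \<in> pcarrier R V s" for x s
    using that by (induction s arbitrary: x) auto
  show ?thesis
  proof (rule moduleI)
    show "abelian_group (pmod R V s)"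
      by (rule abelian_groupI) (auto simp: cl z lz neg intro: assoc comm)
  qed (use is_cring scl sl sr sa so in auto)
qed


section \<open>Polynomial maps given by formal expressions\<close>

text \<open>An expression describes a map in one variable built from projections, additions and scalar
  multiplications. Its formal difference quotient depends on the expression and not only on
  the function it induces. A map of two arguments is an expression
  in the pair of its arguments.\<close>

datatype 'k expr =
    Var
  | Num 'k
  | Zero shape
  | Fst "'k expr"
  | Snd "'k expr"
  | PairE "'k expr" "'k expr"
  | Plus "'k expr" "'k expr"
  | Smul "'k expr" "'k expr"

primrec eval :: "('k, 'r) ring_scheme \<Rightarrow> ('k, 'v, 'm) module_scheme \<Rightarrow>
    'k expr \<Rightarrow> ('k, 'v) pt \<Rightarrow> ('k, 'v) pt" where
  "eval R V Var z = z"
| "eval R V (Num c) z = Scal c"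
| "eval R V (Zero s) z = pzero R V s"
| "eval R V (Fst e) z = fst_pt (eval R V e z)"
| "eval R V (Snd e) z = snd_pt (eval R V e z)"
| "eval R V (PairE d e) z = Tup (eval R V d z) (eval R V e z)"
| "eval R V (Plus d e) z = padd R V (eval R V d z) (eval R V e z)"
| "eval R V (Smul l e) z = psmult R V (the_scal (eval R V l z)) (eval R V e z)"

primrec subst :: "'k expr \<Rightarrow> 'k expr \<Rightarrow> 'k expr" where
  "subst Var x = x"
| "subst (Num c) x = Num c"
| "subst (Zero s) x = Zero s"
| "subst (Fst e) x = Fst (subst e x)"
| "subst (Snd e) x = Snd (subst e x)"
| "subst (PairE d e) x = PairE (subst d x) (subst e x)"
| "subst (Plus d e) x = Plus (subst d x) (subst e x)"
| "subst (Smul l e) x = Smul (subst l x) (subst e x)"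

text \<open>\<open>dquot e x v t\<close> is the formal difference quotient of \<open>e\<close> at \<open>(x, v, t)\<close>, where
  \<open>x\<close>, \<open>v\<close>, \<open>t\<close> are expressions in some new variable. Apart from the last, the cases
  express that linear maps are their own difference quotients and that constants have quotient 0;
  the last case is the product rule, with the \<open>t\<close>-term coming from the finite increments.
  For invertible \<open>t\<close> this agrees with the difference quotient \<open>diff_quot\<close> below.\<close>

primrec dquot :: "'k expr \<Rightarrow> 'k expr \<Rightarrow> 'k expr \<Rightarrow> 'k expr \<Rightarrow> 'k expr" where
  "dquot Var x v t = v"
| "dquot (Num c) x v t = Zero ShK"
| "dquot (Zero s) x v t = Zero s"
| "dquot (Fst e) x v t = Fst (dquot e x v t)"
| "dquot (Snd e) x v t = Snd (dquot e x v t)"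
| "dquot (PairE d e) x v t = PairE (dquot d x v t) (dquot e x v t)"
| "dquot (Plus d e) x v t = Plus (dquot d x v t) (dquot e x v t)"
| "dquot (Smul l e) x v t =
     Plus (Plus (Smul (dquot l x v t) (subst e x)) (Smul (subst l x) (dquot e x v t)))
          (Smul t (Smul (dquot l x v t) (dquot e x v t)))"

abbreviation Trip :: "'k expr \<Rightarrow> 'k expr \<Rightarrow> 'k expr \<Rightarrow> 'k expr" where
  "Trip x v t \<equiv> PairE x (PairE v t)"

abbreviation Mid :: "'k expr \<Rightarrow> 'k expr" where "Mid e \<equiv> Fst (Snd e)"
abbreviation Last :: "'k expr \<Rightarrow> 'k expr" where "Last e \<equiv> Snd (Snd e)"

record 'k gexprs =
  esrc :: "'k expr"
  etgt :: "'k expr"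
  eunit :: "'k expr"
  emul :: "'k expr"
  einv :: "'k expr"

definition interp :: "('k, 'r) ring_scheme \<Rightarrow> ('k, 'v, 'm) module_scheme \<Rightarrow>
    'k gexprs \<Rightarrow> ('k, 'v) pt gmaps" where
  "interp R V S = \<lparr>gsrc = eval R V (esrc S), gtgt = eval R V (etgt S),
     gunit = eval R V (eunit S), gmul = (\<lambda>a b. eval R V (emul S) (Tup a b)),
     ginv = eval R V (einv S)\<rparr>"

text \<open>A formal n-fold groupoid: vertex sets together with expressions for the structure maps.\<close>

record ('k, 'v) formal_nfold =
  fvertex :: "nat set \<Rightarrow> ('k, 'v) pt set"
  fedge :: "nat set \<Rightarrow> nat \<Rightarrow> 'k gexprs"

definition realize :: "('k, 'r) ring_scheme \<Rightarrow> ('k, 'v, 'm) module_scheme \<Rightarrow>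
    ('k, 'v) formal_nfold \<Rightarrow> ('k, 'v) pt nfold" where
  "realize R V L = \<lparr>vertex = fvertex L, edge = (\<lambda>A k. interp R V (fedge L A k))\<rparr>"

definition formal_base :: "'v set \<Rightarrow> ('k, 'v) formal_nfold" where
  "formal_base U = \<lparr>fvertex = (\<lambda>A. Vec ` U), fedge = (\<lambda>A k. undefined)\<rparr>"


section \<open>The construction with variable t\<close>

text \<open>For \<open>Y\<close> a subset of the module \<open>E\<close>: \<open>T = carrier R\<close> gives \<open>Y\<^sup>[\<^sup>1\<^sup>]\<close>,
  and \<open>T = Units R\<close> gives its finite part.\<close>

definition ext_dom :: "'k set \<Rightarrow> ('k, ('k, 'v) pt) module \<Rightarrow> ('k, 'v) pt set \<Rightarrow> ('k, 'v) pt set" where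
  "ext_dom T E Y = {Tup x (Tup v (Scal t)) |x v t.
     x \<in> Y \<and> v \<in> carrier E \<and> t \<in> T \<and> x \<oplus>\<^bsub>E\<^esub> t \<odot>\<^bsub>E\<^esub> v \<in> Y}"

text \<open>Structure maps of the first-order groupoid on a subset of a module of shape \<open>s\<close>. In the
  product, \<open>Fst Var = (x + t v, v', t)\<close> and \<open>Snd Var = (x, v, t)\<close>.\<close>

definition base_exprs :: "('k, 'r) ring_scheme \<Rightarrow> shape \<Rightarrow> 'k gexprs" where
  "base_exprs R s =
    \<lparr>esrc = PairE (Fst Var) (Last Var),
     etgt = PairE (Plus (Fst Var) (Smul (Last Var) (Mid Var))) (Last Var),
     eunit = Trip (Fst Var) (Zero s) (Snd Var),
     emul = Trip (Fst (Snd Var)) (Plus (Mid (Fst Var)) (Mid (Snd Var))) (Last (Snd Var)),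
     einv = Trip (Plus (Fst Var) (Smul (Last Var) (Mid Var)))
              (Smul (Num (\<ominus>\<^bsub>R\<^esub> \<one>\<^bsub>R\<^esub>)) (Mid Var)) (Last Var)\<rparr>"

definition ext_expr :: "'k expr \<Rightarrow> 'k expr \<Rightarrow> 'k expr \<Rightarrow> 'k expr \<Rightarrow> 'k expr" where
  "ext_expr e x v t = Trip (subst e x) (dquot e x v t) t"

text \<open>For the product, a composable pair \<open>((a', b', s), (a, b, s))\<close> of the extended groupoid
  is identified with the element \<open>((a', a), (b', b), s)\<close> of the extension of the set of composable
  pairs. The parametrization of that set by \<open>(x, v, v', t)\<close> is
  not needed: the product is already linear in the pair of its arguments, so both variables give
  the same formal difference quotient.\<close>

definition ext_exprs :: "'k gexprs \<Rightarrow> 'k gexprs" where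
  "ext_exprs S =
    (let ex = (\<lambda>e. ext_expr e (Fst Var) (Mid Var) (Last Var)) in
     \<lparr>esrc = ex (esrc S), etgt = ex (etgt S), eunit = ex (eunit S),
      emul = ext_expr (emul S) (PairE (Fst (Fst Var)) (Fst (Snd Var)))
               (PairE (Mid (Fst Var)) (Mid (Snd Var))) (Last (Snd Var)),
      einv = ex (einv S)\<rparr>)"

definition times_id_exprs :: "'k gexprs \<Rightarrow> 'k gexprs" where
  "times_id_exprs S =
    (let ti = (\<lambda>e. PairE (subst e (Fst Var)) (Snd Var)) in
     \<lparr>esrc = ti (esrc S), etgt = ti (etgt S), eunit = ti (eunit S),
      emul = PairE (subst (emul S) (PairE (Fst (Fst Var)) (Fst (Snd Var)))) (Snd (Snd Var)),
      einv = ti (einv S)\<rparr>)"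

text \<open>The shape of the module containing the vertex set of index \<open>A\<close> after \<open>n\<close> steps.\<close>

primrec ext_shape :: "nat \<Rightarrow> nat set \<Rightarrow> shape" where
  "ext_shape 0 A = ShV"
| "ext_shape (Suc n) A =
    (if Suc n \<in> A
     then let s = ext_shape n (A - {Suc n}) in ShProd s (ShProd s ShK)
     else ShProd (ext_shape n A) ShK)"

primrec formal_ext :: "('k, 'r) ring_scheme \<Rightarrow> ('k, 'v, 'm) module_scheme \<Rightarrow> 'k set \<Rightarrow>
    'v set \<Rightarrow> nat \<Rightarrow> ('k, 'v) formal_nfold" where
  "formal_ext R V T U 0 = formal_base U"
| "formal_ext R V T U (Suc n) =
    (let L = formal_ext R V T U n; k = Suc n in
     \<lparr>fvertex = (\<lambda>A.
        if k \<in> A then ext_dom T (pmod R V (ext_shape n (A - {k}))) (fvertex L (A - {k}))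
        else {Tup x (Scal t) |x t. x \<in> fvertex L A \<and> t \<in> T}),
      fedge = (\<lambda>A i.
        if i = k then base_exprs R (ext_shape n (A - {k}))
        else if k \<in> A then ext_exprs (fedge L (A - {k}) i)
        else times_id_exprs (fedge L A i))\<rparr>)"

definition full_ext where
  "full_ext R V U n = realize R V (formal_ext R V (carrier R) U n)"

definition fin_ext where
  "fin_ext R V U n = realize R V (formal_ext R V (Units R) U n)"


section \<open>The construction with fixed t\<close>

definition at_dom :: "'k \<Rightarrow> ('k, ('k, 'v) pt) module \<Rightarrow> ('k, 'v) pt set \<Rightarrow> ('k, 'v) pt set" where
  "at_dom t E Y = {Tup x v |x v. x \<in> Y \<and> v \<in> carrier E \<and> x \<oplus>\<^bsub>E\<^esub> t \<odot>\<^bsub>E\<^esub> v \<in> Y}"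

definition at_base_exprs :: "('k, 'r) ring_scheme \<Rightarrow> 'k \<Rightarrow> shape \<Rightarrow> 'k gexprs" where
  "at_base_exprs R t s =
    \<lparr>esrc = Fst Var,
     etgt = Plus (Fst Var) (Smul (Num t) (Snd Var)),
     eunit = PairE Var (Zero s),
     emul = PairE (Fst (Snd Var)) (Plus (Snd (Fst Var)) (Snd (Snd Var))),
     einv = PairE (Plus (Fst Var) (Smul (Num t) (Snd Var))) (Smul (Num (\<ominus>\<^bsub>R\<^esub> \<one>\<^bsub>R\<^esub>)) (Snd Var))\<rparr>"

definition at_exprs :: "'k \<Rightarrow> 'k gexprs \<Rightarrow> 'k gexprs" where
  "at_exprs t S =
    (let ex = (\<lambda>e x v. PairE (subst e x) (dquot e x v (Num t)));
         ex1 = (\<lambda>e. ex e (Fst Var) (Snd Var)) in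
     \<lparr>esrc = ex1 (esrc S), etgt = ex1 (etgt S), eunit = ex1 (eunit S),
      emul = ex (emul S) (PairE (Fst (Fst Var)) (Fst (Snd Var)))
               (PairE (Snd (Fst Var)) (Snd (Snd Var))),
      einv = ex1 (einv S)\<rparr>)"

primrec at_shape :: "nat \<Rightarrow> nat set \<Rightarrow> shape" where
  "at_shape 0 A = ShV"
| "at_shape (Suc n) A =
    (if Suc n \<in> A
     then let s = at_shape n (A - {Suc n}) in ShProd s s
     else at_shape n A)"

primrec formal_at :: "('k, 'r) ring_scheme \<Rightarrow> ('k, 'v, 'm) module_scheme \<Rightarrow> 'v set \<Rightarrow>
    (nat \<Rightarrow> 'k) \<Rightarrow> nat \<Rightarrow> ('k, 'v) formal_nfold" where
  "formal_at R V U t 0 = formal_base U"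
| "formal_at R V U t (Suc n) =
    (let L = formal_at R V U t n; k = Suc n in
     \<lparr>fvertex = (\<lambda>A.
        if k \<in> A then at_dom (t k) (pmod R V (at_shape n (A - {k}))) (fvertex L (A - {k}))
        else fvertex L A),
      fedge = (\<lambda>A i.
        if i = k then at_base_exprs R (t k) (at_shape n (A - {k}))
        else if k \<in> A then at_exprs (t k) (fedge L (A - {k}) i)
        else fedge L A i)\<rparr>)"

definition at_ext where
  "at_ext R V U t n = realize R V (formal_at R V U t n)"


section \<open>The n-th order extended domain\<close>

primrec iter_shape :: "nat \<Rightarrow> shape" where
  "iter_shape 0 = ShV"
| "iter_shape (Suc n) = ShProd (iter_shape n) (ShProd (iter_shape n) ShK)"

primrec iter_dom :: "('k, 'r) ring_scheme \<Rightarrow> ('k, 'v, 'm) module_scheme \<Rightarrow> 'v set \<Rightarrow> nat \<Rightarrow>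
    ('k, 'v) pt set" where
  "iter_dom R V U 0 = Vec ` U"
| "iter_dom R V U (Suc n) = ext_dom (carrier R) (pmod R V (iter_shape n)) (iter_dom R V U n)"


section \<open>Iterated extensions of a map\<close>

definition diff_quot :: "('k, 'r) ring_scheme \<Rightarrow> ('k, 'a, 'm) module_scheme \<Rightarrow>
    ('k, 'b, 'p) module_scheme \<Rightarrow> ('a \<Rightarrow> 'b) \<Rightarrow> 'a \<Rightarrow> 'a \<Rightarrow> 'k \<Rightarrow> 'b" where
  "diff_quot R E E' g x v t =
     inv\<^bsub>R\<^esub> t \<odot>\<^bsub>E'\<^esub> (g (x \<oplus>\<^bsub>E\<^esub> t \<odot>\<^bsub>E\<^esub> v) \<ominus>\<^bsub>E'\<^esub> g x)"

primrec fin_map :: "('k, 'r) ring_scheme \<Rightarrow> ('k, 'v, 'm) module_scheme \<Rightarrow>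
    ('k, 'w, 'p) module_scheme \<Rightarrow> ('v \<Rightarrow> 'w) \<Rightarrow> nat \<Rightarrow> nat set \<Rightarrow> ('k, 'v) pt \<Rightarrow> ('k, 'w) pt" where
  "fin_map R V V' f 0 A p = Vec (f (the_vec p))"
| "fin_map R V V' f (Suc n) A p =
    (if Suc n \<in> A
     then let B = A - {Suc n}; g = fin_map R V V' f n B;
              x = fst_pt p; v = fst_pt (snd_pt p); t = the_scal (snd_pt (snd_pt p))
          in Tup (g x) (Tup (diff_quot R (pmod R V (ext_shape n B)) (pmod R V' (ext_shape n B)) g x v t)
               (Scal t))
     else Tup (fin_map R V V' f n A (fst_pt p)) (Scal (the_scal (snd_pt p))))"

primrec at_map :: "('k, 'r) ring_scheme \<Rightarrow> ('k, 'v, 'm) module_scheme \<Rightarrow>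
    ('k, 'w, 'p) module_scheme \<Rightarrow> ('v \<Rightarrow> 'w) \<Rightarrow> (nat \<Rightarrow> 'k) \<Rightarrow> nat \<Rightarrow> nat set \<Rightarrow>
    ('k, 'v) pt \<Rightarrow> ('k, 'w) pt" where
  "at_map R V V' f t 0 A p = Vec (f (the_vec p))"
| "at_map R V V' f t (Suc n) A p =
    (if Suc n \<in> A
     then let B = A - {Suc n}; g = at_map R V V' f t n B; x = fst_pt p; v = snd_pt p
          in Tup (g x)
               (diff_quot R (pmod R V (at_shape n B)) (pmod R V' (at_shape n B)) g x v (t (Suc n)))
     else at_map R V V' f t n A p)"

end

theory Submission
  imports Defs
begin

text \<open>
  The main difficulty is the extension of identities. A structure map \<open>e\<close> of an n-fold
  groupoid is a polynomial map, and when \<open>t\<close> is not invertible its formal difference quotient is not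
  determined by its values, so that an equation \<open>e = e'\<close> between maps does not imply the same
  equation between their extensions; moreover the groupoid axioms are conditional, since they concern
  composable elements only.

  The remedy is scalar extension. For \<open>s\<close> in the ring \<open>K\<close> let
  \<open>K\<^sub>s = K[\<delta>] / (\<delta>\<^sup>2 - s \<delta>)\<close>, a free module of rank 2 over \<open>K\<close>. Writing a
  point of the extended module as \<open>x + \<delta> v\<close>, the rules for formal difference quotients say exactly
  that \<open>e (x + \<delta> v) = e x + \<delta> e\<^sup>[\<^sup>1\<^sup>] (x, v, s)\<close> when \<open>e\<close> is evaluated over
  \<open>K\<^sub>s\<close> (lemma \<open>eval_ext\<close>). Hence the fibre over \<open>s\<close> of the extension of an
  n-fold groupoid, taken on the whole modules, is the same n-fold groupoid over the ring
  \<open>K\<^sub>s\<close>, and all axioms, conditional or not, are inherited provided they are known over all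
  rings. So the induction on \<open>n\<close> is carried out for all rings and modules at once
  (\<open>nfold_groupoid_full_tower\<close>, \<open>nfold_groupoid_at_tower\<close>). As the induction cannot change the type
  of scalars, it takes place in a type \<open>tower\<close> that contains a copy of the given scalars and is closed
  under the formation of pairs.

  The groupoids in the new direction, and their compatibility with the old directions, reduce
  to three identities that every polynomial map \<open>e\<close> satisfies:
  \<open>e (x + s v) = e x + s e\<^sup>[\<^sup>1\<^sup>] (x, v, s)\<close>, \<open>e\<^sup>[\<^sup>1\<^sup>] (x, 0, s) = 0\<close> and
  \<open>e\<^sup>[\<^sup>1\<^sup>] (x, w + v, s) = e\<^sup>[\<^sup>1\<^sup>] (x + s v, w, s) + e\<^sup>[\<^sup>1\<^sup>] (x, v, s)\<close>.
  They say that a polynomial map induces a functor of first-order groupoids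
  (\<open>first_order_functor\<close>); applied to the product maps they give the interchange law.

  For a subset \<open>U\<close> the structure maps are restrictions of those of the whole module, so only
  closedness of the vertex sets remains, which is again the first of the three identities. The
  constructions for variable \<open>t\<close> (in all of \<open>K\<close>, or in its units) and for fixed
  \<open>t\<close> are treated simultaneously in the locale \<open>first_order_extension\<close>.

  Finally, for a map \<open>f\<close> and invertible \<open>t\<close>, a pair \<open>(x, v)\<close> is determined by
  \<open>x\<close> and \<open>x + t v\<close>, and the extension of \<open>f\<close> acts on these two points as
  \<open>f\<close> does. So every equation that expresses compatibility with structure maps follows from the same
  equation at the two points (\<open>nfold_morphism_Suc\<close>).
\<close>

section \<open>Polynomial maps and their formal difference quotients\<close>

text \<open>Evaluation is meaningful only for expressions whose projections, sums and scalar multiples are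
  applied in matching modules. Constants have to lie in the ring.\<close>

inductive typed :: "('k, 'r) ring_scheme \<Rightarrow> shape \<Rightarrow> 'k expr \<Rightarrow> shape \<Rightarrow> bool" for R \<sigma> where
  Var: "typed R \<sigma> Var \<sigma>"
| Num: "c \<in> carrier R \<Longrightarrow> typed R \<sigma> (Num c) ShK"
| Zero: "typed R \<sigma> (Zero \<tau>) \<tau>"
| Fst: "typed R \<sigma> e (ShProd \<tau> \<tau>') \<Longrightarrow> typed R \<sigma> (Fst e) \<tau>"
| Snd: "typed R \<sigma> e (ShProd \<tau> \<tau>') \<Longrightarrow> typed R \<sigma> (Snd e) \<tau>'"
| PairE: "typed R \<sigma> d \<tau> \<Longrightarrow> typed R \<sigma> e \<tau>' \<Longrightarrow> typed R \<sigma> (PairE d e) (ShProd \<tau> \<tau>')"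
| Plus: "typed R \<sigma> d \<tau> \<Longrightarrow> typed R \<sigma> e \<tau> \<Longrightarrow> typed R \<sigma> (Plus d e) \<tau>"
| Smul: "typed R \<sigma> l ShK \<Longrightarrow> typed R \<sigma> e \<tau> \<Longrightarrow> typed R \<sigma> (Smul l e) \<tau>"

lemma typed_subst:
  assumes "typed R \<tau> e \<upsilon>" and "typed R \<sigma> x \<tau>"
  shows "typed R \<sigma> (subst e x) \<upsilon>"
  using assms by (induction) (auto intro: typed.intros)

lemma typed_dquot:
  assumes "typed R \<tau> e \<upsilon>" and "typed R \<sigma> x \<tau>" and "typed R \<sigma> v \<tau>" and "typed R \<sigma> t ShK"
  shows "typed R \<sigma> (dquot e x v t) \<upsilon>"
  using assms by (induction) (auto intro: typed.intros typed_subst)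

lemma eval_subst: "eval R V (subst e x) z = eval R V e (eval R V x z)"
  by (induction e) auto

text \<open>Every value of \<open>dquot e\<close> has this form (\<open>eval_dquot\<close>), so that only points, and
  no longer the expressions for \<open>x\<close>, \<open>v\<close>, \<open>t\<close>, enter the laws below.\<close>

definition dq :: "('k, 'r) ring_scheme \<Rightarrow> ('k, 'v, 'm) module_scheme \<Rightarrow> 'k expr \<Rightarrow> 'k \<Rightarrow>
    ('k, 'v) pt \<Rightarrow> ('k, 'v) pt \<Rightarrow> ('k, 'v) pt" where
  "dq R V e s x v = eval R V (dquot e (Fst Var) (Mid Var) (Last Var)) (Tup x (Tup v (Scal s)))"

lemma eval_dquot:
  assumes "eval R V t w = Scal s"
  shows "eval R V (dquot e x v t) w = dq R V e s (eval R V x w) (eval R V v w)"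
  unfolding dq_def using assms by (induction e) (auto simp: eval_subst)

lemma dq_simps [simp]:
  "dq R V Var s x v = v"
  "dq R V (Num c) s x v = Scal \<zero>\<^bsub>R\<^esub>"
  "dq R V (Zero \<tau>) s x v = pzero R V \<tau>"
  "dq R V (Fst e) s x v = fst_pt (dq R V e s x v)"
  "dq R V (Snd e) s x v = snd_pt (dq R V e s x v)"
  "dq R V (PairE d e) s x v = Tup (dq R V d s x v) (dq R V e s x v)"
  "dq R V (Plus d e) s x v = padd R V (dq R V d s x v) (dq R V e s x v)"
  "dq R V (Smul l e) s x v =
     padd R V (padd R V (psmult R V (the_scal (dq R V l s x v)) (eval R V e x))
                        (psmult R V (the_scal (eval R V l x)) (dq R V e s x v)))
       (psmult R V s (psmult R V (the_scal (dq R V l s x v)) (dq R V e s x v)))"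
  by (simp_all add: dq_def eval_subst)

context
  fixes R :: "('k, 'r) ring_scheme" and V :: "('k, 'v, 'm) module_scheme"
  assumes mod: "module R V"
begin

interpretation module R V by (rule mod)

interpretation P: module R "pmod R V \<tau>"
  rewrites "carrier (pmod R V \<tau>) = pcarrier R V \<tau>" and "zero (pmod R V \<tau>) = pzero R V \<tau>"
    and "add (pmod R V \<tau>) = padd R V" and "smult (pmod R V \<tau>) = psmult R V" for \<tau>
  by (simp_all add: module_pmod mod)

lemma padd_closed: "x \<in> pcarrier R V \<tau> \<Longrightarrow> y \<in> pcarrier R V \<tau> \<Longrightarrow> padd R V x y \<in> pcarrier R V \<tau>"
  by (rule P.M.a_closed)

lemma psmult_closed: "s \<in> carrier R \<Longrightarrow> y \<in> pcarrier R V \<tau> \<Longrightarrow> psmult R V s y \<in> pcarrier R V \<tau>"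
  by (rule P.smult_closed)

lemma pzero_closed: "pzero R V \<tau> \<in> pcarrier R V \<tau>"
  by (rule P.M.zero_closed)

lemma padd_psmult_zero:
  "s \<in> carrier R \<Longrightarrow> x \<in> pcarrier R V \<tau> \<Longrightarrow> padd R V x (psmult R V s (pzero R V \<tau>)) = x"
  by (simp add: P.smult_r_null[where \<tau>=\<tau>] P.M.r_zero[where \<tau>=\<tau>])

lemma padd_zero:
  "x \<in> pcarrier R V \<tau> \<Longrightarrow> padd R V x (pzero R V \<tau>) = x"
  "x \<in> pcarrier R V \<tau> \<Longrightarrow> padd R V (pzero R V \<tau>) x = x"
  by (simp_all add: P.M.r_zero[where \<tau>=\<tau>] P.M.l_zero[where \<tau>=\<tau>])

lemma padd_step:
  assumes "s \<in> carrier R" "x \<in> pcarrier R V \<tau>" "v \<in> pcarrier R V \<tau>" "w \<in> pcarrier R V \<tau>"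
  shows "padd R V x (psmult R V s (padd R V w v)) = padd R V (padd R V x (psmult R V s v)) (psmult R V s w)"
  using assms by (simp add: P.smult_r_distr[where \<tau>=\<tau>] P.M.a_ac[where \<tau>=\<tau>])

lemma pneg_closed: "v \<in> pcarrier R V \<tau> \<Longrightarrow> psmult R V (\<ominus>\<^bsub>R\<^esub> \<one>\<^bsub>R\<^esub>) v \<in> pcarrier R V \<tau>"
  by (simp add: P.smult_closed[where \<tau>=\<tau>])

lemma pneg_add:
  assumes "v \<in> pcarrier R V \<tau>"
  shows "padd R V (psmult R V (\<ominus>\<^bsub>R\<^esub> \<one>\<^bsub>R\<^esub>) v) v = pzero R V \<tau>"
    and "padd R V v (psmult R V (\<ominus>\<^bsub>R\<^esub> \<one>\<^bsub>R\<^esub>) v) = pzero R V \<tau>"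
  using assms by (simp_all add: P.smult_l_minus[where \<tau>=\<tau>] P.M.l_neg[where \<tau>=\<tau>] P.M.r_neg[where \<tau>=\<tau>] P.smult_one[where \<tau>=\<tau>])

lemma padd_assoc:
  "x \<in> pcarrier R V \<tau> \<Longrightarrow> y \<in> pcarrier R V \<tau> \<Longrightarrow> z \<in> pcarrier R V \<tau> \<Longrightarrow>
    padd R V (padd R V x y) z = padd R V x (padd R V y z)"
  by (rule P.M.a_assoc)

lemma padd_step_neg:
  assumes "s \<in> carrier R" "x \<in> pcarrier R V \<tau>" "v \<in> pcarrier R V \<tau>"
  shows "padd R V (padd R V x (psmult R V s v)) (psmult R V s (psmult R V (\<ominus>\<^bsub>R\<^esub> \<one>\<^bsub>R\<^esub>) v)) = x"
  using assms padd_step[of s x \<tau> v "psmult R V (\<ominus>\<^bsub>R\<^esub> \<one>\<^bsub>R\<^esub>) v"]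
  by (simp add: pneg_closed pneg_add padd_psmult_zero)

lemma eval_closed:
  assumes "typed R \<sigma> e \<tau>" and "x \<in> pcarrier R V \<sigma>"
  shows "eval R V e x \<in> pcarrier R V \<tau>"
  using assms
proof (induction)
  case (Smul l e \<tau>)
  then show ?case by (auto intro!: psmult_closed)
qed (auto intro: padd_closed pzero_closed)

lemma dq_closed:
  assumes "typed R \<sigma> e \<tau>" and "x \<in> pcarrier R V \<sigma>" and "v \<in> pcarrier R V \<sigma>" and "s \<in> carrier R"
  shows "dq R V e s x v \<in> pcarrier R V \<tau>"
  unfolding dq_def
  by (rule eval_closed[of "ShProd \<sigma> (ShProd \<sigma> ShK)"])
     (use assms in \<open>auto intro!: typed_dquot intro: typed.intros\<close>)

text \<open>The product rule for \<open>dquot\<close> contains the term with factor \<open>t\<close> so that this holds for all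
  \<open>s\<close>: it is what remains of the product of two increments after one factor \<open>s\<close> is removed.\<close>

lemma eval_increment:
  assumes "typed R \<sigma> e \<tau>" and "x \<in> pcarrier R V \<sigma>" and "v \<in> pcarrier R V \<sigma>" and "s \<in> carrier R"
  shows "eval R V e (padd R V x (psmult R V s v)) =
    padd R V (eval R V e x) (psmult R V s (dq R V e s x v))"
  using assms
proof (induction)
  case (Fst e \<tau> \<tau>')
  then show ?case
    using eval_closed[OF Fst.hyps, of x] dq_closed[OF Fst.hyps, of x v s] by auto
next
  case (Snd e \<tau> \<tau>')
  then show ?case
    using eval_closed[OF Snd.hyps, of x] dq_closed[OF Snd.hyps, of x v s] by auto
next
  case (Plus d \<tau> e)
  then show ?case
    using eval_closed[OF Plus.hyps(1), of x] dq_closed[OF Plus.hyps(1), of x v s]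
      eval_closed[OF Plus.hyps(2), of x] dq_closed[OF Plus.hyps(2), of x v s]
    by (simp add: P.smult_r_distr[where \<tau>=\<tau>] P.M.a_ac[where \<tau>=\<tau>] P.M.a_closed[where \<tau>=\<tau>] P.smult_closed[where \<tau>=\<tau>])
next
  case (Smul l e \<tau>)
  obtain a b where a: "eval R V l x = Scal a" "a \<in> carrier R"
    and b: "dq R V l s x v = Scal b" "b \<in> carrier R"
    using eval_closed[OF Smul.hyps(1), of x] dq_closed[OF Smul.hyps(1), of x v s] Smul.prems by auto
  show ?case
    using Smul a b eval_closed[OF Smul.hyps(2), of x] dq_closed[OF Smul.hyps(2), of x v s]
    by (simp add: P.smult_r_distr[where \<tau>=\<tau>] P.smult_l_distr[where \<tau>=\<tau>] P.M.a_ac[where \<tau>=\<tau>] P.M.a_closed[where \<tau>=\<tau>] P.smult_closed[where \<tau>=\<tau>]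
        P.smult_assoc1[where \<tau>=\<tau>, symmetric] R.m_ac R.r_distr)
qed (auto simp: padd_psmult_zero pzero_closed)

lemma dq_zero:
  assumes "typed R \<sigma> e \<tau>" and "x \<in> pcarrier R V \<sigma>" and "s \<in> carrier R"
  shows "dq R V e s x (pzero R V \<sigma>) = pzero R V \<tau>"
  using assms
proof (induction)
  case (Plus d \<tau> e)
  then show ?case by (simp add: padd_zero pzero_closed)
next
  case (Smul l e \<tau>)
  obtain a where a: "eval R V l x = Scal a" "a \<in> carrier R"
    using eval_closed[OF Smul.hyps(1), of x] Smul.prems by auto
  show ?case
    using Smul a eval_closed[OF Smul.hyps(2), of x]
    by (simp add: P.smult_r_null[where \<tau>=\<tau>] P.smult_l_null[where \<tau>=\<tau>] padd_zero pzero_closed)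
qed auto

text \<open>For invertible \<open>s\<close> this is immediate, since both sides times \<open>s\<close> are
  \<open>e (x + s v + s w) - e x\<close>. In general it is a formal identity: for a product both sides are
  expanded with the values of the two factors at \<open>x + s v\<close>, known from \<open>eval_increment\<close>.\<close>

lemma dq_add:
  assumes "typed R \<sigma> e \<tau>" and "x \<in> pcarrier R V \<sigma>" and "v \<in> pcarrier R V \<sigma>"
    and "w \<in> pcarrier R V \<sigma>" and "s \<in> carrier R"
  shows "dq R V e s x (padd R V w v) =
    padd R V (dq R V e s (padd R V x (psmult R V s v)) w) (dq R V e s x v)"
  using assms
proof (induction)
  case (Fst e \<tau> \<tau>')
  then show ?case
    using dq_closed[OF Fst.hyps, of x v s] dq_closed[OF Fst.hyps, of "padd R V x (psmult R V s v)" w s]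
    by (auto simp: padd_closed psmult_closed)
next
  case (Snd e \<tau> \<tau>')
  then show ?case
    using dq_closed[OF Snd.hyps, of x v s] dq_closed[OF Snd.hyps, of "padd R V x (psmult R V s v)" w s]
    by (auto simp: padd_closed psmult_closed)
next
  case (Plus d \<tau> e)
  let ?y = "padd R V x (psmult R V s v)"
  show ?case
    using Plus dq_closed[OF Plus.hyps(1), of x v s] dq_closed[OF Plus.hyps(2), of x v s]
      dq_closed[OF Plus.hyps(1), of ?y w s] dq_closed[OF Plus.hyps(2), of ?y w s]
    by (simp add: P.M.a_ac[where \<tau>=\<tau>] P.M.a_closed[where \<tau>=\<tau>] P.smult_closed[where \<tau>=\<tau>])
next
  case (Smul l e \<tau>)
  let ?y = "padd R V x (psmult R V s v)"
  have y: "?y \<in> pcarrier R V \<sigma>" using Smul.prems by (simp add: padd_closed psmult_closed)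
  obtain a b c where a: "eval R V l x = Scal a" "a \<in> carrier R"
    and b: "dq R V l s x v = Scal b" "b \<in> carrier R"
    and c: "dq R V l s ?y w = Scal c" "c \<in> carrier R"
    using eval_closed[OF Smul.hyps(1), of x] dq_closed[OF Smul.hyps(1), of x v s]
      dq_closed[OF Smul.hyps(1) y, of w s] Smul.prems by auto
  have cl: "eval R V e x \<in> pcarrier R V \<tau>" "dq R V e s x v \<in> pcarrier R V \<tau>"
    "dq R V e s ?y w \<in> pcarrier R V \<tau>"
    using eval_closed[OF Smul.hyps(2), of x] dq_closed[OF Smul.hyps(2), of x v s]
      dq_closed[OF Smul.hyps(2) y, of w s] Smul.prems by auto
  have "eval R V l ?y = Scal (a \<oplus>\<^bsub>R\<^esub> s \<otimes>\<^bsub>R\<^esub> b)"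
    using eval_increment[OF Smul.hyps(1), of x v s] Smul.prems a b by simp
  moreover have "eval R V e ?y = padd R V (eval R V e x) (psmult R V s (dq R V e s x v))"
    using eval_increment[OF Smul.hyps(2), of x v s] Smul.prems by simp
  ultimately show ?case
    using Smul a b c cl
    by (simp add: P.smult_r_distr[where \<tau>=\<tau>] P.smult_l_distr[where \<tau>=\<tau>] P.M.a_ac[where \<tau>=\<tau>] P.M.a_closed[where \<tau>=\<tau>] P.smult_closed[where \<tau>=\<tau>]
        P.smult_assoc1[where \<tau>=\<tau>, symmetric] R.m_ac R.r_distr)
qed (auto simp: padd_zero pzero_closed)

end


section \<open>Scalar extension\<close>

text \<open>One type for the scalars of all the iterated ring extensions: \<open>Ext a b\<close> stands for
  \<open>a + \<delta> b\<close>. The same type constructor serves for the vectors.\<close>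

datatype 'a tower = Ground (the_ground: 'a) | Ext (re: "'a tower") (im: "'a tower")

text \<open>The ring \<open>R[\<delta>] / (\<delta>\<^sup>2 - s \<delta>)\<close>.\<close>

definition ext_ring :: "'k tower ring \<Rightarrow> 'k tower \<Rightarrow> 'k tower ring" where
  "ext_ring R s = \<lparr>carrier = {Ext a b |a b. a \<in> carrier R \<and> b \<in> carrier R},
     mult = (\<lambda>p q. Ext (re p \<otimes>\<^bsub>R\<^esub> re q)
       ((im p \<otimes>\<^bsub>R\<^esub> re q \<oplus>\<^bsub>R\<^esub> re p \<otimes>\<^bsub>R\<^esub> im q) \<oplus>\<^bsub>R\<^esub> s \<otimes>\<^bsub>R\<^esub> (im p \<otimes>\<^bsub>R\<^esub> im q))),
     one = Ext \<one>\<^bsub>R\<^esub> \<zero>\<^bsub>R\<^esub>, zero = Ext \<zero>\<^bsub>R\<^esub> \<zero>\<^bsub>R\<^esub>,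
     add = (\<lambda>p q. Ext (re p \<oplus>\<^bsub>R\<^esub> re q) (im p \<oplus>\<^bsub>R\<^esub> im q))\<rparr>"

text \<open>The module \<open>V \<oplus> \<delta> V\<close> over this ring.\<close>

definition ext_module ::
    "('k tower, 'v tower) module \<Rightarrow> 'k tower \<Rightarrow> ('k tower, 'v tower) module" where
  "ext_module V s = \<lparr>carrier = {Ext x v |x v. x \<in> carrier V \<and> v \<in> carrier V},
     mult = (\<lambda>_ _. undefined), one = undefined, zero = Ext \<zero>\<^bsub>V\<^esub> \<zero>\<^bsub>V\<^esub>,
     add = (\<lambda>p q. Ext (re p \<oplus>\<^bsub>V\<^esub> re q) (im p \<oplus>\<^bsub>V\<^esub> im q)),
     smult = (\<lambda>a p. Ext (re a \<odot>\<^bsub>V\<^esub> re p)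
       ((im a \<odot>\<^bsub>V\<^esub> re p \<oplus>\<^bsub>V\<^esub> re a \<odot>\<^bsub>V\<^esub> im p) \<oplus>\<^bsub>V\<^esub> s \<odot>\<^bsub>V\<^esub> (im a \<odot>\<^bsub>V\<^esub> im p)))\<rparr>"

lemma cring_ext_ring:
  assumes "cring R" and "s \<in> carrier R"
  shows "cring (ext_ring R s)"
proof -
  interpret cring R by fact
  have neg: "\<exists>y\<in>carrier (ext_ring R s). y \<oplus>\<^bsub>ext_ring R s\<^esub> x = \<zero>\<^bsub>ext_ring R s\<^esub>"
    if "x \<in> carrier (ext_ring R s)" for x
    by (rule bexI[of _ "Ext (\<ominus>\<^bsub>R\<^esub> re x) (\<ominus>\<^bsub>R\<^esub> im x)"])
       (use that in \<open>auto simp: ext_ring_def l_neg\<close>)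
  show ?thesis
  proof (rule cringI)
    show "abelian_group (ext_ring R s)"
      by (rule abelian_groupI) (use neg in \<open>auto simp: ext_ring_def a_ac\<close>)
    show "comm_monoid (ext_ring R s)"
      by (rule comm_monoidI) (use assms(2) in \<open>auto simp: ext_ring_def r_distr l_distr a_ac m_ac\<close>)
  qed (use assms(2) in \<open>auto simp: ext_ring_def r_distr l_distr a_ac m_ac\<close>)
qed

lemma module_ext_module:
  assumes "module R V" and s: "s \<in> carrier R"
  shows "module (ext_ring R s) (ext_module V s)"
proof -
  interpret module R V by fact
  have neg: "\<exists>y\<in>carrier (ext_module V s). y \<oplus>\<^bsub>ext_module V s\<^esub> x = \<zero>\<^bsub>ext_module V s\<^esub>"
    if "x \<in> carrier (ext_module V s)" for x
    by (rule bexI[of _ "Ext (\<ominus>\<^bsub>V\<^esub> re x) (\<ominus>\<^bsub>V\<^esub> im x)"])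
       (use that in \<open>auto simp: ext_module_def M.l_neg\<close>)
  show ?thesis
  proof (rule moduleI)
    show "cring (ext_ring R s)" by (rule cring_ext_ring) (use s is_cring in auto)
    show "abelian_group (ext_module V s)"
      by (rule abelian_groupI) (use neg in \<open>auto simp: ext_module_def M.a_ac\<close>)
  qed (use s in \<open>auto simp: ext_ring_def ext_module_def smult_r_distr smult_l_distr
        smult_assoc1[symmetric] M.a_ac R.m_ac R.r_distr\<close>)
qed

text \<open>The point \<open>x + \<delta> v\<close> of an iterated product of extended modules.\<close>

fun with_delta :: "('k tower, 'v tower) pt \<Rightarrow> ('k tower, 'v tower) pt \<Rightarrow> ('k tower, 'v tower) pt" where
  "with_delta (Vec x) (Vec v) = Vec (Ext x v)"
| "with_delta (Scal a) (Scal b) = Scal (Ext a b)"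
| "with_delta (Tup p q) (Tup p' q') = Tup (with_delta p p') (with_delta q q')"
| "with_delta _ _ = undefined"

lemma map_pt_with_delta:
  assumes "x \<in> pcarrier R V \<sigma>" and "v \<in> pcarrier R V \<sigma>"
  shows "map_pt re re (with_delta x v) = x" and "map_pt im im (with_delta x v) = v"
  using assms by (induction \<sigma> arbitrary: x v) auto

lemma pcarrier_ext:
  "pcarrier (ext_ring R s) (ext_module V s) \<sigma> =
    {with_delta x v |x v. x \<in> pcarrier R V \<sigma> \<and> v \<in> pcarrier R V \<sigma>}"
proof (induction \<sigma>)
  case ShV
  then show ?case by (auto simp: ext_module_def image_iff) (metis with_delta.simps(1))
next
  case ShK
  then show ?case by (auto simp: ext_ring_def image_iff) (metis with_delta.simps(2))
next
  case (ShProd \<sigma> \<tau>)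
  show ?case (is "?L = ?R")
  proof
    show "?L \<subseteq> ?R" using ShProd by auto (metis with_delta.simps(3))
    show "?R \<subseteq> ?L" using ShProd by auto blast+
  qed
qed

lemma padd_with_delta:
  assumes "x \<in> pcarrier R V \<sigma>" "v \<in> pcarrier R V \<sigma>" "y \<in> pcarrier R V \<sigma>" "w \<in> pcarrier R V \<sigma>"
  shows "padd (ext_ring R s) (ext_module V s) (with_delta x v) (with_delta y w) =
    with_delta (padd R V x y) (padd R V v w)"
  using assms
  by (induction \<sigma> arbitrary: x v y w) (auto simp: ext_ring_def ext_module_def)

lemma psmult_with_delta:
  assumes "x \<in> pcarrier R V \<sigma>" "v \<in> pcarrier R V \<sigma>"
  shows "psmult (ext_ring R s) (ext_module V s) (Ext a b) (with_delta x v) =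
    with_delta (psmult R V a x)
      (padd R V (padd R V (psmult R V b x) (psmult R V a v)) (psmult R V s (psmult R V b v)))"
  using assms
  by (induction \<sigma> arbitrary: x v) (auto simp: ext_ring_def ext_module_def)

lemma pzero_with_delta: "pzero (ext_ring R s) (ext_module V s) \<sigma> = with_delta (pzero R V \<sigma>) (pzero R V \<sigma>)"
  by (induction \<sigma>) (auto simp: ext_ring_def ext_module_def)

text \<open>The inclusion of the scalars into the extended ring, to be applied to the constants of an expression.\<close>

definition const_ext :: "'k tower ring \<Rightarrow> 'k tower \<Rightarrow> 'k tower" where
  "const_ext R c = Ext c \<zero>\<^bsub>R\<^esub>"

text \<open>The rules for \<open>dquot\<close> are those of calculation modulo \<open>\<delta>\<^sup>2 - s \<delta>\<close>, where the
  term with factor \<open>s\<close> comes from \<open>\<delta>\<^sup>2\<close>. So the extension of a structure map is the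
  structure map itself, over another ring.\<close>

lemma eval_ext:
  assumes "module R V" and s: "s \<in> carrier R"
    and "typed R \<sigma> e \<tau>" and "x \<in> pcarrier R V \<sigma>" and "v \<in> pcarrier R V \<sigma>"
  shows "eval (ext_ring R s) (ext_module V s) (map_expr (const_ext R) e) (with_delta x v) =
    with_delta (eval R V e x) (dq R V e s x v)"
  using assms(3-)
proof (induction)
  case (Num c)
  then show ?case by (simp add: const_ext_def)
next
  case (Fst e \<tau> \<tau>')
  then show ?case
    using eval_closed[OF assms(1) Fst.hyps, of x] dq_closed[OF assms(1) Fst.hyps, of x v s] s by auto
next
  case (Snd e \<tau> \<tau>')
  then show ?case
    using eval_closed[OF assms(1) Snd.hyps, of x] dq_closed[OF assms(1) Snd.hyps, of x v s] s by auto
next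
  case (Plus d \<tau> e)
  then show ?case
    by (simp add: padd_with_delta[where \<sigma>=\<tau>] eval_closed[OF assms(1)] dq_closed[OF assms(1)] s)
next
  case (Smul l e \<tau>)
  obtain a b where a: "eval R V l x = Scal a" and b: "dq R V l s x v = Scal b"
    using eval_closed[OF assms(1) Smul.hyps(1), of x]
      dq_closed[OF assms(1) Smul.hyps(1), of x v s] Smul.prems s by auto
  then show ?case
    using Smul by (simp add: psmult_with_delta[where \<sigma>=\<tau>] eval_closed[OF assms(1)] dq_closed[OF assms(1)] s)
qed (auto simp: pzero_with_delta)

text \<open>A copy of a given ring and module inside the type \<open>tower\<close>, from which results proved there are
  transported back.\<close>

definition ground_ring :: "('k, 'r) ring_scheme \<Rightarrow> 'k tower ring" where
  "ground_ring R = \<lparr>carrier = Ground ` carrier R,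
     mult = (\<lambda>a b. Ground (the_ground a \<otimes>\<^bsub>R\<^esub> the_ground b)),
     one = Ground \<one>\<^bsub>R\<^esub>, zero = Ground \<zero>\<^bsub>R\<^esub>,
     add = (\<lambda>a b. Ground (the_ground a \<oplus>\<^bsub>R\<^esub> the_ground b))\<rparr>"

definition ground_module :: "('k, 'v, 'm) module_scheme \<Rightarrow> ('k tower, 'v tower) module" where
  "ground_module V = \<lparr>carrier = Ground ` carrier V,
     mult = (\<lambda>_ _. undefined), one = undefined, zero = Ground \<zero>\<^bsub>V\<^esub>,
     add = (\<lambda>x y. Ground (the_ground x \<oplus>\<^bsub>V\<^esub> the_ground y)),
     smult = (\<lambda>a x. Ground (the_ground a \<odot>\<^bsub>V\<^esub> the_ground x))\<rparr>"

lemma cring_ground_ring: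
  assumes "cring R"
  shows "cring (ground_ring R)"
proof -
  interpret cring R by fact
  have neg: "\<exists>y\<in>carrier (ground_ring R). y \<oplus>\<^bsub>ground_ring R\<^esub> x = \<zero>\<^bsub>ground_ring R\<^esub>"
    if "x \<in> carrier (ground_ring R)" for x
    using that
    by (auto simp: ground_ring_def intro!: bexI[of _ "\<ominus>\<^bsub>R\<^esub> the_ground x"] l_neg)
  show ?thesis
  proof (rule cringI)
    show "abelian_group (ground_ring R)"
      by (rule abelian_groupI) (use neg in \<open>auto simp: ground_ring_def a_ac\<close>)
    show "comm_monoid (ground_ring R)"
      by (rule comm_monoidI) (auto simp: ground_ring_def m_ac)
  qed (auto simp: ground_ring_def l_distr)
qed

lemma module_ground_module:
  assumes "module R V"
  shows "module (ground_ring R) (ground_module V)"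
proof -
  interpret module R V by fact
  have neg: "\<exists>y\<in>carrier (ground_module V). y \<oplus>\<^bsub>ground_module V\<^esub> x = \<zero>\<^bsub>ground_module V\<^esub>"
    if "x \<in> carrier (ground_module V)" for x
    using that
    by (auto simp: ground_module_def intro!: bexI[of _ "\<ominus>\<^bsub>V\<^esub> the_ground x"] M.l_neg)
  show ?thesis
  proof (rule moduleI)
    show "cring (ground_ring R)" by (rule cring_ground_ring) (rule is_cring)
    show "abelian_group (ground_module V)"
      by (rule abelian_groupI) (use neg in \<open>auto simp: ground_module_def M.a_ac\<close>)
  qed (auto simp: ground_ring_def ground_module_def smult_r_distr smult_l_distr smult_assoc1)
qed

lemma pcarrier_ground:
  "pcarrier (ground_ring R) (ground_module V) \<sigma> = map_pt Ground Ground ` pcarrier R V \<sigma>"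
  by (induction \<sigma>) (force simp: ground_ring_def ground_module_def image_iff)+

lemma padd_ground:
  assumes "x \<in> pcarrier R V \<sigma>" "y \<in> pcarrier R V \<sigma>"
  shows "padd (ground_ring R) (ground_module V) (map_pt Ground Ground x) (map_pt Ground Ground y) =
    map_pt Ground Ground (padd R V x y)"
  using assms by (induction \<sigma> arbitrary: x y) (auto simp: ground_ring_def ground_module_def)

lemma psmult_ground:
  "psmult (ground_ring R) (ground_module V) (Ground a) (map_pt Ground Ground x) =
    map_pt Ground Ground (psmult R V a x)"
  by (induction x) (auto simp: ground_ring_def ground_module_def)

lemma pzero_ground:
  "pzero (ground_ring R) (ground_module V) \<sigma> = map_pt Ground Ground (pzero R V \<sigma>)"
  by (induction \<sigma>) (auto simp: ground_ring_def ground_module_def)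

lemma eval_ground:
  assumes "module R V" and "typed R \<sigma> e \<tau>" and "x \<in> pcarrier R V \<sigma>"
  shows "eval (ground_ring R) (ground_module V) (map_expr Ground e) (map_pt Ground Ground x) =
    map_pt Ground Ground (eval R V e x)"
  using assms(2-)
proof (induction)
  case (Fst e \<tau> \<tau>')
  then show ?case using eval_closed[OF assms(1) Fst.hyps, of x] by auto
next
  case (Snd e \<tau> \<tau>')
  then show ?case using eval_closed[OF assms(1) Snd.hyps, of x] by auto
next
  case (Plus d \<tau> e)
  then show ?case by (simp add: padd_ground[where \<sigma>=\<tau>] eval_closed[OF assms(1)])
next
  case (Smul l e \<tau>)
  then show ?case
    using eval_closed[OF assms(1) Smul.hyps(1), of x] by (auto simp: psmult_ground)
qed (auto simp: pzero_ground)


section \<open>Transfer of the groupoid axioms\<close>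

text \<open>The part of the groupoid axioms that depends on the chosen subsets of the ambient modules.\<close>

definition closed_edge :: "'a set \<Rightarrow> 'a set \<Rightarrow> 'a gmaps \<Rightarrow> bool" where
  "closed_edge M Ob S \<longleftrightarrow>
     (\<forall>a\<in>M. gsrc S a \<in> Ob \<and> gtgt S a \<in> Ob \<and> ginv S a \<in> M) \<and> (\<forall>x\<in>Ob. gunit S x \<in> M) \<and>
     (\<forall>a b. composable M S a b \<longrightarrow> gmul S a b \<in> M)"

definition closed_nfold :: "nat \<Rightarrow> 'a nfold \<Rightarrow> bool" where
  "closed_nfold n G \<longleftrightarrow>
     (\<forall>A\<subseteq>{1..n}. \<forall>k\<in>A. closed_edge (vertex G A) (vertex G (A - {k})) (edge G A k))"

text \<open>Via the injections \<open>\<phi> s\<close>, the set \<open>M'\<close> is contained in the disjoint union of the sets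
  \<open>M s\<close>. Inclusion suffices for passing to subsets; the disjointness ensures that composable
  elements lie over the same index.\<close>

definition decomposes :: "'i set \<Rightarrow> ('i \<Rightarrow> 'a \<Rightarrow> 'b) \<Rightarrow> ('i \<Rightarrow> 'a set) \<Rightarrow> 'b set \<Rightarrow> bool" where
  "decomposes I \<phi> M M' \<longleftrightarrow> M' \<subseteq> (\<Union>s\<in>I. \<phi> s ` M s) \<and>
     (\<forall>s\<in>I. \<forall>s'\<in>I. \<forall>z\<in>M s. \<forall>z'\<in>M s'. \<phi> s z = \<phi> s' z' \<longrightarrow> s = s' \<and> z = z')"

text \<open>Products of all pairs are compared, composable or not: the structure maps of interest are given by
  expressions, which can be evaluated everywhere.\<close>

definition intertwines :: "'i set \<Rightarrow> ('i \<Rightarrow> 'a \<Rightarrow> 'b) \<Rightarrow> ('i \<Rightarrow> 'a set) \<Rightarrow> ('i \<Rightarrow> 'a set) \<Rightarrow>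
    ('i \<Rightarrow> 'a gmaps) \<Rightarrow> 'b gmaps \<Rightarrow> bool" where
  "intertwines I \<phi> M Ob S S' \<longleftrightarrow> (\<forall>s\<in>I.
     (\<forall>z\<in>M s. gsrc S' (\<phi> s z) = \<phi> s (gsrc (S s) z) \<and> gtgt S' (\<phi> s z) = \<phi> s (gtgt (S s) z) \<and>
       ginv S' (\<phi> s z) = \<phi> s (ginv (S s) z)) \<and>
     (\<forall>z\<in>Ob s. gunit S' (\<phi> s z) = \<phi> s (gunit (S s) z)) \<and>
     (\<forall>y\<in>M s. \<forall>z\<in>M s. gmul S' (\<phi> s y) (\<phi> s z) = \<phi> s (gmul (S s) y z)))"

lemma decomposesE:
  assumes "decomposes I \<phi> M M'" and "a \<in> M'"
  obtains s z where "s \<in> I" "z \<in> M s" "a = \<phi> s z"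
  using assms by (auto simp: decomposes_def)

lemma decomposes_inj:
  assumes "decomposes I \<phi> M M'" and "\<phi> s z = \<phi> s' z'" "s \<in> I" "s' \<in> I" "z \<in> M s" "z' \<in> M s'"
  shows "s = s'" and "z = z'"
  using assms unfolding decomposes_def by blast+

text \<open>Source and target of composable elements agree, so that the elements have the same index by
  disjointness on the objects, and then are composable in that component.\<close>

lemma composableE:
  assumes M: "decomposes I \<phi> M M'" and Ob: "decomposes I \<phi> Ob Ob'"
    and S: "intertwines I \<phi> M Ob S S'" and gr: "\<And>s. s \<in> I \<Longrightarrow> groupoid (M s) (Ob s) (S s)"
    and ab: "composable M' S' a b"
  obtains s y z where "s \<in> I" "a = \<phi> s y" "b = \<phi> s z" "composable (M s) (S s) y z"
proof -
  obtain s y where y: "s \<in> I" "y \<in> M s" "a = \<phi> s y"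
    using decomposesE[OF M] ab by (auto simp: composable_def)
  obtain s' z where z: "s' \<in> I" "z \<in> M s'" "b = \<phi> s' z"
    using decomposesE[OF M] ab by (auto simp: composable_def)
  have "\<phi> s (gsrc (S s) y) = \<phi> s' (gtgt (S s') z)"
    using ab y z S by (simp add: composable_def intertwines_def)
  moreover have "gsrc (S s) y \<in> Ob s" "gtgt (S s') z \<in> Ob s'"
    using groupoid.src_closed[OF gr] groupoid.tgt_closed[OF gr] y z by auto
  ultimately have "s = s'" "gsrc (S s) y = gtgt (S s') z"
    using decomposes_inj[OF Ob] y z by metis+
  then show thesis using that y z by (auto simp: composable_def)
qed

lemma groupoid_decomposes:
  assumes M: "decomposes I \<phi> M M'" and Ob: "decomposes I \<phi> Ob Ob'"
    and S: "intertwines I \<phi> M Ob S S'" and gr: "\<And>s. s \<in> I \<Longrightarrow> groupoid (M s) (Ob s) (S s)"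
    and cl: "closed_edge M' Ob' S'"
  shows "groupoid M' Ob' S'"
proof -
  note gr_simps = groupoid.src_closed groupoid.tgt_closed groupoid.unit_closed groupoid.inv_closed
    groupoid.mul_closed groupoid.src_unit groupoid.tgt_unit groupoid.src_mul groupoid.tgt_mul
    groupoid.mul_assoc groupoid.mul_unit_right groupoid.mul_unit_left groupoid.src_inv
    groupoid.tgt_inv groupoid.inv_mul groupoid.mul_inv
  note gr_simps = gr_simps[OF gr]
  have on_M: "P a" if "a \<in> M'" "\<And>s z. s \<in> I \<Longrightarrow> z \<in> M s \<Longrightarrow> P (\<phi> s z)" for P a
    using decomposesE[OF M that(1)] that(2) by metis
  have on_Ob: "P a" if "a \<in> Ob'" "\<And>s z. s \<in> I \<Longrightarrow> z \<in> Ob s \<Longrightarrow> P (\<phi> s z)" for P a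
    using decomposesE[OF Ob that(1)] that(2) by metis
  have on_pairs: "P a b" if "composable M' S' a b"
    "\<And>s y z. s \<in> I \<Longrightarrow> y \<in> M s \<Longrightarrow> z \<in> M s \<Longrightarrow> composable (M s) (S s) y z \<Longrightarrow> P (\<phi> s y) (\<phi> s z)"
    for P a b
    using composableE[OF M Ob S gr that(1)] that(2) by (metis composable_def)
  note S' = S[unfolded intertwines_def, rule_format]
  show ?thesis
  proof
    fix a b c assume ab: "composable M' S' a b" and bc: "composable M' S' b c"
    obtain s y z where 1: "s \<in> I" "a = \<phi> s y" "b = \<phi> s z" "composable (M s) (S s) y z"
      using composableE[OF M Ob S gr ab] by metis
    obtain s' z' w where 2: "s' \<in> I" "b = \<phi> s' z'" "c = \<phi> s' w" "composable (M s') (S s') z' w"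
      using composableE[OF M Ob S gr bc] by metis
    have "s = s'" "z = z'"
      using decomposes_inj[OF M, of s z s' z'] 1 2 by (auto simp: composable_def)
    moreover have "y \<in> M s" "z \<in> M s" "w \<in> M s'"
      using 1 2 by (auto simp: composable_def)
    ultimately show "gmul S' (gmul S' a b) c = gmul S' a (gmul S' b c)"
      using 1 2 S' by (simp add: gr_simps)
  qed (use cl in \<open>auto simp: closed_edge_def S' gr_simps elim!: on_M on_Ob on_pairs\<close>)
qed

lemma groupoid_functor_decomposes:
  assumes M: "decomposes I \<phi> M M'" and Ob: "decomposes I \<phi> Ob Ob'"
    and S: "intertwines I \<phi> M Ob S S'" and gr: "\<And>s. s \<in> I \<Longrightarrow> groupoid (M s) (Ob s) (S s)"
    and T: "intertwines I \<phi> N Nb T T'"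
    and F: "\<And>s. s \<in> I \<Longrightarrow> groupoid_functor (M s) (Ob s) (S s) (N s) (Nb s) (T s) (F s) (Fo s)"
    and F': "\<And>s z. s \<in> I \<Longrightarrow> z \<in> M s \<Longrightarrow> F' (\<phi> s z) = \<phi> s (F s z)"
    and Fo': "\<And>s z. s \<in> I \<Longrightarrow> z \<in> Ob s \<Longrightarrow> Fo' (\<phi> s z) = \<phi> s (Fo s z)"
    and cl: "F' \<in> M' \<rightarrow> N'" "Fo' \<in> Ob' \<rightarrow> Nb'"
  shows "groupoid_functor M' Ob' S' N' Nb' T' F' Fo'"
  unfolding groupoid_functor_def
proof (intro conjI ballI allI impI cl)
  note S' = S[unfolded intertwines_def, rule_format]
  note T' = T[unfolded intertwines_def, rule_format]
  show "gsrc T' (F' a) = Fo' (gsrc S' a)" "gtgt T' (F' a) = Fo' (gtgt S' a)" if "a \<in> M'" for a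
  proof -
    from that
    obtain s z where z: "s \<in> I" "z \<in> M s" "a = \<phi> s z" using decomposesE[OF M] by metis
    note F'' = F[OF z(1), unfolded groupoid_functor_def]
    have "F s z \<in> N s" using F'' z by auto
    then show "gsrc T' (F' a) = Fo' (gsrc S' a)" "gtgt T' (F' a) = Fo' (gtgt S' a)"
      using z S' T' F' Fo' F'' by (auto simp: groupoid.src_closed[OF gr] groupoid.tgt_closed[OF gr])
  qed
  show "F' (gunit S' a) = gunit T' (Fo' a)" if "a \<in> Ob'" for a
  proof -
    from that obtain s z where z: "s \<in> I" "z \<in> Ob s" "a = \<phi> s z" using decomposesE[OF Ob] by metis
    note F'' = F[OF z(1), unfolded groupoid_functor_def]
    have "Fo s z \<in> Nb s" using F'' z by auto
    then show "F' (gunit S' a) = gunit T' (Fo' a)"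
      using z S' T' F' Fo' F'' by (auto simp: groupoid.unit_closed[OF gr])
  qed
  show "F' (gmul S' a b) = gmul T' (F' a) (F' b)" if "composable M' S' a b" for a b
  proof -
    from that obtain s y z where z: "s \<in> I" "a = \<phi> s y" "b = \<phi> s z" "composable (M s) (S s) y z"
      using composableE[OF M Ob S gr] by metis
    note F'' = F[OF z(1), unfolded groupoid_functor_def]
    have "y \<in> M s" "z \<in> M s" "F s y \<in> N s" "F s z \<in> N s"
      using F'' z by (auto simp: composable_def)
    then show "F' (gmul S' a b) = gmul T' (F' a) (F' b)"
      using z S' T' F' F'' by (auto simp: groupoid.mul_closed[OF gr])
  qed
qed

lemma interchange_decomposes:
  assumes M: "decomposes I \<phi> M M'"
    and Ob: "decomposes I \<phi> Ob Ob'" and S: "intertwines I \<phi> M Ob S S'"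
    and grS: "\<And>s. s \<in> I \<Longrightarrow> groupoid (M s) (Ob s) (S s)"
    and Nb: "decomposes I \<phi> Nb Nb'" and T: "intertwines I \<phi> M Nb T T'"
    and grT: "\<And>s. s \<in> I \<Longrightarrow> groupoid (M s) (Nb s) (T s)"
    and ic: "\<And>s. s \<in> I \<Longrightarrow> interchange (M s) (S s) (T s)"
  shows "interchange M' S' T'"
  unfolding interchange_def
proof (intro allI impI, elim conjE)
  fix a b c d
  assume ac: "composable M' T' a c" and bd: "composable M' T' b d"
    and ab: "composable M' S' a b" and cd: "composable M' S' c d"
  obtain s x z where 1: "s \<in> I" "a = \<phi> s x" "c = \<phi> s z" "composable (M s) (T s) x z"
    using composableE[OF M Nb T grT ac] by metis
  obtain s' y w where 2: "s' \<in> I" "b = \<phi> s' y" "d = \<phi> s' w" "composable (M s') (T s') y w"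
    using composableE[OF M Nb T grT bd] by metis
  obtain r x' y' where 3: "r \<in> I" "a = \<phi> r x'" "b = \<phi> r y'" "composable (M r) (S r) x' y'"
    using composableE[OF M Ob S grS ab] by metis
  obtain r' z' w' where 4: "r' \<in> I" "c = \<phi> r' z'" "d = \<phi> r' w'" "composable (M r') (S r') z' w'"
    using composableE[OF M Ob S grS cd] by metis
  note mem = 1(4)[unfolded composable_def] 2(4)[unfolded composable_def]
    3(4)[unfolded composable_def] 4(4)[unfolded composable_def]
  have "s = r" "x = x'" using decomposes_inj[OF M, of s x r x'] 1 3 mem by auto
  moreover have "s' = r" "y = y'" using decomposes_inj[OF M, of s' y r y'] 2 3 mem by auto
  moreover have "s = r'" "z = z'" using decomposes_inj[OF M, of s z r' z'] 1 4 mem by auto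
  moreover have "s' = r'" "w = w'" using decomposes_inj[OF M, of s' w r' w'] 2 4 mem by auto
  ultimately have comp: "composable (M s) (T s) x z" "composable (M s) (T s) y w"
      "composable (M s) (S s) x y" "composable (M s) (S s) z w"
    and eqs: "a = \<phi> s x" "b = \<phi> s y" "c = \<phi> s z" "d = \<phi> s w"
    using 1 2 3 4 by auto
  have in_M: "x \<in> M s" "y \<in> M s" "z \<in> M s" "w \<in> M s" using comp by (auto simp: composable_def)
  have "gmul (S s) (gmul (T s) x z) (gmul (T s) y w) = gmul (T s) (gmul (S s) x y) (gmul (S s) z w)"
    using ic[OF 1(1)] comp unfolding interchange_def by blast
  moreover have "gmul (T s) x z \<in> M s" "gmul (T s) y w \<in> M s" "gmul (S s) x y \<in> M s" "gmul (S s) z w \<in> M s"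
    using comp groupoid.mul_closed[OF grS[OF 1(1)]] groupoid.mul_closed[OF grT[OF 1(1)]] by auto
  ultimately show "gmul S' (gmul T' a c) (gmul T' b d) = gmul T' (gmul S' a b) (gmul S' c d)"
    using eqs in_M 1(1) S T by (simp add: intertwines_def)
qed

lemma nfold_groupoidD:
  assumes "nfold_groupoid n G" and "A \<subseteq> {1..n}"
  shows "k \<in> A \<Longrightarrow> groupoid (vertex G A) (vertex G (A - {k})) (edge G A k)"
    and "j \<in> A \<Longrightarrow> k \<in> A \<Longrightarrow> j \<noteq> k \<Longrightarrow> double_groupoid G A j k"
  using assms by (auto simp: nfold_groupoid_def)

text \<open>This is used in four situations: for the disjoint union, over all \<open>s\<close>, of the groupoids over
  the rings \<open>R[\<delta>] / (\<delta>\<^sup>2 - s \<delta>)\<close>, for one such ring when \<open>t\<close> is fixed, for products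
  with a set of parameters, and for a subset embedded in a copy of its module.\<close>

lemma nfold_groupoid_decomposes:
  assumes N: "\<And>s. s \<in> I \<Longrightarrow> nfold_groupoid n (N s)"
    and dec: "\<And>A. A \<subseteq> {1..n} \<Longrightarrow> decomposes I \<phi> (\<lambda>s. vertex (N s) A) (vertex H A)"
    and tw: "\<And>A k. A \<subseteq> {1..n} \<Longrightarrow> k \<in> A \<Longrightarrow>
      intertwines I \<phi> (\<lambda>s. vertex (N s) A) (\<lambda>s. vertex (N s) (A - {k})) (\<lambda>s. edge (N s) A k) (edge H A k)"
    and cl: "closed_nfold n H"
  shows "nfold_groupoid n H"
proof -
  have gr: "groupoid (vertex (N s) A) (vertex (N s) (A - {k})) (edge (N s) A k)"
    if "s \<in> I" "A \<subseteq> {1..n}" "k \<in> A" for s A k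
    using nfold_groupoidD(1)[OF N that(2)] that by auto
  have cle: "closed_edge (vertex H A) (vertex H (A - {k})) (edge H A k)"
    if "A \<subseteq> {1..n}" "k \<in> A" for A k
    using cl that by (auto simp: closed_nfold_def)
  have fa: "functorial_along H A j k" if A: "A \<subseteq> {1..n}" and jk: "j \<in> A" "k \<in> A" "j \<noteq> k" for A j k
  proof -
    have sub: "A - {j} \<subseteq> {1..n}" "A - {k} \<subseteq> {1..n}" "A - {j, k} \<subseteq> {1..n}"
      and eq: "A - {j} - {k} = A - {j, k}" "A - {k} - {j} = A - {j, k}"
      and mem: "k \<in> A - {j}" "j \<in> A - {k}" using that by auto
    have fs: "functorial_along (N s) A j k" if "s \<in> I" for s
      using nfold_groupoidD(2)[OF N[OF that] A jk] by (auto simp: double_groupoid_def)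
    note Sj = tw[OF A jk(1), unfolded intertwines_def, rule_format]
    note Sjk = tw[OF sub(2) mem(2), unfolded intertwines_def eq, rule_format]
    note clj = cle[OF A jk(1), unfolded closed_edge_def]
    note clj' = cle[OF sub(2) mem(2), unfolded closed_edge_def eq]
    note grjk = gr[OF _ sub(1) mem(1), unfolded eq]
    note twjk = tw[OF sub(1) mem(1), unfolded eq]
    show ?thesis
      unfolding functorial_along_def Let_def
    proof (intro conjI)
      show "groupoid_functor (vertex H A) (vertex H (A - {k})) (edge H A k) (vertex H (A - {j}))
        (vertex H (A - {j, k})) (edge H (A - {j}) k) (gsrc (edge H A j)) (gsrc (edge H (A - {k}) j))"
        by (rule groupoid_functor_decomposes[OF dec[OF A] dec[OF sub(2)] tw[OF A jk(2)] gr[OF _ A jk(2)] twjk,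
              where F="\<lambda>s. gsrc (edge (N s) A j)" and Fo="\<lambda>s. gsrc (edge (N s) (A - {k}) j)"])
           (use fs Sj Sjk clj clj' in \<open>auto simp: functorial_along_def Let_def\<close>)
      show "groupoid_functor (vertex H A) (vertex H (A - {k})) (edge H A k) (vertex H (A - {j}))
        (vertex H (A - {j, k})) (edge H (A - {j}) k) (gtgt (edge H A j)) (gtgt (edge H (A - {k}) j))"
        by (rule groupoid_functor_decomposes[OF dec[OF A] dec[OF sub(2)] tw[OF A jk(2)] gr[OF _ A jk(2)] twjk,
              where F="\<lambda>s. gtgt (edge (N s) A j)" and Fo="\<lambda>s. gtgt (edge (N s) (A - {k}) j)"])
           (use fs Sj Sjk clj clj' in \<open>auto simp: functorial_along_def Let_def\<close>)
      show "groupoid_functor (vertex H (A - {j})) (vertex H (A - {j, k})) (edge H (A - {j}) k)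
        (vertex H A) (vertex H (A - {k})) (edge H A k) (gunit (edge H A j)) (gunit (edge H (A - {k}) j))"
        by (rule groupoid_functor_decomposes[OF dec[OF sub(1)] dec[OF sub(3)] twjk grjk tw[OF A jk(2)],
              where F="\<lambda>s. gunit (edge (N s) A j)" and Fo="\<lambda>s. gunit (edge (N s) (A - {k}) j)"])
           (use fs Sj Sjk clj clj' in \<open>auto simp: functorial_along_def Let_def\<close>)
    qed
  qed
  have ic: "interchange (vertex H A) (edge H A j) (edge H A k)"
    if A: "A \<subseteq> {1..n}" and jk: "j \<in> A" "k \<in> A" "j \<noteq> k" for A j k
  proof -
    have sub: "A - {j} \<subseteq> {1..n}" "A - {k} \<subseteq> {1..n}" using that by auto
    show ?thesis
      by (rule interchange_decomposes[OF dec[OF A] dec[OF sub(1)] tw[OF A jk(1)] gr[OF _ A jk(1)]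
            dec[OF sub(2)] tw[OF A jk(2)] gr[OF _ A jk(2)]])
         (use nfold_groupoidD(2)[OF N A jk] in \<open>auto simp: double_groupoid_def\<close>)
  qed
  show ?thesis
    unfolding nfold_groupoid_def double_groupoid_def
  proof (intro conjI allI ballI impI)
    fix A k assume A: "A \<subseteq> {1..n}" "k \<in> A"
    then have "A - {k} \<subseteq> {1..n}" by auto
    then show "groupoid (vertex H A) (vertex H (A - {k})) (edge H A k)"
      using groupoid_decomposes[OF dec dec tw gr cle] A by blast
  qed (use fa ic in auto)
qed

text \<open>The direction \<open>m\<close> is left out of the index sets, so that for \<open>m = Suc n\<close> this is a
  structure with the \<open>n\<close> directions \<open>{1..n}\<close>.\<close>

definition upper_face :: "nat \<Rightarrow> 'a nfold \<Rightarrow> 'a nfold" where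
  "upper_face m G = \<lparr>vertex = (\<lambda>A. vertex G (insert m A)), edge = (\<lambda>A. edge G (insert m A))\<rparr>"

lemma interchange_commute: "interchange M S T \<longleftrightarrow> interchange M T S"
  unfolding interchange_def by metis

lemma double_groupoid_commute: "double_groupoid G A j k \<longleftrightarrow> double_groupoid G A k j"
  unfolding double_groupoid_def using interchange_commute by blast

lemma subset_atLeastAtMost_Suc_cases:
  assumes "A \<subseteq> {1..Suc n}"
  obtains "A \<subseteq> {1..n}" "Suc n \<notin> A" | B where "B \<subseteq> {1..n}" "Suc n \<notin> B" "A = insert (Suc n) B"
proof (cases "Suc n \<in> A")
  case True
  have "A - {Suc n} \<subseteq> {1..n}" using assms by (auto simp: le_Suc_eq)
  with True show thesis using that(2)[of "A - {Suc n}"] by (auto simp: insert_absorb)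
next
  case False
  with assms show thesis using that(1) by (force simp: le_Suc_eq)
qed

lemma double_groupoid_upper_face:
  assumes "j \<noteq> m" "k \<noteq> m"
  shows "double_groupoid (upper_face m G) A j k \<longleftrightarrow> double_groupoid G (insert m A) j k"
proof -
  have "insert m A - {j} = insert m (A - {j})" "insert m A - {k} = insert m (A - {k})"
    "insert m A - {j, k} = insert m (A - {j, k})" "insert m A - {k, j} = insert m (A - {k, j})"
    using assms by auto
  then show ?thesis by (simp add: double_groupoid_def functorial_along_def upper_face_def Let_def)
qed

lemma nfold_groupoid_Suc:
  assumes low: "nfold_groupoid n G" and up: "nfold_groupoid n (upper_face (Suc n) G)"
    and gr: "\<And>A. A \<subseteq> {1..n} \<Longrightarrow>
      groupoid (vertex G (insert (Suc n) A)) (vertex G A) (edge G (insert (Suc n) A) (Suc n))"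
    and dbl: "\<And>A j. A \<subseteq> {1..n} \<Longrightarrow> j \<in> A \<Longrightarrow> double_groupoid G (insert (Suc n) A) j (Suc n)"
  shows "nfold_groupoid (Suc n) G"
  unfolding nfold_groupoid_def
proof (intro conjI allI ballI impI)
  fix A k assume A: "A \<subseteq> {1..Suc n}" and k: "k \<in> A"
  from A show "groupoid (vertex G A) (vertex G (A - {k})) (edge G A k)"
  proof (cases rule: subset_atLeastAtMost_Suc_cases)
    case 1
    then show ?thesis using nfold_groupoidD(1)[OF low] k by auto
  next
    case (2 B)
    show ?thesis
    proof (cases "k = Suc n")
      case True
      then show ?thesis using gr[OF 2(1)] 2 by auto
    next
      case False
      then have "k \<in> B" "insert (Suc n) B - {k} = insert (Suc n) (B - {k})" using 2 k by auto
      then show ?thesis using nfold_groupoidD(1)[OF up 2(1)] 2 by (simp add: upper_face_def)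
    qed
  qed
next
  fix A j k assume A: "A \<subseteq> {1..Suc n}" and jk: "j \<in> A" "k \<in> A" "j \<noteq> k"
  from A show "double_groupoid G A j k"
  proof (cases rule: subset_atLeastAtMost_Suc_cases)
    case 1
    then show ?thesis using nfold_groupoidD(2)[OF low] jk by auto
  next
    case (2 B)
    consider "k = Suc n" "j \<in> B" | "j = Suc n" "k \<in> B" | "j \<in> B" "k \<in> B" using jk 2 by auto
    then show ?thesis
    proof cases
      case 1
      then show ?thesis using dbl 2 by auto
    next
      case j: 2
      then show ?thesis using dbl 2 double_groupoid_commute by metis
    next
      case 3
      then have "j \<noteq> Suc n" "k \<noteq> Suc n" using 2 by auto
      then show ?thesis
        using nfold_groupoidD(2)[OF up 2(1) 3 jk(3)] 2 by (simp add: double_groupoid_upper_face)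
    qed
  qed
qed


section \<open>First-order extensions of subsets of modules\<close>

definition map_gexprs :: "('k \<Rightarrow> 'l) \<Rightarrow> 'k gexprs \<Rightarrow> 'l gexprs" where
  "map_gexprs h L = \<lparr>esrc = map_expr h (esrc L), etgt = map_expr h (etgt L),
     eunit = map_expr h (eunit L), emul = map_expr h (emul L), einv = map_expr h (einv L)\<rparr>"

definition typed_edge :: "('k, 'r) ring_scheme \<Rightarrow> shape \<Rightarrow> shape \<Rightarrow> 'k gexprs \<Rightarrow> bool" where
  "typed_edge R \<sigma> \<tau> L \<longleftrightarrow> typed R \<sigma> (esrc L) \<tau> \<and> typed R \<sigma> (etgt L) \<tau> \<and> typed R \<tau> (eunit L) \<sigma> \<and>
     typed R (ShProd \<sigma> \<sigma>) (emul L) \<sigma> \<and> typed R \<sigma> (einv L) \<sigma>"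

text \<open>The constructions with variable and with fixed \<open>t\<close> differ only in how a morphism
  \<open>(x, v)\<close> over the parameter \<open>s\<close>, or an object \<open>x\<close> over \<open>s\<close>, is
  represented by a point. This is abstracted by \<open>mor\<close> and \<open>ob\<close>; for fixed \<open>t\<close> the
  set \<open>I\<close> of parameters is \<open>{t}\<close>.\<close>

locale first_order =
  fixes R :: "('k, 'r) ring_scheme" and V :: "('k, 'v, 'm) module_scheme" and I :: "'k set"
    and mor :: "'k \<Rightarrow> ('k, 'v) pt \<Rightarrow> ('k, 'v) pt \<Rightarrow> ('k, 'v) pt"
    and ob :: "'k \<Rightarrow> ('k, 'v) pt \<Rightarrow> ('k, 'v) pt"
  assumes mod: "module R V" and params: "I \<subseteq> carrier R"
    and mor_inj: "s \<in> I \<Longrightarrow> s' \<in> I \<Longrightarrow> mor s x v = mor s' x' v' \<longleftrightarrow> s = s' \<and> x = x' \<and> v = v'"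
    and ob_inj: "s \<in> I \<Longrightarrow> s' \<in> I \<Longrightarrow> ob s x = ob s' x' \<longleftrightarrow> s = s' \<and> x = x'"
begin

abbreviation shift :: "'k \<Rightarrow> ('k, 'v) pt \<Rightarrow> ('k, 'v) pt \<Rightarrow> ('k, 'v) pt" where
  "shift s x v \<equiv> padd R V x (psmult R V s v)"

definition mors :: "shape \<Rightarrow> ('k, 'v) pt set \<Rightarrow> ('k, 'v) pt set" where
  "mors \<sigma> Y = {mor s x v |s x v. s \<in> I \<and> x \<in> Y \<and> v \<in> pcarrier R V \<sigma> \<and> shift s x v \<in> Y}"

definition obs :: "('k, 'v) pt set \<Rightarrow> ('k, 'v) pt set" where
  "obs Y = {ob s x |s x. s \<in> I \<and> x \<in> Y}"

definition is_first_order_edge :: "shape \<Rightarrow> ('k, 'v) pt gmaps \<Rightarrow> bool" where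
  "is_first_order_edge \<sigma> S \<longleftrightarrow> (\<forall>s\<in>I. \<forall>x.
     gunit S (ob s x) = mor s x (pzero R V \<sigma>) \<and>
     (\<forall>v. gsrc S (mor s x v) = ob s x \<and> gtgt S (mor s x v) = ob s (shift s x v) \<and>
       ginv S (mor s x v) = mor s (shift s x v) (psmult R V (\<ominus>\<^bsub>R\<^esub> \<one>\<^bsub>R\<^esub>) v) \<and>
       (\<forall>y w. gmul S (mor s y w) (mor s x v) = mor s x (padd R V w v))))"

text \<open>The structure maps of an old direction on the vertices that contain the new direction.\<close>

definition is_ext_edge :: "'k gexprs \<Rightarrow> ('k, 'v) pt gmaps \<Rightarrow> bool" where
  "is_ext_edge L S \<longleftrightarrow> (\<forall>s\<in>I. \<forall>x v.
     gsrc S (mor s x v) = mor s (eval R V (esrc L) x) (dq R V (esrc L) s x v) \<and>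
     gtgt S (mor s x v) = mor s (eval R V (etgt L) x) (dq R V (etgt L) s x v) \<and>
     gunit S (mor s x v) = mor s (eval R V (eunit L) x) (dq R V (eunit L) s x v) \<and>
     ginv S (mor s x v) = mor s (eval R V (einv L) x) (dq R V (einv L) s x v) \<and>
     (\<forall>y w. gmul S (mor s x v) (mor s y w) =
       mor s (eval R V (emul L) (Tup x y)) (dq R V (emul L) s (Tup x y) (Tup v w))))"

text \<open>The structure maps of an old direction on the vertices that do not contain the new direction.\<close>

definition is_copy_edge :: "'k gexprs \<Rightarrow> ('k, 'v) pt gmaps \<Rightarrow> bool" where
  "is_copy_edge L S \<longleftrightarrow> (\<forall>s\<in>I. \<forall>x.
     gsrc S (ob s x) = ob s (eval R V (esrc L) x) \<and>
     gtgt S (ob s x) = ob s (eval R V (etgt L) x) \<and>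
     gunit S (ob s x) = ob s (eval R V (eunit L) x) \<and>
     ginv S (ob s x) = ob s (eval R V (einv L) x) \<and>
     (\<forall>y. gmul S (ob s x) (ob s y) = ob s (eval R V (emul L) (Tup x y))))"

lemma params_carrier: "s \<in> I \<Longrightarrow> s \<in> carrier R"
  using params by auto

lemma first_order_edge_simps:
  assumes "is_first_order_edge \<sigma> S" and "s \<in> I"
  shows "gunit S (ob s x) = mor s x (pzero R V \<sigma>)" "gsrc S (mor s x v) = ob s x"
    "gtgt S (mor s x v) = ob s (shift s x v)"
    "ginv S (mor s x v) = mor s (shift s x v) (psmult R V (\<ominus>\<^bsub>R\<^esub> \<one>\<^bsub>R\<^esub>) v)"
    "gmul S (mor s y w) (mor s x v) = mor s x (padd R V w v)"
  using assms unfolding is_first_order_edge_def by blast+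

lemma ext_edge_simps:
  assumes "is_ext_edge L S" and "s \<in> I"
  shows "gsrc S (mor s x v) = mor s (eval R V (esrc L) x) (dq R V (esrc L) s x v)"
    "gtgt S (mor s x v) = mor s (eval R V (etgt L) x) (dq R V (etgt L) s x v)"
    "gunit S (mor s x v) = mor s (eval R V (eunit L) x) (dq R V (eunit L) s x v)"
    "ginv S (mor s x v) = mor s (eval R V (einv L) x) (dq R V (einv L) s x v)"
    "gmul S (mor s x v) (mor s y w) =
       mor s (eval R V (emul L) (Tup x y)) (dq R V (emul L) s (Tup x y) (Tup v w))"
  using assms unfolding is_ext_edge_def by blast+

lemma copy_edge_simps:
  assumes "is_copy_edge L S" and "s \<in> I"
  shows "gsrc S (ob s x) = ob s (eval R V (esrc L) x)"
    "gtgt S (ob s x) = ob s (eval R V (etgt L) x)"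
    "gunit S (ob s x) = ob s (eval R V (eunit L) x)"
    "ginv S (ob s x) = ob s (eval R V (einv L) x)"
    "gmul S (ob s x) (ob s y) = ob s (eval R V (emul L) (Tup x y))"
  using assms unfolding is_copy_edge_def by blast+

lemma morsE:
  assumes "a \<in> mors \<sigma> Y"
  obtains s x v where "s \<in> I" "x \<in> Y" "v \<in> pcarrier R V \<sigma>" "shift s x v \<in> Y" "a = mor s x v"
  using assms by (auto simp: mors_def)

lemma obsE:
  assumes "a \<in> obs Y"
  obtains s x where "s \<in> I" "x \<in> Y" "a = ob s x"
  using assms by (auto simp: obs_def)

lemma morsI:
  "s \<in> I \<Longrightarrow> x \<in> Y \<Longrightarrow> v \<in> pcarrier R V \<sigma> \<Longrightarrow> shift s x v \<in> Y \<Longrightarrow> mor s x v \<in> mors \<sigma> Y"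
  by (auto simp: mors_def)

lemma obsI: "s \<in> I \<Longrightarrow> x \<in> Y \<Longrightarrow> ob s x \<in> obs Y"
  by (auto simp: obs_def)

lemma composable_first_orderE:
  assumes S: "is_first_order_edge \<sigma> S" and "composable (mors \<sigma> Y) S a b"
  obtains s x v w where "s \<in> I" "x \<in> Y" "v \<in> pcarrier R V \<sigma>" "w \<in> pcarrier R V \<sigma>"
    "shift s x v \<in> Y" "shift s (shift s x v) w \<in> Y" "a = mor s (shift s x v) w" "b = mor s x v"
proof -
  have a: "a \<in> mors \<sigma> Y" and b: "b \<in> mors \<sigma> Y" and ab: "gsrc S a = gtgt S b"
    using assms(2) by (auto simp: composable_def)
  obtain s y w where 1: "s \<in> I" "y \<in> Y" "w \<in> pcarrier R V \<sigma>" "shift s y w \<in> Y" "a = mor s y w"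
    using a by (rule morsE)
  obtain s' x v where 2: "s' \<in> I" "x \<in> Y" "v \<in> pcarrier R V \<sigma>" "shift s' x v \<in> Y" "b = mor s' x v"
    using b by (rule morsE)
  have "s = s' \<and> y = shift s' x v"
    using ab 1 2 by (simp add: first_order_edge_simps[OF S] ob_inj)
  with 1 2 that show thesis by auto
qed

lemma groupoid_first_order:
  assumes S: "is_first_order_edge \<sigma> S" and Y: "Y \<subseteq> pcarrier R V \<sigma>"
  shows "groupoid (mors \<sigma> Y) (obs Y) S"
proof -
  note simps = first_order_edge_simps[OF S] params_carrier
    padd_psmult_zero[OF mod, where \<tau>=\<sigma>] padd_step_neg[OF mod, where \<tau>=\<sigma>]
    padd_zero[OF mod, where \<tau>=\<sigma>] pneg_add[OF mod, where \<tau>=\<sigma>]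
    padd_step[OF mod, where \<tau>=\<sigma>]
  note intros = morsI obsI padd_closed[OF mod] pneg_closed[OF mod] pzero_closed[OF mod]
  show ?thesis
  proof
    fix a b c assume ab: "composable (mors \<sigma> Y) S a b" and bc: "composable (mors \<sigma> Y) S b c"
    obtain s x v w where 1: "s \<in> I" "v \<in> pcarrier R V \<sigma>" "w \<in> pcarrier R V \<sigma>"
      "a = mor s (shift s x v) w" "b = mor s x v"
      using composable_first_orderE[OF S ab] by metis
    obtain s' x' v' w' where 2: "s' \<in> I" "v' \<in> pcarrier R V \<sigma>" "w' \<in> pcarrier R V \<sigma>"
      "b = mor s' (shift s' x' v') w'" "c = mor s' x' v'"
      using composable_first_orderE[OF S bc] by metis
    have "s = s'" "v = w'" using 1 2 mor_inj[of s' s] by auto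
    then show "gmul S (gmul S a b) c = gmul S a (gmul S b c)"
      using 1 2 by (simp add: simps padd_assoc[OF mod, where \<tau>=\<sigma>])
  qed (use Y in \<open>auto simp: simps subset_iff intro!: intros elim!: morsE obsE composable_first_orderE[OF S]\<close>)
qed

text \<open>Naturality of the first-order construction in polynomial maps. Compatibility with targets, units
  and products is \<open>eval_increment\<close>, \<open>dq_zero\<close> and \<open>dq_add\<close>, respectively.\<close>

lemma first_order_functor:
  assumes S: "is_first_order_edge \<sigma> S" and S': "is_first_order_edge \<tau> S'"
    and Y: "Y \<subseteq> pcarrier R V \<sigma>" and e: "typed R \<sigma> e \<tau>" and Y': "\<And>x. x \<in> Y \<Longrightarrow> eval R V e x \<in> Y'"
    and F: "\<And>s x v. s \<in> I \<Longrightarrow> F (mor s x v) = mor s (eval R V e x) (dq R V e s x v)"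
    and Fo: "\<And>s x. s \<in> I \<Longrightarrow> Fo (ob s x) = ob s (eval R V e x)"
  shows "groupoid_functor (mors \<sigma> Y) (obs Y) S (mors \<tau> Y') (obs Y') S' F Fo"
proof -
  have inc: "shift s (eval R V e x) (dq R V e s x v) = eval R V e (shift s x v)"
    if "s \<in> I" "x \<in> Y" "v \<in> pcarrier R V \<sigma>" for s x v
    using eval_increment[OF mod e subsetD[OF Y] _ params_carrier] that by simp
  note simps = first_order_edge_simps[OF S] first_order_edge_simps[OF S'] F Fo inc
  show ?thesis
    unfolding groupoid_functor_def
  proof (intro conjI ballI allI impI funcsetI)
    fix a assume "a \<in> mors \<sigma> Y"
    then obtain s x v where a: "s \<in> I" "x \<in> Y" "v \<in> pcarrier R V \<sigma>" "shift s x v \<in> Y" "a = mor s x v"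
      by (rule morsE)
    then show "F a \<in> mors \<tau> Y'"
      using Y params by (auto simp: simps intro!: morsI Y' dq_closed[OF mod e])
    show "gsrc S' (F a) = Fo (gsrc S a)" "gtgt S' (F a) = Fo (gtgt S a)"
      using a by (auto simp: simps)
  next
    fix a assume "a \<in> obs Y"
    then obtain s x where a: "s \<in> I" "x \<in> Y" "a = ob s x"
      by (rule obsE)
    then show "Fo a \<in> obs Y'" by (auto simp: simps intro!: obsI Y')
    show "F (gunit S a) = gunit S' (Fo a)"
      using a dq_zero[OF mod e subsetD[OF Y] params_carrier] by (auto simp: simps)
  next
    fix a b assume "composable (mors \<sigma> Y) S a b"
    from composable_first_orderE[OF S this] obtain s x v w
      where "s \<in> I" "x \<in> Y" "v \<in> pcarrier R V \<sigma>" "w \<in> pcarrier R V \<sigma>"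
        "a = mor s (shift s x v) w" "b = mor s x v" by metis
    then show "F (gmul S a b) = gmul S' (F a) (F b)"
      using dq_add[OF mod e subsetD[OF Y] _ _ params_carrier] by (auto simp: simps)
  qed
qed

text \<open>Since the difference quotients of source and target agree on a composable pair, source and target
  also agree after the shift, by \<open>eval_increment\<close>. This allows one to check closedness and
  functoriality at the two end points.\<close>

lemma composable_extE:
  assumes L: "typed_edge R \<sigma> \<tau> L" and S: "is_ext_edge L S" and Y: "Y \<subseteq> pcarrier R V \<sigma>"
    and "composable (mors \<sigma> Y) S a b"
  obtains s x v y w where "s \<in> I" "x \<in> Y" "v \<in> pcarrier R V \<sigma>" "shift s x v \<in> Y"
    "y \<in> Y" "w \<in> pcarrier R V \<sigma>" "shift s y w \<in> Y" "a = mor s x v" "b = mor s y w"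
    "composable Y (interp R V L) x y" "composable Y (interp R V L) (shift s x v) (shift s y w)"
proof -
  have a: "a \<in> mors \<sigma> Y" and b: "b \<in> mors \<sigma> Y" and ab: "gsrc S a = gtgt S b"
    using assms(4) by (auto simp: composable_def)
  obtain s x v where 1: "s \<in> I" "x \<in> Y" "v \<in> pcarrier R V \<sigma>" "shift s x v \<in> Y" "a = mor s x v"
    using a by (rule morsE)
  obtain s' y w where 2: "s' \<in> I" "y \<in> Y" "w \<in> pcarrier R V \<sigma>" "shift s' y w \<in> Y" "b = mor s' y w"
    using b by (rule morsE)
  have s: "s' = s" and eq: "eval R V (esrc L) x = eval R V (etgt L) y"
    and deq: "dq R V (esrc L) s x v = dq R V (etgt L) s y w"
    using ab 1 2 by (auto simp: ext_edge_simps[OF S] mor_inj)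
  have "eval R V (esrc L) (shift s x v) = eval R V (etgt L) (shift s y w)"
    using eval_increment[OF mod _ subsetD[OF Y] _ params_carrier, of "esrc L" \<tau> x v s]
      eval_increment[OF mod _ subsetD[OF Y] _ params_carrier, of "etgt L" \<tau> y w s]
      L 1 2 eq deq s by (simp add: typed_edge_def)
  with that 1 2 s eq show thesis by (auto simp: composable_def interp_def)
qed

lemma composable_copyE:
  assumes S: "is_copy_edge L S" and "composable (obs Y) S a b"
  obtains s x y where "s \<in> I" "x \<in> Y" "y \<in> Y" "a = ob s x" "b = ob s y"
    "composable Y (interp R V L) x y"
  using assms(2) unfolding composable_def
  by (auto elim!: obsE simp: copy_edge_simps[OF S] ob_inj interp_def)

lemma pair_increment:
  assumes "typed_edge R \<sigma> \<tau> L" "s \<in> I" "x \<in> pcarrier R V \<sigma>" "v \<in> pcarrier R V \<sigma>"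
    "y \<in> pcarrier R V \<sigma>" "w \<in> pcarrier R V \<sigma>"
  shows "shift s (eval R V (emul L) (Tup x y)) (dq R V (emul L) s (Tup x y) (Tup v w)) =
      eval R V (emul L) (Tup (shift s x v) (shift s y w))"
    and "dq R V (emul L) s (Tup x y) (Tup v w) \<in> pcarrier R V \<sigma>"
  using assms eval_increment[OF mod, of "ShProd \<sigma> \<sigma>" "emul L" \<sigma> "Tup x y" "Tup v w" s]
    params
  by (auto simp: typed_edge_def intro!: dq_closed[OF mod])

lemma pair_zero:
  assumes "typed_edge R \<sigma> \<tau> L" "s \<in> I" "x \<in> pcarrier R V \<sigma>" "y \<in> pcarrier R V \<sigma>"
  shows "dq R V (emul L) s (Tup x y) (Tup (pzero R V \<sigma>) (pzero R V \<sigma>)) = pzero R V \<sigma>"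
  using assms dq_zero[OF mod, of "ShProd \<sigma> \<sigma>" "emul L" \<sigma> "Tup x y" s] params
  by (auto simp: typed_edge_def)

lemma closed_ext_edge:
  assumes L: "typed_edge R \<sigma> \<tau> L" and S: "is_ext_edge L S"
    and Y: "Y \<subseteq> pcarrier R V \<sigma>" and Z: "Z \<subseteq> pcarrier R V \<tau>"
    and cl: "closed_edge Y Z (interp R V L)"
  shows "closed_edge (mors \<sigma> Y) (mors \<tau> Z) S"
proof -
  have ext: "mor s (eval R V e x) (dq R V e s x v) \<in> mors \<tau>' Z'"
    if e: "typed R \<sigma>' e \<tau>'" and Y': "Y' \<subseteq> pcarrier R V \<sigma>'" and m: "\<forall>y\<in>Y'. eval R V e y \<in> Z'"
      and "s \<in> I" "x \<in> Y'" "v \<in> pcarrier R V \<sigma>'" "shift s x v \<in> Y'" for \<sigma>' \<tau>' e Y' Z' s x v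
    using eval_increment[OF mod e subsetD[OF Y'] _ params_carrier, of x v s, symmetric] that params
    by (auto intro!: morsI dq_closed[OF mod e])
  note cl' = cl[unfolded closed_edge_def interp_def, simplified]
  show ?thesis
    unfolding closed_edge_def
  proof (intro conjI ballI allI impI)
    fix a assume "a \<in> mors \<sigma> Y"
    then obtain s x v where a: "s \<in> I" "x \<in> Y" "v \<in> pcarrier R V \<sigma>" "shift s x v \<in> Y" "a = mor s x v"
      by (rule morsE)
    show "gsrc S a \<in> mors \<tau> Z" "gtgt S a \<in> mors \<tau> Z" "ginv S a \<in> mors \<sigma> Y"
      using a cl' L by (auto simp: ext_edge_simps[OF S] typed_edge_def intro!: ext[OF _ Y])
  next
    fix a assume "a \<in> mors \<tau> Z"
    then obtain s x v where a: "s \<in> I" "x \<in> Z" "v \<in> pcarrier R V \<tau>" "shift s x v \<in> Z" "a = mor s x v"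
      by (rule morsE)
    show "gunit S a \<in> mors \<sigma> Y"
      using a cl' L by (auto simp: ext_edge_simps[OF S] typed_edge_def intro!: ext[OF _ Z])
  next
    fix a b assume "composable (mors \<sigma> Y) S a b"
    from composable_extE[OF L S Y this] obtain s x v y w where
      *: "s \<in> I" "x \<in> Y" "v \<in> pcarrier R V \<sigma>" "y \<in> Y" "w \<in> pcarrier R V \<sigma>"
        "a = mor s x v" "b = mor s y w"
        "composable Y (interp R V L) x y" "composable Y (interp R V L) (shift s x v) (shift s y w)"
      by metis
    have "gmul (interp R V L) x y \<in> Y" "gmul (interp R V L) (shift s x v) (shift s y w) \<in> Y"
      using cl * by (auto simp: closed_edge_def)
    then show "gmul S a b \<in> mors \<sigma> Y"
      using * pair_increment[OF L _ subsetD[OF Y] _ subsetD[OF Y], of s x v y w]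
      by (auto simp: ext_edge_simps[OF S] interp_def intro!: morsI)
  qed
qed

lemma closed_copy_edge:
  assumes S: "is_copy_edge L S" and cl: "closed_edge Y Z (interp R V L)"
  shows "closed_edge (obs Y) (obs Z) S"
proof -
  note cl' = cl[unfolded closed_edge_def]
  show ?thesis
    unfolding closed_edge_def
  proof (intro conjI ballI allI impI)
    fix a b assume "composable (obs Y) S a b"
    from composable_copyE[OF S this] obtain s x y where
      "s \<in> I" "a = ob s x" "b = ob s y" "composable Y (interp R V L) x y" by metis
    moreover then have "gmul (interp R V L) x y \<in> Y" using cl' by blast
    ultimately show "gmul S a b \<in> obs Y" by (auto simp: copy_edge_simps[OF S] interp_def intro!: obsI)
  qed (use cl' in \<open>auto simp: copy_edge_simps[OF S] interp_def elim!: obsE intro!: obsI\<close>)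
qed

text \<open>The converse half of the double groupoid conditions: source, target and unit in the new direction
  commute with the extensions of the structure maps of the old direction.\<close>

lemma first_order_maps_functors:
  assumes L: "typed_edge R \<sigma> \<tau> L" and S: "is_ext_edge L S" and T: "is_copy_edge L T"
    and N: "is_first_order_edge \<sigma> N" and No: "is_first_order_edge \<tau> No"
    and Y: "Y \<subseteq> pcarrier R V \<sigma>" and Z: "Z \<subseteq> pcarrier R V \<tau>"
    and cl: "closed_edge Y Z (interp R V L)"
  shows "groupoid_functor (mors \<sigma> Y) (mors \<tau> Z) S (obs Y) (obs Z) T (gsrc N) (gsrc No)"
    and "groupoid_functor (mors \<sigma> Y) (mors \<tau> Z) S (obs Y) (obs Z) T (gtgt N) (gtgt No)"
    and "groupoid_functor (obs Y) (obs Z) T (mors \<sigma> Y) (mors \<tau> Z) S (gunit N) (gunit No)"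
proof -
  have inc: "shift s (eval R V e x) (dq R V e s x v) = eval R V e (shift s x v)"
    if "typed R \<sigma>' e \<tau>'" "s \<in> I" "x \<in> pcarrier R V \<sigma>'" "v \<in> pcarrier R V \<sigma>'" for \<sigma>' \<tau>' e s x v
    using eval_increment[OF mod that(1), of x v s] that params by auto
  have zero: "dq R V e s x (pzero R V \<sigma>') = pzero R V \<tau>'"
    if "typed R \<sigma>' e \<tau>'" "s \<in> I" "x \<in> pcarrier R V \<sigma>'" for \<sigma>' \<tau>' e s x
    using dq_zero[OF mod that(1)] that params by auto
  note simps = ext_edge_simps[OF S] copy_edge_simps[OF T] first_order_edge_simps[OF N]
    first_order_edge_simps[OF No]
  note L' = L[unfolded typed_edge_def]
  have Y': "x \<in> pcarrier R V \<sigma>" if "x \<in> Y" for x using that Y by auto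
  have Z': "x \<in> pcarrier R V \<tau>" if "x \<in> Z" for x using that Z by auto
  show "groupoid_functor (mors \<sigma> Y) (mors \<tau> Z) S (obs Y) (obs Z) T (gsrc N) (gsrc No)"
    unfolding groupoid_functor_def
    by (intro conjI ballI allI impI funcsetI)
       (auto simp: simps elim!: morsE composable_extE[OF L S Y] intro!: obsI)
  show "groupoid_functor (mors \<sigma> Y) (mors \<tau> Z) S (obs Y) (obs Z) T (gtgt N) (gtgt No)"
    unfolding groupoid_functor_def
    by (intro conjI ballI allI impI funcsetI)
       (use L' in \<open>auto simp: simps inc[where \<sigma>'=\<sigma> and \<tau>'=\<tau>] inc[where \<sigma>'=\<tau> and \<tau>'=\<sigma>] Y' Z'
          pair_increment[OF L] elim!: morsE composable_extE[OF L S Y] intro!: obsI\<close>)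
  show "groupoid_functor (obs Y) (obs Z) T (mors \<sigma> Y) (mors \<tau> Z) S (gunit N) (gunit No)"
    unfolding groupoid_functor_def
    by (intro conjI ballI allI impI funcsetI)
       (use L' in \<open>auto simp: simps zero[where \<sigma>'=\<sigma> and \<tau>'=\<tau>] zero[where \<sigma>'=\<tau> and \<tau>'=\<sigma>] Y' Z'
          pair_zero[OF L] pzero_closed[OF mod] params_carrier
          padd_psmult_zero[OF mod, where \<tau>=\<sigma>] padd_psmult_zero[OF mod, where \<tau>=\<tau>]
          elim!: obsE composable_copyE[OF T] intro!: morsI\<close>)
qed

text \<open>The interchange law is \<open>dq_add\<close> for the product map \<open>emul L\<close>.\<close>

lemma interchange_first_order:
  assumes L: "typed_edge R \<sigma> \<tau> L" and S: "is_ext_edge L S" and N: "is_first_order_edge \<sigma> N"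
    and Y: "Y \<subseteq> pcarrier R V \<sigma>"
  shows "interchange (mors \<sigma> Y) S N"
  unfolding interchange_def
proof (intro allI impI, elim conjE)
  fix a b c d
  assume ac: "composable (mors \<sigma> Y) N a c" and bd: "composable (mors \<sigma> Y) N b d"
    and ab: "composable (mors \<sigma> Y) S a b" and cd: "composable (mors \<sigma> Y) S c d"
  obtain s x v w where 1: "s \<in> I" "x \<in> Y" "v \<in> pcarrier R V \<sigma>" "w \<in> pcarrier R V \<sigma>"
      "a = mor s (shift s x v) w" "c = mor s x v"
    using composable_first_orderE[OF N ac] by metis
  obtain s' y v' w' where 2: "s' \<in> I" "y \<in> Y" "v' \<in> pcarrier R V \<sigma>" "w' \<in> pcarrier R V \<sigma>"
      "b = mor s' (shift s' y v') w'" "d = mor s' y v'"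
    using composable_first_orderE[OF N bd] by metis
  have "gsrc S c = gtgt S d" using cd by (simp add: composable_def)
  then have s: "s' = s" using 1 2 by (simp add: ext_edge_simps[OF S] mor_inj)
  have "dq R V (emul L) s (Tup x y) (padd R V (Tup w w') (Tup v v')) =
    padd R V (dq R V (emul L) s (shift s (Tup x y) (Tup v v')) (Tup w w'))
      (dq R V (emul L) s (Tup x y) (Tup v v'))"
    by (rule dq_add[OF mod, of "ShProd \<sigma> \<sigma>" _ \<sigma>])
       (use 1 2 L Y params in \<open>auto simp: typed_edge_def\<close>)
  then show "gmul S (gmul N a c) (gmul N b d) = gmul N (gmul S a b) (gmul S c d)"
    using 1 2 s by (simp add: ext_edge_simps[OF S] first_order_edge_simps[OF N])
qed

end

text \<open>One step of the iteration: \<open>G\<close> arises from the formal n-fold groupoid \<open>L\<close> by adding the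
  direction \<open>Suc n\<close>.\<close>

locale first_order_extension = first_order R V I mor ob
  for R :: "('k, 'r) ring_scheme" and V :: "('k, 'v, 'm) module_scheme" and I mor ob +
  fixes n :: nat and shp :: "nat set \<Rightarrow> shape" and L :: "('k, 'v) formal_nfold"
    and G :: "('k, 'v) pt nfold"
  assumes low_vertex: "A \<subseteq> {1..n} \<Longrightarrow> fvertex L A \<subseteq> pcarrier R V (shp A)"
    and low_typed: "A \<subseteq> {1..n} \<Longrightarrow> k \<in> A \<Longrightarrow> typed_edge R (shp A) (shp (A - {k})) (fedge L A k)"
    and upper_vertex: "A \<subseteq> {1..n} \<Longrightarrow> vertex G (insert (Suc n) A) = mors (shp A) (fvertex L A)"
    and lower_vertex: "A \<subseteq> {1..n} \<Longrightarrow> vertex G A = obs (fvertex L A)"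
    and new_edge: "A \<subseteq> {1..n} \<Longrightarrow> is_first_order_edge (shp A) (edge G (insert (Suc n) A) (Suc n))"
    and upper_edge: "A \<subseteq> {1..n} \<Longrightarrow> k \<in> A \<Longrightarrow> is_ext_edge (fedge L A k) (edge G (insert (Suc n) A) k)"
    and lower_edge: "A \<subseteq> {1..n} \<Longrightarrow> k \<in> A \<Longrightarrow> is_copy_edge (fedge L A k) (edge G A k)"
begin

lemma closed_low_edge:
  assumes "closed_nfold n (realize R V L)" "A \<subseteq> {1..n}" "k \<in> A"
  shows "closed_edge (fvertex L A) (fvertex L (A - {k})) (interp R V (fedge L A k))"
  using assms by (auto simp: closed_nfold_def realize_def)

lemma closed_lower_face:
  assumes "closed_nfold n (realize R V L)"
  shows "closed_nfold n G"
  unfolding closed_nfold_def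
proof (intro allI impI ballI)
  fix A k assume A: "A \<subseteq> {1..n}" "k \<in> A"
  moreover then have "A - {k} \<subseteq> {1..n}" by auto
  ultimately show "closed_edge (vertex G A) (vertex G (A - {k})) (edge G A k)"
    using closed_copy_edge[OF lower_edge closed_low_edge[OF assms]] by (simp add: lower_vertex)
qed

lemma closed_upper_face:
  assumes "closed_nfold n (realize R V L)"
  shows "closed_nfold n (upper_face (Suc n) G)"
  unfolding closed_nfold_def
proof (intro allI impI ballI)
  fix A k assume A: "A \<subseteq> {1..n}" "k \<in> A"
  moreover then have "A - {k} \<subseteq> {1..n}" by auto
  ultimately show "closed_edge (vertex (upper_face (Suc n) G) A) (vertex (upper_face (Suc n) G) (A - {k}))
      (edge (upper_face (Suc n) G) A k)"
    using closed_ext_edge[OF low_typed upper_edge low_vertex low_vertex closed_low_edge[OF assms]]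
    by (simp add: upper_vertex upper_face_def)
qed

lemma groupoid_new_edge:
  assumes "A \<subseteq> {1..n}"
  shows "groupoid (vertex G (insert (Suc n) A)) (vertex G A) (edge G (insert (Suc n) A) (Suc n))"
  using groupoid_first_order[OF new_edge low_vertex] assms by (simp add: upper_vertex lower_vertex)

lemma double_groupoid_new_edge:
  assumes "closed_nfold n (realize R V L)" and A: "A \<subseteq> {1..n}" "j \<in> A"
  shows "double_groupoid G (insert (Suc n) A) j (Suc n)"
proof -
  have neq: "j \<noteq> Suc n" "Suc n \<notin> A" using A by auto
  have Aj: "A - {j} \<subseteq> {1..n}" using A by auto
  have sets: "insert (Suc n) A - {j} = insert (Suc n) (A - {j})" "insert (Suc n) A - {Suc n} = A"
    "insert (Suc n) A - {j, Suc n} = A - {j}" "insert (Suc n) A - {Suc n, j} = A - {j}"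
    using neq by auto
  note cl = closed_low_edge[OF assms]
  note cl' = cl[unfolded closed_edge_def interp_def, simplified]
  note ty = low_typed[OF A]
  have vs: "vertex G (insert (Suc n) A) = mors (shp A) (fvertex L A)" "vertex G A = obs (fvertex L A)"
    "vertex G (insert (Suc n) (A - {j})) = mors (shp (A - {j})) (fvertex L (A - {j}))"
    "vertex G (A - {j}) = obs (fvertex L (A - {j}))"
    by (rule upper_vertex lower_vertex A Aj)+
  note poly = typed_edge_def ext_edge_simps[OF upper_edge[OF A]]
    copy_edge_simps[OF lower_edge[OF A]]
  have "functorial_along G (insert (Suc n) A) j (Suc n)"
    unfolding functorial_along_def Let_def sets vs
  proof (intro conjI)
    show "groupoid_functor (mors (shp A) (fvertex L A)) (obs (fvertex L A))
        (edge G (insert (Suc n) A) (Suc n)) (mors (shp (A - {j})) (fvertex L (A - {j})))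
        (obs (fvertex L (A - {j}))) (edge G (insert (Suc n) (A - {j})) (Suc n))
        (gsrc (edge G (insert (Suc n) A) j)) (gsrc (edge G A j))"
      by (rule first_order_functor[OF new_edge[OF A(1)] new_edge[OF Aj] low_vertex[OF A(1)],
            of "esrc (fedge L A j)"]) (use cl' ty in \<open>simp_all add: poly\<close>)
    show "groupoid_functor (mors (shp A) (fvertex L A)) (obs (fvertex L A))
        (edge G (insert (Suc n) A) (Suc n)) (mors (shp (A - {j})) (fvertex L (A - {j})))
        (obs (fvertex L (A - {j}))) (edge G (insert (Suc n) (A - {j})) (Suc n))
        (gtgt (edge G (insert (Suc n) A) j)) (gtgt (edge G A j))"
      by (rule first_order_functor[OF new_edge[OF A(1)] new_edge[OF Aj] low_vertex[OF A(1)],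
            of "etgt (fedge L A j)"]) (use cl' ty in \<open>simp_all add: poly\<close>)
    show "groupoid_functor (mors (shp (A - {j})) (fvertex L (A - {j})))
        (obs (fvertex L (A - {j}))) (edge G (insert (Suc n) (A - {j})) (Suc n))
        (mors (shp A) (fvertex L A)) (obs (fvertex L A)) (edge G (insert (Suc n) A) (Suc n))
        (gunit (edge G (insert (Suc n) A) j)) (gunit (edge G A j))"
      by (rule first_order_functor[OF new_edge[OF Aj] new_edge[OF A(1)] low_vertex[OF Aj],
            of "eunit (fedge L A j)"]) (use cl' ty in \<open>simp_all add: poly\<close>)
  qed
  moreover have "functorial_along G (insert (Suc n) A) (Suc n) j"
    unfolding functorial_along_def Let_def sets vs
    by (intro conjI; rule first_order_maps_functors[OF ty upper_edge[OF A] lower_edge[OF A]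
          new_edge[OF A(1)] new_edge[OF Aj] low_vertex[OF A(1)] low_vertex[OF Aj] cl])
  moreover have "interchange (vertex G (insert (Suc n) A)) (edge G (insert (Suc n) A) j)
      (edge G (insert (Suc n) A) (Suc n))"
    unfolding vs by (rule interchange_first_order[OF ty upper_edge[OF A] new_edge[OF A(1)] low_vertex[OF A(1)]])
  ultimately show ?thesis by (simp add: double_groupoid_def)
qed

lemma closed_nfold_Suc:
  assumes "closed_nfold n (realize R V L)"
  shows "closed_nfold (Suc n) G"
  unfolding closed_nfold_def
proof (intro allI impI ballI)
  fix A k assume A: "A \<subseteq> {1..Suc n}" and k: "k \<in> A"
  from A show "closed_edge (vertex G A) (vertex G (A - {k})) (edge G A k)"
  proof (cases rule: subset_atLeastAtMost_Suc_cases)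
    case 1
    then show ?thesis using closed_lower_face[OF assms] k by (auto simp: closed_nfold_def)
  next
    case (2 B)
    show ?thesis
    proof (cases "k = Suc n")
      case True
      then have "groupoid (vertex G A) (vertex G (A - {k})) (edge G A k)"
        using groupoid_new_edge 2 by auto
      then show ?thesis
        by (auto simp: closed_edge_def groupoid.src_closed groupoid.tgt_closed groupoid.inv_closed
            groupoid.unit_closed groupoid.mul_closed)
    next
      case False
      then have "k \<in> B" "insert (Suc n) B - {k} = insert (Suc n) (B - {k})" using 2 k by auto
      then show ?thesis
        using closed_upper_face[OF assms] 2 by (auto simp: closed_nfold_def upper_face_def)
    qed
  qed
qed

lemma nfold_groupoid_lower_face:
  assumes "nfold_groupoid n (realize R V L)" and "closed_nfold n (realize R V L)"
  shows "nfold_groupoid n G"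
proof (rule nfold_groupoid_decomposes[where N="\<lambda>_. realize R V L" and I=I and \<phi>=ob])
  fix A k assume A: "A \<subseteq> {1..n}" "k \<in> A"
  show "intertwines I ob (\<lambda>s. vertex (realize R V L) A) (\<lambda>s. vertex (realize R V L) (A - {k}))
      (\<lambda>s. edge (realize R V L) A k) (edge G A k)"
    using copy_edge_simps[OF lower_edge[OF A]] by (simp add: intertwines_def realize_def interp_def)
qed (use assms in \<open>auto simp: decomposes_def lower_vertex realize_def ob_inj closed_lower_face elim!: obsE\<close>)

end

text \<open>The inductive step. The faces of \<open>G\<close> that contain the new direction form the disjoint union of
  the n-fold groupoids \<open>N s\<close>, which are the interpretations of \<open>L\<close> over the rings
  \<open>R[\<delta>] / (\<delta>\<^sup>2 - s \<delta>)\<close>.\<close>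

lemma nfold_groupoid_first_order_extension:
  fixes R :: "'k tower ring" and V :: "('k tower, 'v tower) module"
  assumes "first_order_extension R V I mor ob n shp L G"
    and low: "nfold_groupoid n (realize R V L)" and cl: "closed_nfold n (realize R V L)"
    and N: "\<And>s. s \<in> I \<Longrightarrow> nfold_groupoid n (N s)"
    and N_vertex: "\<And>s A. s \<in> I \<Longrightarrow> A \<subseteq> {1..n} \<Longrightarrow>
      vertex (N s) A = pcarrier (ext_ring R s) (ext_module V s) (shp A)"
    and N_edge: "\<And>s A k. s \<in> I \<Longrightarrow> A \<subseteq> {1..n} \<Longrightarrow> k \<in> A \<Longrightarrow>
      edge (N s) A k = interp (ext_ring R s) (ext_module V s) (map_gexprs (const_ext R) (fedge L A k))"
  shows "nfold_groupoid (Suc n) G"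
proof -
  interpret first_order_extension R V I mor ob n shp L G by fact
  \<comment> \<open>the map \<open>x + \<delta> v \<mapsto> (x, v, s)\<close>\<close>
  let ?\<phi> = "\<lambda>s z. mor s (map_pt re re z) (map_pt im im z)"
  have \<phi>: "?\<phi> s (with_delta x v) = mor s x v"
    if "x \<in> pcarrier R V \<sigma>" "v \<in> pcarrier R V \<sigma>" for s x v \<sigma>
    using map_pt_with_delta[OF that] by simp
  have ext: "?\<phi> s (eval (ext_ring R s) (ext_module V s) (map_expr (const_ext R) e) (with_delta x v)) =
      mor s (eval R V e x) (dq R V e s x v)"
    if "typed R \<sigma> e \<tau>" "s \<in> I" "x \<in> pcarrier R V \<sigma>" "v \<in> pcarrier R V \<sigma>" for \<sigma> e \<tau> s x v
    using eval_ext[OF mod _ that(1,3,4), of s] params_carrier[OF that(2)]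
      \<phi>[OF eval_closed[OF mod that(1,3)] dq_closed[OF mod that(1,3,4)]] by simp
  have "nfold_groupoid n (upper_face (Suc n) G)"
  proof (rule nfold_groupoid_decomposes[where N=N and I=I and \<phi>="?\<phi>"])
    fix A assume A: "A \<subseteq> {1..n}"
    show "decomposes I ?\<phi> (\<lambda>s. vertex (N s) A) (vertex (upper_face (Suc n) G) A)"
      unfolding decomposes_def
    proof (intro conjI ballI impI subsetI)
      fix a assume "a \<in> vertex (upper_face (Suc n) G) A"
      then obtain s x v where a: "s \<in> I" "x \<in> pcarrier R V (shp A)" "v \<in> pcarrier R V (shp A)" "a = mor s x v"
        using low_vertex[OF A] A by (auto simp: upper_face_def upper_vertex elim!: morsE)
      then have "with_delta x v \<in> vertex (N s) A" using A by (auto simp: N_vertex pcarrier_ext)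
      with a \<phi>[OF a(2,3)] show "a \<in> (\<Union>s\<in>I. ?\<phi> s ` vertex (N s) A)"
        by (intro UN_I[of s] image_eqI[of _ _ "with_delta x v"]) simp_all
    next
      fix s s' z z' assume s: "s \<in> I" "s' \<in> I" and z: "z \<in> vertex (N s) A" "z' \<in> vertex (N s') A"
        and eq: "?\<phi> s z = ?\<phi> s' z'"
      obtain x v where x: "x \<in> pcarrier R V (shp A)" "v \<in> pcarrier R V (shp A)" "z = with_delta x v"
        using z(1) s A by (auto simp: N_vertex pcarrier_ext)
      obtain x' v' where x': "x' \<in> pcarrier R V (shp A)" "v' \<in> pcarrier R V (shp A)" "z' = with_delta x' v'"
        using z(2) s A by (auto simp: N_vertex pcarrier_ext)
      have "mor s x v = mor s' x' v'" using eq x x' \<phi> by simp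
      then show "s = s'" "z = z'" using s x x' by (auto simp: mor_inj)
    qed
  next
    fix A k assume A: "A \<subseteq> {1..n}" "k \<in> A"
    have Ak: "A - {k} \<subseteq> {1..n}" using A by auto
    note ty = low_typed[OF A, unfolded typed_edge_def]
    have upe: "edge (upper_face (Suc n) G) A k = edge G (insert (Suc n) A) k"
      by (simp add: upper_face_def)
    show "intertwines I ?\<phi> (\<lambda>s. vertex (N s) A) (\<lambda>s. vertex (N s) (A - {k}))
        (\<lambda>s. edge (N s) A k) (edge (upper_face (Suc n) G) A k)"
      unfolding intertwines_def upe
    proof (intro ballI conjI)
      fix s z assume s: "s \<in> I" and "z \<in> vertex (N s) A"
      then obtain x v where x: "x \<in> pcarrier R V (shp A)" "v \<in> pcarrier R V (shp A)" "z = with_delta x v"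
        using A by (auto simp: N_vertex pcarrier_ext)
      note simps = \<phi>[OF x(1,2)] ext[OF _ s x(1,2)] ext_edge_simps[OF upper_edge[OF A] s] x(3)
        N_edge[OF s A] interp_def map_gexprs_def
      show "gsrc (edge G (insert (Suc n) A) k) (?\<phi> s z) = ?\<phi> s (gsrc (edge (N s) A k) z)"
        "gtgt (edge G (insert (Suc n) A) k) (?\<phi> s z) = ?\<phi> s (gtgt (edge (N s) A k) z)"
        "ginv (edge G (insert (Suc n) A) k) (?\<phi> s z) = ?\<phi> s (ginv (edge (N s) A k) z)"
        using ty by (auto simp: simps)
    next
      fix s z assume s: "s \<in> I" and "z \<in> vertex (N s) (A - {k})"
      then obtain x v where x: "x \<in> pcarrier R V (shp (A - {k}))" "v \<in> pcarrier R V (shp (A - {k}))"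
          "z = with_delta x v"
        using Ak by (auto simp: N_vertex pcarrier_ext)
      show "gunit (edge G (insert (Suc n) A) k) (?\<phi> s z) = ?\<phi> s (gunit (edge (N s) A k) z)"
        using ty by (auto simp: \<phi>[OF x(1,2)] ext[OF _ s x(1,2)] ext_edge_simps[OF upper_edge[OF A] s] x(3)
            N_edge[OF s A] interp_def map_gexprs_def)
    next
      fix s y z assume s: "s \<in> I" and yz: "y \<in> vertex (N s) A" "z \<in> vertex (N s) A"
      obtain x v where x: "x \<in> pcarrier R V (shp A)" "v \<in> pcarrier R V (shp A)" "y = with_delta x v"
        using A s yz(1) by (auto simp: N_vertex pcarrier_ext)
      obtain x' v' where x': "x' \<in> pcarrier R V (shp A)" "v' \<in> pcarrier R V (shp A)" "z = with_delta x' v'"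
        using A s yz(2) by (auto simp: N_vertex pcarrier_ext)
      show "gmul (edge G (insert (Suc n) A) k) (?\<phi> s y) (?\<phi> s z) = ?\<phi> s (gmul (edge (N s) A k) y z)"
        using ty x x' ext[of "ShProd (shp A) (shp A)" "emul (fedge L A k)" "shp A" s "Tup x x'" "Tup v v'"] s
        by (auto simp: \<phi>[OF x(1,2)] \<phi>[OF x'(1,2)] ext_edge_simps[OF upper_edge[OF A] s]
            N_edge[OF s A] interp_def map_gexprs_def)
    qed
  qed (use N closed_upper_face[OF cl] in auto)
  then show ?thesis
    by (rule nfold_groupoid_Suc[OF nfold_groupoid_lower_face[OF low cl]])
       (use groupoid_new_edge double_groupoid_new_edge[OF cl] in auto)
qed


section \<open>The two constructions as first-order extensions\<close>

lemma map_expr_subst: "map_expr h (subst e x) = subst (map_expr h e) (map_expr h x)"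
  by (induction e) auto

lemma map_expr_dquot:
  "map_expr h (dquot e x v t) = dquot (map_expr h e) (map_expr h x) (map_expr h v) (map_expr h t)"
  by (induction e) (auto simp: map_expr_subst)

lemma typed_projections:
  "typed R (ShProd \<sigma> (ShProd \<sigma> ShK)) (Mid Var) \<sigma>"
  "typed R (ShProd \<sigma> (ShProd \<sigma> ShK)) (Last Var) ShK"
  "typed R (ShProd \<sigma> \<tau>) (Fst Var) \<sigma>" "typed R (ShProd \<sigma> \<tau>) (Snd Var) \<tau>"
  by (rule typed.intros)+

lemma typed_edge_base:
  assumes "cring R"
  shows "typed_edge R (ShProd \<sigma> (ShProd \<sigma> ShK)) (ShProd \<sigma> ShK) (base_exprs R \<sigma>)"
proof -
  interpret cring R by fact
  show ?thesis
    unfolding typed_edge_def base_exprs_def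
    by (auto intro!: typed.intros)
qed

lemma typed_edge_ext:
  assumes "typed_edge R \<sigma> \<tau> S"
  shows "typed_edge R (ShProd \<sigma> (ShProd \<sigma> ShK)) (ShProd \<tau> (ShProd \<tau> ShK)) (ext_exprs S)"
  using assms unfolding typed_edge_def ext_exprs_def Let_def ext_expr_def
  by (auto intro!: typed.intros intro: typed_subst typed_dquot typed_projections)

lemma typed_edge_times_id:
  assumes "typed_edge R \<sigma> \<tau> S"
  shows "typed_edge R (ShProd \<sigma> ShK) (ShProd \<tau> ShK) (times_id_exprs S)"
  using assms unfolding typed_edge_def times_id_exprs_def Let_def
  by (auto intro!: typed.intros intro: typed_subst typed_projections)

lemma typed_edge_at_base:
  assumes "cring R" and "t \<in> carrier R"
  shows "typed_edge R (ShProd \<sigma> \<sigma>) \<sigma> (at_base_exprs R t \<sigma>)"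
proof -
  interpret cring R by fact
  show ?thesis
    unfolding typed_edge_def at_base_exprs_def using assms(2)
    by (auto intro!: typed.intros)
qed

lemma typed_edge_at:
  assumes "typed_edge R \<sigma> \<tau> S" and "t \<in> carrier R"
  shows "typed_edge R (ShProd \<sigma> \<sigma>) (ShProd \<tau> \<tau>) (at_exprs t S)"
  using assms unfolding typed_edge_def at_exprs_def Let_def
  by (auto intro!: typed.intros intro: typed_subst typed_dquot typed_projections)

lemma subset_Suc_remove: "A \<subseteq> {1..Suc n} \<Longrightarrow> A - {Suc n} \<subseteq> {1..n}"
  by (auto simp: le_Suc_eq)

lemma subset_Suc_notin: "A \<subseteq> {1..Suc n} \<Longrightarrow> Suc n \<notin> A \<Longrightarrow> A \<subseteq> {1..n}"
  by (force simp: le_Suc_eq)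

lemma Diff_swap: "A - {x} - {y} = A - {y} - {x}"
  by auto

lemma fedge_formal_ext_typed:
  assumes "cring R" and "A \<subseteq> {1..n}" and "k \<in> A"
  shows "typed_edge R (ext_shape n A) (ext_shape n (A - {k})) (fedge (formal_ext R V T U n) A k)"
  using assms(2,3)
proof (induction n arbitrary: A)
  case (Suc n)
  show ?case
  proof (cases "k = Suc n")
    case True
    then show ?thesis using Suc.prems typed_edge_base[OF assms(1)] by (simp add: Let_def)
  next
    case k: False
    show ?thesis
    proof (cases "Suc n \<in> A")
      case True
      then show ?thesis
        using k Suc.prems Suc.IH[OF subset_Suc_remove]
        by (simp add: Let_def typed_edge_ext Diff_swap[of A k])
    next
      case False
      then show ?thesis
        using k Suc.prems Suc.IH[OF subset_Suc_notin]
        by (simp add: Let_def typed_edge_times_id)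
    qed
  qed
qed simp

lemma fedge_formal_at_typed:
  assumes "cring R" and "t \<in> {1..n} \<rightarrow> carrier R" and "A \<subseteq> {1..n}" and "k \<in> A"
  shows "typed_edge R (at_shape n A) (at_shape n (A - {k})) (fedge (formal_at R V U t n) A k)"
  using assms(2-4)
proof (induction n arbitrary: A)
  case (Suc n)
  have t: "t (Suc n) \<in> carrier R" "t \<in> {1..n} \<rightarrow> carrier R" using Suc.prems(1) by auto
  show ?case
  proof (cases "k = Suc n")
    case True
    then show ?thesis using Suc.prems typed_edge_at_base[OF assms(1) t(1)] by (simp add: Let_def)
  next
    case k: False
    show ?thesis
    proof (cases "Suc n \<in> A")
      case True
      then show ?thesis
        using k Suc.prems Suc.IH[OF t(2) subset_Suc_remove] t
        by (simp add: Let_def typed_edge_at Diff_swap[of A k])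
    next
      case False
      then show ?thesis
        using k Suc.prems Suc.IH[OF t(2) subset_Suc_notin]
        by (simp add: Let_def)
    qed
  qed
qed simp

lemma fvertex_formal_ext_subset:
  assumes "T \<subseteq> carrier R" and "U \<subseteq> carrier V"
  shows "fvertex (formal_ext R V T U n) A \<subseteq> pcarrier R V (ext_shape n A)"
proof (induction n arbitrary: A)
  case 0
  then show ?case using assms by (auto simp: formal_base_def)
next
  case (Suc n)
  show ?case
    using assms(1) by (auto simp: Let_def ext_dom_def intro!: imageI intro: subsetD[OF Suc.IH])
qed

lemma fvertex_formal_at_subset:
  assumes "U \<subseteq> carrier V"
  shows "fvertex (formal_at R V U t n) A \<subseteq> pcarrier R V (at_shape n A)"
proof (induction n arbitrary: A)
  case 0
  then show ?case using assms by (auto simp: formal_base_def)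
next
  case (Suc n)
  show ?case by (auto simp: Let_def at_dom_def intro: subsetD[OF Suc.IH])
qed

lemma fvertex_formal_ext_carrier:
  assumes "module R V"
  shows "fvertex (formal_ext R V (carrier R) (carrier V) n) A = pcarrier R V (ext_shape n A)"
proof (induction n arbitrary: A)
  case 0
  then show ?case by (simp add: formal_base_def)
next
  case (Suc n)
  show ?case
    by (auto simp: Let_def ext_dom_def Suc padd_closed[OF assms] psmult_closed[OF assms])
qed

lemma fvertex_formal_at_carrier:
  assumes "module R V" and "t \<in> {1..n} \<rightarrow> carrier R"
  shows "fvertex (formal_at R V (carrier V) t n) A = pcarrier R V (at_shape n A)"
  using assms(2)
proof (induction n arbitrary: A)
  case 0
  then show ?case by (simp add: formal_base_def)
next
  case (Suc n)
  have "t (Suc n) \<in> carrier R" "t \<in> {1..n} \<rightarrow> carrier R" using Suc.prems by auto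
  then show ?case
    by (auto simp: Let_def at_dom_def Suc.IH padd_closed[OF assms(1)] psmult_closed[OF assms(1)])
qed

text \<open>The formal structure maps contain no scalars besides zero, \<open>-1\<close> and, for fixed \<open>t\<close>, the
  parameters. So they are the same over all rings up to the translation of these constants, which is
  all that is required of \<open>h\<close>. With the identity for \<open>h\<close> this shows that they do not depend on
  the module either.\<close>

lemma map_gexprs_base:
  assumes "h (\<ominus>\<^bsub>R\<^esub> \<one>\<^bsub>R\<^esub>) = \<ominus>\<^bsub>R'\<^esub> \<one>\<^bsub>R'\<^esub>"
  shows "map_gexprs h (base_exprs R \<sigma>) = base_exprs R' \<sigma>"
    and "map_gexprs h (at_base_exprs R t \<sigma>) = at_base_exprs R' (h t) \<sigma>"
  using assms by (simp_all add: map_gexprs_def base_exprs_def at_base_exprs_def)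

lemma map_gexprs_ext:
  "map_gexprs h (ext_exprs S) = ext_exprs (map_gexprs h S)"
  "map_gexprs h (times_id_exprs S) = times_id_exprs (map_gexprs h S)"
  "map_gexprs h (at_exprs t S) = at_exprs (h t) (map_gexprs h S)"
  by (simp_all add: map_gexprs_def ext_exprs_def ext_expr_def times_id_exprs_def at_exprs_def Let_def
      map_expr_subst map_expr_dquot)

lemma fedge_formal_ext_map:
  assumes "h (\<ominus>\<^bsub>R\<^esub> \<one>\<^bsub>R\<^esub>) = \<ominus>\<^bsub>R'\<^esub> \<one>\<^bsub>R'\<^esub>" and "A \<subseteq> {1..n}" and "k \<in> A"
  shows "fedge (formal_ext R' V' T' U' n) A k = map_gexprs h (fedge (formal_ext R V T U n) A k)"
  using assms(2,3)
proof (induction n arbitrary: A)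
  case (Suc n)
  show ?case
    using Suc.prems Suc.IH[OF subset_Suc_remove] Suc.IH[OF subset_Suc_notin]
    by (auto simp: Let_def map_gexprs_base[where h=h, OF assms(1)] map_gexprs_ext)
qed simp

lemma fedge_formal_at_map:
  assumes "h (\<ominus>\<^bsub>R\<^esub> \<one>\<^bsub>R\<^esub>) = \<ominus>\<^bsub>R'\<^esub> \<one>\<^bsub>R'\<^esub>" and "A \<subseteq> {1..n}" and "k \<in> A"
  shows "fedge (formal_at R' V' U' (h \<circ> t) n) A k = map_gexprs h (fedge (formal_at R V U t n) A k)"
  using assms(2,3)
proof (induction n arbitrary: A)
  case (Suc n)
  show ?case
    using Suc.prems Suc.IH[OF subset_Suc_remove] Suc.IH[OF subset_Suc_notin]
    by (auto simp: Let_def map_gexprs_base[where h=h, OF assms(1)] map_gexprs_ext)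
qed simp

lemma map_gexprs_id: "map_gexprs (\<lambda>c. c) S = S"
  by (simp add: map_gexprs_def expr.map_ident)

abbreviation (input) mor_var :: "'k \<Rightarrow> ('k, 'v) pt \<Rightarrow> ('k, 'v) pt \<Rightarrow> ('k, 'v) pt" where
  "mor_var \<equiv> \<lambda>s x v. Tup x (Tup v (Scal s))"

abbreviation (input) ob_var :: "'k \<Rightarrow> ('k, 'v) pt \<Rightarrow> ('k, 'v) pt" where
  "ob_var \<equiv> \<lambda>s x. Tup x (Scal s)"

lemma first_order_extension_var:
  assumes "module R V" and "T \<subseteq> carrier R" and "U \<subseteq> carrier V"
  shows "first_order_extension R V T mor_var ob_var n (ext_shape n) (formal_ext R V T U n)
    (realize R V (formal_ext R V T U (Suc n)))"
proof -
  interpret first_order R V T mor_var ob_var by (rule first_order.intro) (use assms in auto)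
  have cr: "cring R" using assms(1) by (simp add: module_def)
  show ?thesis
  proof unfold_locales
    fix A assume A: "A \<subseteq> {1..n}"
    then have nA: "Suc n \<notin> A" by auto
    then have [simp]: "insert (Suc n) A - {Suc n} = A" by auto
    show "fvertex (formal_ext R V T U n) A \<subseteq> pcarrier R V (ext_shape n A)"
      by (rule fvertex_formal_ext_subset[OF assms(2,3)])
    show "vertex (realize R V (formal_ext R V T U (Suc n))) (insert (Suc n) A) =
        mors (ext_shape n A) (fvertex (formal_ext R V T U n) A)"
      by (auto simp: realize_def Let_def ext_dom_def mors_def)
    show "vertex (realize R V (formal_ext R V T U (Suc n))) A = obs (fvertex (formal_ext R V T U n) A)"
      using nA by (auto simp: realize_def Let_def obs_def)
    show "is_first_order_edge (ext_shape n A)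
        (edge (realize R V (formal_ext R V T U (Suc n))) (insert (Suc n) A) (Suc n))"
      by (simp add: is_first_order_edge_def realize_def Let_def interp_def base_exprs_def)
    fix k assume k: "k \<in> A"
    then have "k \<noteq> Suc n" using nA by auto
    show "typed_edge R (ext_shape n A) (ext_shape n (A - {k})) (fedge (formal_ext R V T U n) A k)"
      by (rule fedge_formal_ext_typed[OF cr A k])
    show "is_ext_edge (fedge (formal_ext R V T U n) A k)
        (edge (realize R V (formal_ext R V T U (Suc n))) (insert (Suc n) A) k)"
      using \<open>k \<noteq> Suc n\<close> by (simp add: is_ext_edge_def realize_def Let_def interp_def ext_exprs_def
        ext_expr_def eval_subst eval_dquot)
    show "is_copy_edge (fedge (formal_ext R V T U n) A k)
        (edge (realize R V (formal_ext R V T U (Suc n))) A k)"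
      using \<open>k \<noteq> Suc n\<close> nA by (simp add: is_copy_edge_def realize_def Let_def interp_def
        times_id_exprs_def eval_subst)
  qed
qed

lemma first_order_extension_at:
  assumes "module R V" and "t \<in> {1..Suc n} \<rightarrow> carrier R" and "U \<subseteq> carrier V"
  shows "first_order_extension R V {t (Suc n)} (\<lambda>_. Tup) (\<lambda>_ x. x) n (at_shape n) (formal_at R V U t n)
    (realize R V (formal_at R V U t (Suc n)))"
proof -
  have t: "t (Suc n) \<in> carrier R" "t \<in> {1..n} \<rightarrow> carrier R" using assms(2) by auto
  interpret first_order R V "{t (Suc n)}" "\<lambda>_. Tup" "\<lambda>_ x. x" by (rule first_order.intro) (use assms t in auto)
  have cr: "cring R" using assms(1) by (simp add: module_def)
  show ?thesis
  proof unfold_locales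
    fix A assume A: "A \<subseteq> {1..n}"
    then have nA: "Suc n \<notin> A" by auto
    then have [simp]: "insert (Suc n) A - {Suc n} = A" by auto
    show "fvertex (formal_at R V U t n) A \<subseteq> pcarrier R V (at_shape n A)"
      by (rule fvertex_formal_at_subset[OF assms(3)])
    show "vertex (realize R V (formal_at R V U t (Suc n))) (insert (Suc n) A) =
        mors (at_shape n A) (fvertex (formal_at R V U t n) A)"
      by (auto simp: realize_def Let_def at_dom_def mors_def)
    show "vertex (realize R V (formal_at R V U t (Suc n))) A = obs (fvertex (formal_at R V U t n) A)"
      using nA by (auto simp: realize_def Let_def obs_def)
    show "is_first_order_edge (at_shape n A)
        (edge (realize R V (formal_at R V U t (Suc n))) (insert (Suc n) A) (Suc n))"
      by (simp add: is_first_order_edge_def realize_def Let_def interp_def at_base_exprs_def)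
    fix k assume k: "k \<in> A"
    then have "k \<noteq> Suc n" using nA by auto
    show "typed_edge R (at_shape n A) (at_shape n (A - {k})) (fedge (formal_at R V U t n) A k)"
      by (rule fedge_formal_at_typed[OF cr t(2) A k])
    show "is_ext_edge (fedge (formal_at R V U t n) A k)
        (edge (realize R V (formal_at R V U t (Suc n))) (insert (Suc n) A) k)"
      using \<open>k \<noteq> Suc n\<close> by (simp add: is_ext_edge_def realize_def Let_def interp_def at_exprs_def
        eval_subst eval_dquot)
    show "is_copy_edge (fedge (formal_at R V U t n) A k)
        (edge (realize R V (formal_at R V U t (Suc n))) A k)"
      using \<open>k \<noteq> Suc n\<close> nA by (simp add: is_copy_edge_def realize_def Let_def interp_def)
  qed
qed

lemma closed_nfold_0: "closed_nfold 0 G" and nfold_groupoid_0: "nfold_groupoid 0 G"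
  by (auto simp: closed_nfold_def nfold_groupoid_def)

lemma closed_formal_ext:
  assumes "module R V" and "T \<subseteq> carrier R" and "U \<subseteq> carrier V"
  shows "closed_nfold n (realize R V (formal_ext R V T U n))"
  by (induction n)
     (auto intro: closed_nfold_0 first_order_extension.closed_nfold_Suc[OF first_order_extension_var[OF assms]]
       simp del: formal_ext.simps)

lemma closed_formal_at:
  assumes "module R V" and "t \<in> {1..n} \<rightarrow> carrier R" and "U \<subseteq> carrier V"
  shows "closed_nfold n (realize R V (formal_at R V U t n))"
  using assms(2)
proof (induction n)
  case (Suc n)
  then have "t \<in> {1..n} \<rightarrow> carrier R" by auto
  then show ?case
    by (rule first_order_extension.closed_nfold_Suc[OF
          first_order_extension_at[OF assms(1) Suc.prems assms(3)] Suc.IH])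
qed (rule closed_nfold_0)

lemma const_ext_minus_one:
  assumes "cring R" and "s \<in> carrier R"
  shows "const_ext R (\<ominus>\<^bsub>R\<^esub> \<one>\<^bsub>R\<^esub>) = \<ominus>\<^bsub>ext_ring R s\<^esub> \<one>\<^bsub>ext_ring R s\<^esub>"
proof -
  interpret cring R by fact
  interpret E: cring "ext_ring R s" by (rule cring_ext_ring[OF assms])
  show ?thesis
    by (rule E.minus_equality[symmetric]) (auto simp: const_ext_def ext_ring_def l_neg)
qed

lemma ground_minus_one:
  assumes "cring R"
  shows "Ground (\<ominus>\<^bsub>R\<^esub> \<one>\<^bsub>R\<^esub>) = \<ominus>\<^bsub>ground_ring R\<^esub> \<one>\<^bsub>ground_ring R\<^esub>"
proof -
  interpret cring R by fact
  interpret E: cring "ground_ring R" by (rule cring_ground_ring[OF assms])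
  show ?thesis
    by (rule E.minus_equality[symmetric]) (auto simp: ground_ring_def l_neg)
qed


section \<open>Induction over all rings\<close>

text \<open>The ring and the module vary in the induction: the hypothesis for \<open>n\<close> is applied to the rings
  \<open>R[\<delta>] / (\<delta>\<^sup>2 - s \<delta>)\<close>.\<close>

lemma nfold_groupoid_full_tower:
  fixes R :: "'k tower ring" and V :: "('k tower, 'v tower) module"
  assumes "module R V"
  shows "nfold_groupoid n (realize R V (formal_ext R V (carrier R) (carrier V) n))"
  using assms
proof (induction n arbitrary: R V)
  case 0
  show ?case by (rule nfold_groupoid_0)
next
  case (Suc n)
  have cr: "cring R" using Suc.prems by (simp add: module_def)
  let ?N = "\<lambda>s. realize (ext_ring R s) (ext_module V s) (formal_ext (ext_ring R s) (ext_module V s)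
    (carrier (ext_ring R s)) (carrier (ext_module V s)) n)"
  show ?case
  proof (rule nfold_groupoid_first_order_extension[OF first_order_extension_var[OF Suc.prems order_refl order_refl],
        where N="?N"])
    fix s assume "s \<in> carrier R"
    note m = module_ext_module[OF Suc.prems this] and c = const_ext_minus_one[OF cr this]
    show "nfold_groupoid n (?N s)" by (rule Suc.IH[OF m])
    fix A assume "A \<subseteq> {1..n}"
    then show "vertex (?N s) A = pcarrier (ext_ring R s) (ext_module V s) (ext_shape n A)"
      by (simp add: realize_def fvertex_formal_ext_carrier[OF m])
    fix k assume "k \<in> A"
    with \<open>A \<subseteq> {1..n}\<close> show "edge (?N s) A k = interp (ext_ring R s) (ext_module V s)
        (map_gexprs (const_ext R) (fedge (formal_ext R V (carrier R) (carrier V) n) A k))"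
      by (simp add: realize_def fedge_formal_ext_map[where h="const_ext R" and R=R and V=V and T="carrier R" and U="carrier V", OF c])
  qed (rule Suc.IH[OF Suc.prems] closed_formal_ext[OF Suc.prems order_refl order_refl])+
qed

lemma nfold_groupoid_at_tower:
  fixes R :: "'k tower ring" and V :: "('k tower, 'v tower) module"
  assumes "module R V" and "t \<in> {1..n} \<rightarrow> carrier R"
  shows "nfold_groupoid n (realize R V (formal_at R V (carrier V) t n))"
  using assms
proof (induction n arbitrary: R V t)
  case 0
  show ?case by (rule nfold_groupoid_0)
next
  case (Suc n)
  have cr: "cring R" using Suc.prems by (simp add: module_def)
  have t: "t (Suc n) \<in> carrier R" "t \<in> {1..n} \<rightarrow> carrier R" using Suc.prems(2) by auto
  let ?N = "\<lambda>s. realize (ext_ring R s) (ext_module V s) (formal_at (ext_ring R s) (ext_module V s)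
    (carrier (ext_module V s)) (const_ext R \<circ> t) n)"
  show ?case
  proof (rule nfold_groupoid_first_order_extension[OF first_order_extension_at[OF Suc.prems order_refl],
        where N="?N"])
    fix s assume "s \<in> {t (Suc n)}"
    then have s: "s \<in> carrier R" using t by simp
    note m = module_ext_module[OF Suc.prems(1) s] and c = const_ext_minus_one[OF cr s]
    have t': "const_ext R \<circ> t \<in> {1..n} \<rightarrow> carrier (ext_ring R s)"
      using t(2) cring.cring_simprules(2)[OF cr] by (auto simp: const_ext_def ext_ring_def)
    show "nfold_groupoid n (?N s)" by (rule Suc.IH[OF m t'])
    fix A assume "A \<subseteq> {1..n}"
    then show "vertex (?N s) A = pcarrier (ext_ring R s) (ext_module V s) (at_shape n A)"
      by (simp add: realize_def fvertex_formal_at_carrier[OF m t'])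
    fix k assume "k \<in> A"
    with \<open>A \<subseteq> {1..n}\<close> show "edge (?N s) A k = interp (ext_ring R s) (ext_module V s)
        (map_gexprs (const_ext R) (fedge (formal_at R V (carrier V) t n) A k))"
      by (simp add: realize_def fedge_formal_at_map[where h="const_ext R" and R=R and V=V and U="carrier V", OF c])
  qed (rule Suc.IH[OF Suc.prems(1) t(2)] closed_formal_at[OF Suc.prems(1) t(2) order_refl])+
qed

text \<open>Return to an arbitrary type of scalars, and at the same time to subsets: \<open>N\<close> lives on the whole
  modules, and the vertex sets of \<open>L\<close> only have to be closed under the structure maps.\<close>

lemma nfold_groupoid_from_ground:
  assumes mod: "module R V"
    and vert: "\<And>A. A \<subseteq> {1..n} \<Longrightarrow> fvertex L A \<subseteq> pcarrier R V (shp A)"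
    and wt: "\<And>A k. A \<subseteq> {1..n} \<Longrightarrow> k \<in> A \<Longrightarrow> typed_edge R (shp A) (shp (A - {k})) (fedge L A k)"
    and cl: "closed_nfold n (realize R V L)"
    and N: "nfold_groupoid n N"
    and N_vertex: "\<And>A. A \<subseteq> {1..n} \<Longrightarrow> vertex N A = pcarrier (ground_ring R) (ground_module V) (shp A)"
    and N_edge: "\<And>A k. A \<subseteq> {1..n} \<Longrightarrow> k \<in> A \<Longrightarrow>
      edge N A k = interp (ground_ring R) (ground_module V) (map_gexprs Ground (fedge L A k))"
  shows "nfold_groupoid n (realize R V L)"
proof -
  let ?\<phi> = "map_pt the_ground the_ground"
  have \<phi>: "?\<phi> (map_pt Ground Ground x) = x" for x by (simp add: pt.map_comp o_def pt.map_ident)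
  have ext: "?\<phi> (eval (ground_ring R) (ground_module V) (map_expr Ground e) (map_pt Ground Ground x)) =
      eval R V e x"
    if "typed R \<sigma> e \<tau>" "x \<in> pcarrier R V \<sigma>" for \<sigma> e \<tau> x
    using eval_ground[OF mod that] \<phi> by simp
  show ?thesis
  proof (rule nfold_groupoid_decomposes[where N="\<lambda>_. N" and I="{()}" and \<phi>="\<lambda>_. ?\<phi>"])
    fix A assume A: "A \<subseteq> {1..n}"
    show "decomposes {()} (\<lambda>_. ?\<phi>) (\<lambda>_. vertex N A) (vertex (realize R V L) A)"
      unfolding decomposes_def N_vertex[OF A] pcarrier_ground
      using vert[OF A] by (force simp: realize_def \<phi> image_image)
  next
    fix A k assume A: "A \<subseteq> {1..n}" "k \<in> A"
    have Ak: "A - {k} \<subseteq> {1..n}" using A by auto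
    show "intertwines {()} (\<lambda>_. ?\<phi>) (\<lambda>_. vertex N A) (\<lambda>_. vertex N (A - {k}))
        (\<lambda>_. edge N A k) (edge (realize R V L) A k)"
      unfolding intertwines_def N_vertex[OF A(1)] N_vertex[OF Ak] pcarrier_ground N_edge[OF A]
      using wt[OF A] ext[of "ShProd (shp A) (shp A)" "emul (fedge L A k)" "shp A" "Tup x y" for x y]
      by (auto simp: realize_def interp_def map_gexprs_def \<phi> typed_edge_def ext)
  qed (use N cl in auto)
qed

lemma nfold_groupoid_formal_ext:
  assumes "module R V" and "T \<subseteq> carrier R" and "U \<subseteq> carrier V"
  shows "nfold_groupoid n (realize R V (formal_ext R V T U n))"
proof -
  have cr: "cring R" using assms(1) by (simp add: module_def)
  note m = module_ground_module[OF assms(1)]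
  show ?thesis
    by (rule nfold_groupoid_from_ground[OF assms(1) fvertex_formal_ext_subset[OF assms(2,3)]
          fedge_formal_ext_typed[OF cr] closed_formal_ext[OF assms] nfold_groupoid_full_tower[OF m]])
       (auto simp: realize_def fvertex_formal_ext_carrier[OF m] fedge_formal_ext_map[where h=Ground and R=R and V=V and T=T and U=U, OF ground_minus_one[OF cr]])
qed

lemma nfold_groupoid_formal_at:
  assumes "module R V" and "t \<in> {1..n} \<rightarrow> carrier R" and "U \<subseteq> carrier V"
  shows "nfold_groupoid n (realize R V (formal_at R V U t n))"
proof -
  have cr: "cring R" using assms(1) by (simp add: module_def)
  note m = module_ground_module[OF assms(1)]
  have t: "Ground \<circ> t \<in> {1..n} \<rightarrow> carrier (ground_ring R)"
    using assms(2) by (auto simp: ground_ring_def)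
  show ?thesis
    by (rule nfold_groupoid_from_ground[OF assms(1) fvertex_formal_at_subset[OF assms(3)]
          fedge_formal_at_typed[OF cr assms(2)] closed_formal_at[OF assms] nfold_groupoid_at_tower[OF m t]])
       (auto simp: realize_def fvertex_formal_at_carrier[OF m t] fedge_formal_at_map[where h=Ground and R=R and V=V and U=U, OF ground_minus_one[OF cr]])
qed

lemma iter_shape_eq: "iter_shape n = ext_shape n {1..n}"
proof (induction n)
  case (Suc n)
  have "{1..Suc n} - {Suc n} = {1..n}" by auto
  then show ?case using Suc by (simp add: Let_def)
qed simp

lemma fvertex_top: "fvertex (formal_ext R V (carrier R) U n) {1..n} = iter_dom R V U n"
proof (induction n)
  case 0
  then show ?case by (simp add: formal_base_def)
next
  case (Suc n)
  have "{1..Suc n} - {Suc n} = {1..n}" by auto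
  then show ?case using Suc iter_shape_eq[of n] by (simp add: Let_def)
qed


section \<open>Morphisms\<close>

lemma (in module) scaled_difference:
  assumes s: "s \<in> Units R" and a: "a \<in> carrier M"
  shows "w \<in> carrier M \<Longrightarrow> inv\<^bsub>R\<^esub> s \<odot>\<^bsub>M\<^esub> ((a \<oplus>\<^bsub>M\<^esub> s \<odot>\<^bsub>M\<^esub> w) \<ominus>\<^bsub>M\<^esub> a) = w"
    and "b \<in> carrier M \<Longrightarrow> inv\<^bsub>R\<^esub> s \<odot>\<^bsub>M\<^esub> (b \<ominus>\<^bsub>M\<^esub> a) \<in> carrier M"
    and "b \<in> carrier M \<Longrightarrow> a \<oplus>\<^bsub>M\<^esub> s \<odot>\<^bsub>M\<^esub> (inv\<^bsub>R\<^esub> s \<odot>\<^bsub>M\<^esub> (b \<ominus>\<^bsub>M\<^esub> a)) = b"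
proof -
  have c: "s \<in> carrier R" "inv\<^bsub>R\<^esub> s \<in> carrier R"
    using s by (simp_all add: R.Units_closed R.Units_inv_closed)
  have i: "inv\<^bsub>R\<^esub> s \<odot>\<^bsub>M\<^esub> (s \<odot>\<^bsub>M\<^esub> w) = w" "s \<odot>\<^bsub>M\<^esub> (inv\<^bsub>R\<^esub> s \<odot>\<^bsub>M\<^esub> w) = w" if "w \<in> carrier M" for w
    using that c s by (simp_all add: smult_assoc1[symmetric] R.Units_l_inv R.Units_r_inv smult_one)
  show "inv\<^bsub>R\<^esub> s \<odot>\<^bsub>M\<^esub> ((a \<oplus>\<^bsub>M\<^esub> s \<odot>\<^bsub>M\<^esub> w) \<ominus>\<^bsub>M\<^esub> a) = w" if w: "w \<in> carrier M"
  proof -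
    have z: "s \<odot>\<^bsub>M\<^esub> w \<in> carrier M" using c w by simp
    have "(a \<oplus>\<^bsub>M\<^esub> s \<odot>\<^bsub>M\<^esub> w) \<ominus>\<^bsub>M\<^esub> a = s \<odot>\<^bsub>M\<^esub> w"
      using a z by (simp add: a_minus_def M.a_comm[of a] M.a_assoc M.r_neg)
    then show ?thesis using i w by simp
  qed
  show "inv\<^bsub>R\<^esub> s \<odot>\<^bsub>M\<^esub> (b \<ominus>\<^bsub>M\<^esub> a) \<in> carrier M" if "b \<in> carrier M"
    using that a c by simp
  show "a \<oplus>\<^bsub>M\<^esub> s \<odot>\<^bsub>M\<^esub> (inv\<^bsub>R\<^esub> s \<odot>\<^bsub>M\<^esub> (b \<ominus>\<^bsub>M\<^esub> a)) = b" if b: "b \<in> carrier M"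
  proof -
    have "a \<oplus>\<^bsub>M\<^esub> (b \<ominus>\<^bsub>M\<^esub> a) = b"
      using a b by (simp add: a_minus_def M.a_comm[of b] M.a_assoc[symmetric] M.r_neg)
    then show ?thesis using i a b by simp
  qed
qed

text \<open>Over an invertible \<open>s\<close> a tangent vector is determined by its two end points. Together with
  \<open>diff_quot_step\<close> this characterizes the difference quotient without inverses.\<close>

lemma diff_quot_eq:
  assumes mod: "module R V'" and s: "s \<in> Units R"
    and a: "g x \<in> pcarrier R V' \<tau>" and w: "w \<in> pcarrier R V' \<tau>"
    and b: "g (padd R V x (psmult R V s v)) = padd R V' (g x) (psmult R V' s w)"
  shows "diff_quot R (pmod R V \<sigma>) (pmod R V' \<tau>) g x v s = w"
  using module.scaled_difference(1)[OF module_pmod[OF mod, of \<tau>] s, of "g x" w] a w b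
  by (simp add: diff_quot_def)

lemma diff_quot_step:
  assumes mod: "module R V'" and s: "s \<in> Units R"
    and a: "g x \<in> pcarrier R V' \<tau>" and b: "g (padd R V x (psmult R V s v)) \<in> pcarrier R V' \<tau>"
  shows "diff_quot R (pmod R V \<sigma>) (pmod R V' \<tau>) g x v s \<in> pcarrier R V' \<tau>"
    and "padd R V' (g x) (psmult R V' s (diff_quot R (pmod R V \<sigma>) (pmod R V' \<tau>) g x v s)) =
      g (padd R V x (psmult R V s v))"
  using module.scaled_difference(2,3)[OF module_pmod[OF mod, of \<tau>] s, of "g x"] a b
  by (simp_all add: diff_quot_def)

text \<open>All equations are checked at the two end points of the tangent vectors. There they are the
  corresponding equations for \<open>F\<close>, because a structure map \<open>e\<close> satisfies
  \<open>eval_increment\<close>.\<close>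

lemma nfold_morphism_Suc:
  assumes "first_order_extension R V I mor ob n shp L G"
    and "first_order_extension R V' I mor' ob' n shp L' G'"
    and edges: "\<And>A k. A \<subseteq> {1..n} \<Longrightarrow> k \<in> A \<Longrightarrow> fedge L' A k = fedge L A k"
    and units: "I \<subseteq> Units R"
    and cl: "closed_nfold n (realize R V L)"
    and F: "nfold_morphism n (realize R V L) (realize R V' L') F"
    and upper: "\<And>A s x v. A \<subseteq> {1..n} \<Longrightarrow> s \<in> I \<Longrightarrow> H (insert (Suc n) A) (mor s x v) =
      mor' s (F A x) (diff_quot R (pmod R V (shp A)) (pmod R V' (shp A)) (F A) x v s)"
    and lower: "\<And>A s x. A \<subseteq> {1..n} \<Longrightarrow> s \<in> I \<Longrightarrow> H A (ob s x) = ob' s (F A x)"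
  shows "nfold_morphism (Suc n) G G' H"
proof -
  interpret A: first_order_extension R V I mor ob n shp L G by fact
  interpret B: first_order_extension R V' I mor' ob' n shp L' G' by fact
  let ?Y = "fvertex L" and ?Y' = "fvertex L'"
  \<comment> \<open>the new component of the extended map, characterized below by \<open>D\<close> and \<open>D_eq\<close>\<close>
  define D where "D A s x v = diff_quot R (pmod R V (shp A)) (pmod R V' (shp A)) (F A) x v s" for A s x v
  note upper = upper[folded D_def]
  have FY: "F A x \<in> ?Y' A" if "A \<subseteq> {1..n}" "x \<in> ?Y A" for A x
    using F that by (auto simp: nfold_morphism_def realize_def)
  have FE: "F A x \<in> pcarrier R V' (shp A)" if "A \<subseteq> {1..n}" "x \<in> ?Y A" for A x
    using FY[OF that] B.low_vertex[OF that(1)] by auto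
  have unit: "s \<in> Units R" if "s \<in> I" for s using that units by auto
  have D: "D A s x v \<in> pcarrier R V' (shp A)"
    "B.shift s (F A x) (D A s x v) = F A (A.shift s x v)"
    if "A \<subseteq> {1..n}" "s \<in> I" "x \<in> ?Y A" "A.shift s x v \<in> ?Y A" for A s x v
    unfolding D_def
    by (rule diff_quot_step[OF B.mod unit[OF that(2)] FE[OF that(1,3)] FE[OF that(1,4)]])+
  have D_eq: "D A s x v = w"
    if "A \<subseteq> {1..n}" "s \<in> I" "x \<in> ?Y A" "w \<in> pcarrier R V' (shp A)"
      "F A (A.shift s x v) = B.shift s (F A x) w" for A s x v w
    unfolding D_def by (rule diff_quot_eq[OF B.mod unit[OF that(2)] FE[OF that(1,3)] that(4,5)])
  have H_mors: "H (insert (Suc n) A) a \<in> B.mors (shp A) (?Y' A)"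
    if "A \<subseteq> {1..n}" "a \<in> A.mors (shp A) (?Y A)" for A a
    using that(2) by (rule A.morsE) (use that(1) D FY in \<open>auto simp: upper intro!: B.morsI\<close>)
  have H_obs: "H A a \<in> B.obs (?Y' A)" if "A \<subseteq> {1..n}" "a \<in> A.obs (?Y A)" for A a
    using that(2) by (rule A.obsE) (use that(1) FY in \<open>auto simp: lower intro!: B.obsI\<close>)
  have new: "groupoid_functor (A.mors (shp A) (?Y A)) (A.obs (?Y A)) (edge G (insert (Suc n) A) (Suc n))
      (B.mors (shp A) (?Y' A)) (B.obs (?Y' A)) (edge G' (insert (Suc n) A) (Suc n))
      (H (insert (Suc n) A)) (H A)" if A: "A \<subseteq> {1..n}" for A
    unfolding groupoid_functor_def
  proof (intro conjI ballI allI impI funcsetI H_mors[OF A] H_obs[OF A])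
    note simps = A.first_order_edge_simps[OF A.new_edge[OF A]] B.first_order_edge_simps[OF B.new_edge[OF A]]
      upper[OF A] lower[OF A]
    {
      fix a assume "a \<in> A.mors (shp A) (?Y A)"
      then obtain s x v where "s \<in> I" "x \<in> ?Y A" "A.shift s x v \<in> ?Y A" "a = mor s x v"
        by (rule A.morsE)
      then show "gsrc (edge G' (insert (Suc n) A) (Suc n)) (H (insert (Suc n) A) a) =
          H A (gsrc (edge G (insert (Suc n) A) (Suc n)) a)"
        "gtgt (edge G' (insert (Suc n) A) (Suc n)) (H (insert (Suc n) A) a) =
          H A (gtgt (edge G (insert (Suc n) A) (Suc n)) a)"
        using D[OF A] by (simp_all add: simps)
    }
    {
      fix a assume "a \<in> A.obs (?Y A)"
      then obtain s x where a: "s \<in> I" "x \<in> ?Y A" "a = ob s x" by (rule A.obsE)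
      have "D A s x (pzero R V (shp A)) = pzero R V' (shp A)"
        by (rule D_eq[OF A a(1,2) pzero_closed[OF B.mod]])
           (simp add: padd_psmult_zero[OF A.mod A.params_carrier[OF a(1)] subsetD[OF A.low_vertex[OF A] a(2)]]
              padd_psmult_zero[OF B.mod A.params_carrier[OF a(1)] FE[OF A a(2)]])
      then show "H (insert (Suc n) A) (gunit (edge G (insert (Suc n) A) (Suc n)) a) =
          gunit (edge G' (insert (Suc n) A) (Suc n)) (H A a)"
        using a by (simp add: simps)
    }
    {
      fix a b assume "composable (A.mors (shp A) (?Y A)) (edge G (insert (Suc n) A) (Suc n)) a b"
      from A.composable_first_orderE[OF A.new_edge[OF A] this] obtain s x v w where
        a: "s \<in> I" "x \<in> ?Y A" "v \<in> pcarrier R V (shp A)" "w \<in> pcarrier R V (shp A)"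
          "A.shift s x v \<in> ?Y A" "A.shift s (A.shift s x v) w \<in> ?Y A"
          "a = mor s (A.shift s x v) w" "b = mor s x v" by metis
      note d1 = D[OF A a(1,2,5)] and d2 = D[OF A a(1,5,6)]
      have "D A s x (padd R V w v) = padd R V' (D A s (A.shift s x v) w) (D A s x v)"
        by (rule D_eq[OF A a(1,2) padd_closed[OF B.mod d2(1) d1(1)]])
           (simp add: padd_step[OF A.mod A.params_carrier[OF a(1)] subsetD[OF A.low_vertex[OF A] a(2)] a(3,4)]
              padd_step[OF B.mod A.params_carrier[OF a(1)] FE[OF A a(2)] d1(1) d2(1)] d1 d2)
      then show "H (insert (Suc n) A) (gmul (edge G (insert (Suc n) A) (Suc n)) a b) =
          gmul (edge G' (insert (Suc n) A) (Suc n)) (H (insert (Suc n) A) a) (H (insert (Suc n) A) b)"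
        using a by (simp add: simps)
    }
  qed
  have F_edge: "groupoid_functor (?Y A) (?Y (A - {k})) (interp R V (fedge L A k))
      (?Y' A) (?Y' (A - {k})) (interp R V' (fedge L A k)) (F A) (F (A - {k}))"
    if "A \<subseteq> {1..n}" "k \<in> A" for A k
    using F that edges[OF that] unfolding nfold_morphism_def realize_def by (metis nfold.simps(1,2))
  have low: "eval R V' (esrc (fedge L A k)) (F A x) = F (A - {k}) (eval R V (esrc (fedge L A k)) x)"
      "eval R V' (etgt (fedge L A k)) (F A x) = F (A - {k}) (eval R V (etgt (fedge L A k)) x)"
      "eval R V (esrc (fedge L A k)) x \<in> ?Y (A - {k})" "eval R V (etgt (fedge L A k)) x \<in> ?Y (A - {k})"
    if "A \<subseteq> {1..n}" "k \<in> A" "x \<in> ?Y A" for A k x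
    using F_edge[OF that(1,2)] A.closed_low_edge[OF cl that(1,2)] that(3)
    by (simp_all add: groupoid_functor_def interp_def closed_edge_def)
  have low_unit: "F A (eval R V (eunit (fedge L A k)) x) = eval R V' (eunit (fedge L A k)) (F (A - {k}) x)"
      "eval R V (eunit (fedge L A k)) x \<in> ?Y A"
    if "A \<subseteq> {1..n}" "k \<in> A" "x \<in> ?Y (A - {k})" for A k x
    using F_edge[OF that(1,2)] A.closed_low_edge[OF cl that(1,2)] that(3)
    by (simp_all add: groupoid_functor_def interp_def closed_edge_def)
  have low_mul: "F A (eval R V (emul (fedge L A k)) (Tup x y)) =
      eval R V' (emul (fedge L A k)) (Tup (F A x) (F A y))"
      "eval R V (emul (fedge L A k)) (Tup x y) \<in> ?Y A"
    if "A \<subseteq> {1..n}" "k \<in> A" "composable (?Y A) (interp R V (fedge L A k)) x y" for A k x y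
    using F_edge[OF that(1,2)] A.closed_low_edge[OF cl that(1,2)] that(3)
    by (simp_all add: groupoid_functor_def interp_def closed_edge_def)
  have D_expr: "D C s (eval R V e x) (dq R V e s x v) = dq R V' e s (F A x) (D A s x v)"
    if e: "typed R (shp A) e (shp C)" and A: "A \<subseteq> {1..n}" and C: "C \<subseteq> {1..n}"
      and comm: "\<And>x. x \<in> ?Y A \<Longrightarrow> F C (eval R V e x) = eval R V' e (F A x)"
      and ran: "\<And>x. x \<in> ?Y A \<Longrightarrow> eval R V e x \<in> ?Y C"
      and x: "s \<in> I" "x \<in> ?Y A" "v \<in> pcarrier R V (shp A)" "A.shift s x v \<in> ?Y A" for A C e s x v
  proof (rule D_eq[OF C x(1) ran[OF x(2)]])
    note s = A.params_carrier[OF x(1)] and d = D[OF A x(1,2,4)]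
    show "dq R V' e s (F A x) (D A s x v) \<in> pcarrier R V' (shp C)"
      by (rule dq_closed[OF B.mod e FE[OF A x(2)] d(1) s])
    show "F C (A.shift s (eval R V e x) (dq R V e s x v)) =
        B.shift s (F C (eval R V e x)) (dq R V' e s (F A x) (D A s x v))"
      using eval_increment[OF A.mod e subsetD[OF A.low_vertex[OF A] x(2)] x(3) s]
        eval_increment[OF B.mod e FE[OF A x(2)] d(1) s] comm[OF x(2)] comm[OF x(4)] d(2) by simp
  qed
  have up: "groupoid_functor (A.mors (shp A) (?Y A)) (A.mors (shp (A - {k})) (?Y (A - {k})))
      (edge G (insert (Suc n) A) k) (B.mors (shp A) (?Y' A)) (B.mors (shp (A - {k})) (?Y' (A - {k})))
      (edge G' (insert (Suc n) A) k) (H (insert (Suc n) A)) (H (insert (Suc n) (A - {k})))"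
    if A: "A \<subseteq> {1..n}" and k: "k \<in> A" for A k
  proof -
    have Ak: "A - {k} \<subseteq> {1..n}" using A by auto
    note ty = A.low_typed[OF A k, unfolded typed_edge_def]
    note ee = B.upper_edge[OF A k, unfolded edges[OF A k]]
    note simps = A.ext_edge_simps[OF A.upper_edge[OF A k]] B.ext_edge_simps[OF ee]
      upper[OF A] upper[OF Ak]
    show ?thesis
      unfolding groupoid_functor_def
    proof (intro conjI ballI allI impI funcsetI H_mors[OF A] H_mors[OF Ak])
      {
        fix a assume "a \<in> A.mors (shp A) (?Y A)"
        then obtain s x v where a: "s \<in> I" "x \<in> ?Y A" "v \<in> pcarrier R V (shp A)"
            "A.shift s x v \<in> ?Y A" "a = mor s x v"
          by (rule A.morsE)
        show "gsrc (edge G' (insert (Suc n) A) k) (H (insert (Suc n) A) a) =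
            H (insert (Suc n) (A - {k})) (gsrc (edge G (insert (Suc n) A) k) a)"
          "gtgt (edge G' (insert (Suc n) A) k) (H (insert (Suc n) A) a) =
            H (insert (Suc n) (A - {k})) (gtgt (edge G (insert (Suc n) A) k) a)"
          using a D_expr[OF _ A Ak _ _ a(1-4)] ty low[OF A k] by (simp_all add: simps)
      }
      {
        fix a assume "a \<in> A.mors (shp (A - {k})) (?Y (A - {k}))"
        then obtain s x v where a: "s \<in> I" "x \<in> ?Y (A - {k})" "v \<in> pcarrier R V (shp (A - {k}))"
            "A.shift s x v \<in> ?Y (A - {k})" "a = mor s x v"
          by (rule A.morsE)
        show "H (insert (Suc n) A) (gunit (edge G (insert (Suc n) A) k) a) =
            gunit (edge G' (insert (Suc n) A) k) (H (insert (Suc n) (A - {k})) a)"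
          using a D_expr[OF _ Ak A _ _ a(1-4)] ty low_unit[OF A k] by (simp add: simps)
      }
      {
        fix a b assume "composable (A.mors (shp A) (?Y A)) (edge G (insert (Suc n) A) k) a b"
        from A.composable_extE[OF A.low_typed[OF A k] A.upper_edge[OF A k] A.low_vertex[OF A] this]
        obtain s x v y w where a: "s \<in> I" "x \<in> ?Y A" "v \<in> pcarrier R V (shp A)" "A.shift s x v \<in> ?Y A"
            "y \<in> ?Y A" "w \<in> pcarrier R V (shp A)" "A.shift s y w \<in> ?Y A" "a = mor s x v" "b = mor s y w"
            "composable (?Y A) (interp R V (fedge L A k)) x y"
            "composable (?Y A) (interp R V (fedge L A k)) (A.shift s x v) (A.shift s y w)" .
        let ?m = "emul (fedge L A k)"
        note dx = D[OF A a(1,2,4)] and dy = D[OF A a(1,5,7)]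
        have xE: "x \<in> pcarrier R V (shp A)" "y \<in> pcarrier R V (shp A)"
          using A.low_vertex[OF A] a by auto
        have "D A s (eval R V ?m (Tup x y)) (dq R V ?m s (Tup x y) (Tup v w)) =
            dq R V' ?m s (Tup (F A x) (F A y)) (Tup (D A s x v) (D A s y w))"
        proof (rule D_eq[OF A a(1) low_mul(2)[OF A k a(10)]])
          show "dq R V' ?m s (Tup (F A x) (F A y)) (Tup (D A s x v) (D A s y w)) \<in> pcarrier R V' (shp A)"
            by (rule B.pair_increment(2)[OF A.low_typed[OF A k] a(1) FE[OF A a(2)] dx(1) FE[OF A a(5)] dy(1)])
          show "F A (A.shift s (eval R V ?m (Tup x y)) (dq R V ?m s (Tup x y) (Tup v w))) =
              B.shift s (F A (eval R V ?m (Tup x y)))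
                (dq R V' ?m s (Tup (F A x) (F A y)) (Tup (D A s x v) (D A s y w)))"
            using A.pair_increment(1)[OF A.low_typed[OF A k] a(1) xE(1) a(3) xE(2) a(6)]
              B.pair_increment(1)[OF A.low_typed[OF A k] a(1) FE[OF A a(2)] dx(1) FE[OF A a(5)] dy(1)]
              low_mul(1)[OF A k a(10)] low_mul(1)[OF A k a(11)] dx(2) dy(2) by simp
        qed
        then show "H (insert (Suc n) A) (gmul (edge G (insert (Suc n) A) k) a b) =
            gmul (edge G' (insert (Suc n) A) k) (H (insert (Suc n) A) a) (H (insert (Suc n) A) b)"
          using a low_mul(1)[OF A k a(10)] by (simp add: simps)
      }
    qed
  qed
  have down: "groupoid_functor (A.obs (?Y A)) (A.obs (?Y (A - {k}))) (edge G A k)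
      (B.obs (?Y' A)) (B.obs (?Y' (A - {k}))) (edge G' A k) (H A) (H (A - {k}))"
    if A: "A \<subseteq> {1..n}" and k: "k \<in> A" for A k
  proof -
    have Ak: "A - {k} \<subseteq> {1..n}" using A by auto
    note ee = B.lower_edge[OF A k, unfolded edges[OF A k]]
    note simps = A.copy_edge_simps[OF A.lower_edge[OF A k]] B.copy_edge_simps[OF ee]
      lower[OF A] lower[OF Ak]
    show ?thesis
      unfolding groupoid_functor_def
      by (intro conjI ballI allI impI funcsetI H_obs[OF A] H_obs[OF Ak])
         (auto simp: simps low[OF A k] low_unit[OF A k] low_mul[OF A k]
           elim!: A.obsE A.composable_copyE[OF A.lower_edge[OF A k]])
  qed
  show ?thesis
    unfolding nfold_morphism_def
  proof (intro conjI allI impI ballI)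
    fix A assume "A \<subseteq> {1..Suc n}"
    then show "H A \<in> vertex G A \<rightarrow> vertex G' A"
    proof (cases rule: subset_atLeastAtMost_Suc_cases)
      case 1
      then show ?thesis using H_obs[OF 1(1)] by (simp add: A.lower_vertex B.lower_vertex)
    next
      case (2 C)
      then show ?thesis using H_mors[OF 2(1)] by (simp add: A.upper_vertex B.upper_vertex)
    qed
  next
    fix A k assume A: "A \<subseteq> {1..Suc n}" and k: "k \<in> A"
    from A show "groupoid_functor (vertex G A) (vertex G (A - {k})) (edge G A k)
        (vertex G' A) (vertex G' (A - {k})) (edge G' A k) (H A) (H (A - {k}))"
    proof (cases rule: subset_atLeastAtMost_Suc_cases)
      case 1
      moreover then have "A - {k} \<subseteq> {1..n}" by auto
      ultimately show ?thesis using down[OF 1(1) k] by (simp add: A.lower_vertex B.lower_vertex)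
    next
      case (2 C)
      show ?thesis
      proof (cases "k = Suc n")
        case True
        then have "A - {k} = C" using 2 by auto
        then show ?thesis
          using new[OF 2(1)] 2 True
          by (simp add: A.upper_vertex B.upper_vertex A.lower_vertex B.lower_vertex)
      next
        case False
        then have "k \<in> C" "insert (Suc n) C - {k} = insert (Suc n) (C - {k})" "C - {k} \<subseteq> {1..n}"
          using 2 k by auto
        then show ?thesis
          using up[OF 2(1)] 2 by (simp add: A.upper_vertex B.upper_vertex)
      qed
    qed
  qed
qed

lemma nfold_morphism_0:
  assumes "f \<in> U \<rightarrow> U'" and "\<And>p. F {} p = Vec (f (the_vec p))"
    and "vertex G {} = Vec ` U" and "vertex G' {} = Vec ` U'"
  shows "nfold_morphism 0 G G' F"
  using assms by (auto simp: nfold_morphism_def)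

lemma nfold_morphism_fin:
  assumes "module R V" and "module R V'" and "U \<subseteq> carrier V" and "U' \<subseteq> carrier V'" and "f \<in> U \<rightarrow> U'"
  shows "nfold_morphism n (realize R V (formal_ext R V (Units R) U n))
    (realize R V' (formal_ext R V' (Units R) U' n)) (fin_map R V V' f n)"
proof (induction n)
  case 0
  show ?case by (rule nfold_morphism_0[OF assms(5)]) (auto simp: realize_def formal_base_def)
next
  case (Suc n)
  have T: "Units R \<subseteq> carrier R" by (auto simp: Units_def)
  show ?case
  proof (rule nfold_morphism_Suc[OF first_order_extension_var[OF assms(1) T assms(3)]
        first_order_extension_var[OF assms(2) T assms(4)] _ order_refl
        closed_formal_ext[OF assms(1) T assms(3)] Suc.IH])
    fix A k assume A: "A \<subseteq> {1..n}" "k \<in> A"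
    show "fedge (formal_ext R V' (Units R) U' n) A k = fedge (formal_ext R V (Units R) U n) A k"
      using fedge_formal_ext_map[where h="\<lambda>c. c", OF refl A] by (simp add: map_gexprs_id)
  next
    fix A s x v assume A: "A \<subseteq> {1..n}"
    then have "insert (Suc n) A - {Suc n} = A" "Suc n \<notin> A" by auto
    then show "fin_map R V V' f (Suc n) (insert (Suc n) A) (Tup x (Tup v (Scal s))) =
        Tup (fin_map R V V' f n A x) (Tup (diff_quot R (pmod R V (ext_shape n A))
          (pmod R V' (ext_shape n A)) (fin_map R V V' f n A) x v s) (Scal s))"
      "fin_map R V V' f (Suc n) A (Tup x (Scal s)) = Tup (fin_map R V V' f n A x) (Scal s)"
      by (simp_all add: Let_def)
  qed
qed

lemma nfold_morphism_at:
  assumes "module R V" and "module R V'" and "U \<subseteq> carrier V" and "U' \<subseteq> carrier V'" and "f \<in> U \<rightarrow> U'"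
    and "t \<in> {1..n} \<rightarrow> Units R"
  shows "nfold_morphism n (realize R V (formal_at R V U t n))
    (realize R V' (formal_at R V' U' t n)) (at_map R V V' f t n)"
  using assms(6)
proof (induction n)
  case 0
  show ?case by (rule nfold_morphism_0[OF assms(5)]) (auto simp: realize_def formal_base_def)
next
  case (Suc n)
  have t: "t \<in> {1..Suc n} \<rightarrow> carrier R" "t \<in> {1..n} \<rightarrow> carrier R" "t \<in> {1..n} \<rightarrow> Units R"
    "{t (Suc n)} \<subseteq> Units R"
    using Suc.prems by (auto simp: Units_def Pi_def)
  show ?case
  proof (rule nfold_morphism_Suc[OF first_order_extension_at[OF assms(1) t(1) assms(3)]
        first_order_extension_at[OF assms(2) t(1) assms(4)] _ t(4)
        closed_formal_at[OF assms(1) t(2) assms(3)] Suc.IH[OF t(3)]])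
    fix A k assume A: "A \<subseteq> {1..n}" "k \<in> A"
    show "fedge (formal_at R V' U' t n) A k = fedge (formal_at R V U t n) A k"
      using fedge_formal_at_map[where h="\<lambda>c. c" and t=t, OF refl A]
      by (simp add: map_gexprs_id comp_def)
  next
    fix A s x v assume A: "A \<subseteq> {1..n}" and s: "s \<in> {t (Suc n)}"
    then have "insert (Suc n) A - {Suc n} = A" "Suc n \<notin> A" by auto
    then show "at_map R V V' f t (Suc n) (insert (Suc n) A) (Tup x v) =
        Tup (at_map R V V' f t n A x) (diff_quot R (pmod R V (at_shape n A))
          (pmod R V' (at_shape n A)) (at_map R V V' f t n A) x v s)"
      "at_map R V V' f t (Suc n) A x = at_map R V V' f t n A x"
      using s by (simp_all add: Let_def)
  qed
qed

theorem theorem6p1: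
  fixes R :: "('k, 'r) ring_scheme" and V :: "('k, 'v, 'm) module_scheme"
    and U :: "'v set" and n :: nat
  assumes "cring R" and "module R V" and "U \<subseteq> carrier V" and "U \<noteq> {}"
  shows "nfold_groupoid n (full_ext R V U n)
    \<and> nfold_groupoid n (fin_ext R V U n)
    \<and> (\<forall>t \<in> {1..n} \<rightarrow> carrier R. nfold_groupoid n (at_ext R V U t n))
    \<and> vertex (full_ext R V U n) {1..n} = iter_dom R V U n
    \<and> (\<forall>(V' :: ('k, 'w, 'p) module_scheme) U' f.
        module R V' \<and> U' \<subseteq> carrier V' \<and> U' \<noteq> {} \<and> f \<in> U \<rightarrow> U' \<longrightarrow>
          nfold_morphism n (fin_ext R V U n) (fin_ext R V' U' n) (fin_map R V V' f n)
          \<and> (\<forall>t \<in> {1..n} \<rightarrow> Units R.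
              nfold_morphism n (at_ext R V U t n) (at_ext R V' U' t n) (at_map R V V' f t n)))"
proof -
  have T: "Units R \<subseteq> carrier R" by (auto simp: Units_def)
  show ?thesis
    unfolding full_ext_def fin_ext_def at_ext_def
  proof (intro conjI ballI allI impI, goal_cases)
    case 1
    show ?case by (rule nfold_groupoid_formal_ext[OF assms(2) order_refl assms(3)])
  next
    case 2
    show ?case by (rule nfold_groupoid_formal_ext[OF assms(2) T assms(3)])
  next
    case (3 t)
    then show ?case by (rule nfold_groupoid_formal_at[OF assms(2) _ assms(3)])
  next
    case 4
    show ?case by (simp only: realize_def nfold.simps fvertex_top)
  next
    case 5
    then show ?case using nfold_morphism_fin[OF assms(2) _ assms(3)] by blast
  next
    case 6
    then show ?case using nfold_morphism_at[OF assms(2) _ assms(3)] by blast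
  qed
qed

end
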